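(* Let $R$ be a ring and $M$ a non-zero dual Baer right $R$-module. Consider the following conditions. (a) Every direct summand of $M$ is co-retractable. (b) $M=\bigoplus_{i\in I}M_i$ is a direct sum of co-prime $R$-modules with $\mathrm{Hom}_R(M_i,M_j)=0$ for $i\neq j$, such that each $M_i$ is a direct sum of indecomposable co-compressible modules that are mutually epi-invariant. Then (a) implies (b), and the converse is true if $I$ is a finite set (i.e. if $M$ has a decomposition as in (b) with $I$ finite, then (a) holds).
   Context: Rings have a unit element and modules are right unitary modules. Let $S=\mathrm{End}_R(M)$. $M$ is dual Baer if for every submodule $N\leq M$ the right ideal $\mathrm{Hom}_R(M,N)$ of $S$ equals $eS$ for some $e=e^2\in S$. An $R$-module $X$ is co-retractable if $\mathrm{Hom}_R(X/Y,X)\neq 0$ for every proper submodule $Y<X$. $X$ is co-prime if $X/Y$ generates $X$ for every proper submodule $Y<X$ (i.e. $X$ is a homomorphic image of a direct sum of copies of $X/Y$). $X$ is co-compressible if $X$ is a homomorphic image of every nonzero factor module of $X$. Modules $X$ and $Y$ are epi-invariant if $X$ is a homomorphic image of $Y$ and $Y$ is a homomorphic image of $X$. *)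

theory Defs
  imports "HOL-Algebra.Module" "HOL-Algebra.AbelCoset"
begin

section \<open>Right modules\<close>

text \<open>
  The locale \<open>module\<close> of HOL-Algebra is restricted to commutative rings. We reuse its record type,
  reading \<open>r \<odot>\<^bsub>M\<^esub> x\<close> as the right action \<open>x r\<close>; this is visible in \<open>smult_assoc\<close>. The record also has
  the inherited fields \<open>mult\<close> and \<open>one\<close>, which play no role. The library notion
  \<^term>\<open>submodule\<close> does not depend on commutativity and is used unchanged; a submodule \<open>N\<close> is
  regarded as a module in its own right via \<open>M\<lparr>carrier := N\<rparr>\<close>.
\<close>

locale right_module = R?: ring R + M?: abelian_group M
  for R :: "'a ring" (structure) and M :: "('a, 'b) module" (structure) +
  assumes smult_closed [simp, intro]:
      "\<lbrakk>r \<in> carrier R; x \<in> carrier M\<rbrakk> \<Longrightarrow> r \<odot>\<^bsub>M\<^esub> x \<in> carrier M"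
    and smult_l_distr:
      "\<lbrakk>r \<in> carrier R; s \<in> carrier R; x \<in> carrier M\<rbrakk> \<Longrightarrow>
        (r \<oplus>\<^bsub>R\<^esub> s) \<odot>\<^bsub>M\<^esub> x = r \<odot>\<^bsub>M\<^esub> x \<oplus>\<^bsub>M\<^esub> s \<odot>\<^bsub>M\<^esub> x"
    and smult_r_distr:
      "\<lbrakk>r \<in> carrier R; x \<in> carrier M; y \<in> carrier M\<rbrakk> \<Longrightarrow>
        r \<odot>\<^bsub>M\<^esub> (x \<oplus>\<^bsub>M\<^esub> y) = r \<odot>\<^bsub>M\<^esub> x \<oplus>\<^bsub>M\<^esub> r \<odot>\<^bsub>M\<^esub> y"
    and smult_assoc:
      "\<lbrakk>r \<in> carrier R; s \<in> carrier R; x \<in> carrier M\<rbrakk> \<Longrightarrow>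
        (r \<otimes>\<^bsub>R\<^esub> s) \<odot>\<^bsub>M\<^esub> x = s \<odot>\<^bsub>M\<^esub> (r \<odot>\<^bsub>M\<^esub> x)"
    and smult_one [simp]:
      "x \<in> carrier M \<Longrightarrow> \<one>\<^bsub>R\<^esub> \<odot>\<^bsub>M\<^esub> x = x"

definition nonzero_module :: "('a, 'b) module \<Rightarrow> bool" where
  "nonzero_module M \<longleftrightarrow> carrier M \<noteq> {\<zero>\<^bsub>M\<^esub>}"

section \<open>Homomorphisms\<close>

text \<open>
  Homomorphisms are extensional functions, so that equality of homomorphisms is equality in HOL and,
  for a submodule \<open>N\<close> of \<open>M\<close>, the set \<open>Hom(M, N)\<close> is literally a subset of \<open>End(M)\<close>.
\<close>

definition mod_hom :: "'a ring \<Rightarrow> ('a, 'b) module \<Rightarrow> ('a, 'c) module \<Rightarrow> ('b \<Rightarrow> 'c) set" where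
  "mod_hom R M N = {f \<in> carrier M \<rightarrow>\<^sub>E carrier N.
     (\<forall>x\<in>carrier M. \<forall>y\<in>carrier M. f (x \<oplus>\<^bsub>M\<^esub> y) = f x \<oplus>\<^bsub>N\<^esub> f y) \<and>
     (\<forall>r\<in>carrier R. \<forall>x\<in>carrier M. f (r \<odot>\<^bsub>M\<^esub> x) = r \<odot>\<^bsub>N\<^esub> f x)}"

definition zero_hom :: "('a, 'b) module \<Rightarrow> ('a, 'c) module \<Rightarrow> 'b \<Rightarrow> 'c" where
  "zero_hom M N = (\<lambda>x\<in>carrier M. \<zero>\<^bsub>N\<^esub>)"

definition End_ring :: "'a ring \<Rightarrow> ('a, 'b) module \<Rightarrow> ('b \<Rightarrow> 'b) ring" where
  "End_ring R M =
    \<lparr>carrier = mod_hom R M M,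
     mult = (\<lambda>f g. compose (carrier M) f g),
     one = (\<lambda>x\<in>carrier M. x),
     zero = zero_hom M M,
     add = (\<lambda>f g. \<lambda>x\<in>carrier M. f x \<oplus>\<^bsub>M\<^esub> g x)\<rparr>"

definition hom_image :: "'a ring \<Rightarrow> ('a, 'c) module \<Rightarrow> ('a, 'b) module \<Rightarrow> bool" where
  "hom_image R X Y \<longleftrightarrow> (\<exists>f \<in> mod_hom R Y X. f ` carrier Y = carrier X)"
  \<comment> \<open>\<open>X\<close> is a homomorphic image of \<open>Y\<close>\<close>

definition epi_invariant :: "'a ring \<Rightarrow> ('a, 'b) module \<Rightarrow> ('a, 'c) module \<Rightarrow> bool" where
  "epi_invariant R X Y \<longleftrightarrow> hom_image R X Y \<and> hom_image R Y X"

section \<open>Factor modules and direct sums\<close>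

definition factor_module :: "('a, 'b) module \<Rightarrow> 'b set \<Rightarrow> ('a, 'b set) module" where
  "factor_module X Y =
    \<lparr>carrier = a_rcosets\<^bsub>X\<^esub> Y, mult = undefined, one = undefined,
     zero = Y, add = set_add X,
     smult = (\<lambda>r C. \<Union>x\<in>C. Y +>\<^bsub>X\<^esub> (r \<odot>\<^bsub>X\<^esub> x))\<rparr>"

definition direct_sum :: "'i set \<Rightarrow> ('i \<Rightarrow> ('a, 'b) module) \<Rightarrow> ('a, 'i \<Rightarrow> 'b) module" where
  "direct_sum I F =
    \<lparr>carrier = {x \<in> \<Pi>\<^sub>E i\<in>I. carrier (F i). finite {i \<in> I. x i \<noteq> \<zero>\<^bsub>F i\<^esub>}},
     mult = undefined, one = undefined,
     zero = (\<lambda>i\<in>I. \<zero>\<^bsub>F i\<^esub>),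
     add = (\<lambda>x y. \<lambda>i\<in>I. x i \<oplus>\<^bsub>F i\<^esub> y i),
     smult = (\<lambda>r x. \<lambda>i\<in>I. r \<odot>\<^bsub>F i\<^esub> x i)\<rparr>"

text \<open>
  \<open>M\<close> is the internal direct sum of the submodules \<open>N i\<close>: the canonical map from the external direct
  sum to \<open>M\<close> is bijective.
\<close>

definition is_internal_direct_sum ::
    "'a ring \<Rightarrow> ('a, 'b) module \<Rightarrow> 'i set \<Rightarrow> ('i \<Rightarrow> 'b set) \<Rightarrow> bool" where
  "is_internal_direct_sum R M I N \<longleftrightarrow>
     (\<forall>i\<in>I. submodule (N i) R M) \<and>
     bij_betw (\<lambda>x. \<Oplus>\<^bsub>M\<^esub> i \<in> {i \<in> I. x i \<noteq> \<zero>\<^bsub>M\<^esub>}. x i)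
       (carrier (direct_sum I (\<lambda>i. M\<lparr>carrier := N i\<rparr>))) (carrier M)"

definition direct_summand :: "'a ring \<Rightarrow> 'b set \<Rightarrow> ('a, 'b) module \<Rightarrow> bool" where
  "direct_summand R N M \<longleftrightarrow> submodule N R M \<and>
     (\<exists>N'. submodule N' R M \<and> N \<inter> N' = {\<zero>\<^bsub>M\<^esub>} \<and> N <+>\<^bsub>M\<^esub> N' = carrier M)"

definition indecomposable :: "'a ring \<Rightarrow> ('a, 'b) module \<Rightarrow> bool" where
  "indecomposable R X \<longleftrightarrow> nonzero_module X \<and>
     (\<forall>N. direct_summand R N X \<longrightarrow> N = {\<zero>\<^bsub>X\<^esub>} \<or> N = carrier X)"

text \<open>
  \<open>G\<close> generates \<open>X\<close>. HOL cannot quantify over the type of the index set. The type chosen here can index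
  a copy of \<open>G\<close> by each homomorphism from \<open>G\<close> to \<open>X\<close>, so nothing is lost; see
  \<open>generates_if_hom_image\<close> below.
\<close>

definition generates :: "'a ring \<Rightarrow> ('a, 'c) module \<Rightarrow> ('a, 'b) module \<Rightarrow> bool" where
  "generates R G X \<longleftrightarrow> (\<exists>I :: ('c \<Rightarrow> 'b) set. hom_image R X (direct_sum I (\<lambda>_. G)))"

section \<open>Dual Baer, co-retractable, co-prime and co-compressible modules\<close>

definition dual_Baer :: "'a ring \<Rightarrow> ('a, 'b) module \<Rightarrow> bool" where
  "dual_Baer R M \<longleftrightarrow>
     (\<forall>N. submodule N R M \<longrightarrow>
       (\<exists>e \<in> carrier (End_ring R M).
          e \<otimes>\<^bsub>End_ring R M\<^esub> e = e \<and>
          mod_hom R M (M\<lparr>carrier := N\<rparr>) = e <#\<^bsub>End_ring R M\<^esub> carrier (End_ring R M)))"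

definition co_retractable :: "'a ring \<Rightarrow> ('a, 'b) module \<Rightarrow> bool" where
  "co_retractable R X \<longleftrightarrow>
     (\<forall>Y. submodule Y R X \<and> Y \<noteq> carrier X \<longrightarrow>
        mod_hom R (factor_module X Y) X \<noteq> {zero_hom (factor_module X Y) X})"

definition co_prime :: "'a ring \<Rightarrow> ('a, 'b) module \<Rightarrow> bool" where
  "co_prime R X \<longleftrightarrow>
     (\<forall>Y. submodule Y R X \<and> Y \<noteq> carrier X \<longrightarrow> generates R (factor_module X Y) X)"

definition co_compressible :: "'a ring \<Rightarrow> ('a, 'b) module \<Rightarrow> bool" where
  "co_compressible R X \<longleftrightarrow>
     (\<forall>Y. submodule Y R X \<and> nonzero_module (factor_module X Y) \<longrightarrow>
        hom_image R X (factor_module X Y))"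

section \<open>The two conditions\<close>

definition summands_co_retractable :: "'a ring \<Rightarrow> ('a, 'b) module \<Rightarrow> bool" where
  "summands_co_retractable R M \<longleftrightarrow>
     (\<forall>N. direct_summand R N M \<longrightarrow> co_retractable R (M\<lparr>carrier := N\<rparr>))"

text \<open>
  The type \<^typ>\<open>'b set\<close> of the inner index set is large enough: indecomposable summands are non-zero,
  hence pairwise distinct as submodules, so they can be indexed by themselves.
\<close>

definition sum_of_epi_invariant_co_compressibles :: "'a ring \<Rightarrow> ('a, 'b) module \<Rightarrow> bool" where
  "sum_of_epi_invariant_co_compressibles R X \<longleftrightarrow>
     (\<exists>(J :: 'b set set) K. is_internal_direct_sum R X J K \<and>
        (\<forall>j\<in>J. indecomposable R (X\<lparr>carrier := K j\<rparr>) \<and> co_compressible R (X\<lparr>carrier := K j\<rparr>)) \<and>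
        (\<forall>j\<in>J. \<forall>k\<in>J. epi_invariant R (X\<lparr>carrier := K j\<rparr>) (X\<lparr>carrier := K k\<rparr>)))"

definition co_prime_decomposition ::
    "'a ring \<Rightarrow> ('a, 'b) module \<Rightarrow> 'i set \<Rightarrow> ('i \<Rightarrow> 'b set) \<Rightarrow> bool" where
  "co_prime_decomposition R M I N \<longleftrightarrow>
     is_internal_direct_sum R M I N \<and>
     (\<forall>i\<in>I. co_prime R (M\<lparr>carrier := N i\<rparr>)) \<and>
     (\<forall>i\<in>I. \<forall>j\<in>I. i \<noteq> j \<longrightarrow>
        mod_hom R (M\<lparr>carrier := N i\<rparr>) (M\<lparr>carrier := N j\<rparr>) =
          {zero_hom (M\<lparr>carrier := N i\<rparr>) (M\<lparr>carrier := N j\<rparr>)}) \<and>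
     (\<forall>i\<in>I. sum_of_epi_invariant_co_compressibles R (M\<lparr>carrier := N i\<rparr>))"


section \<open>Basic facts\<close>

lemma right_moduleI:
  fixes R :: "'a ring" and M :: "('a, 'b) module"
  assumes "ring R"
    and add: "\<And>x y. x \<in> carrier M \<Longrightarrow> y \<in> carrier M \<Longrightarrow> x \<oplus>\<^bsub>M\<^esub> y \<in> carrier M"
    and zero: "\<zero>\<^bsub>M\<^esub> \<in> carrier M"
    and assoc: "\<And>x y z. x \<in> carrier M \<Longrightarrow> y \<in> carrier M \<Longrightarrow> z \<in> carrier M \<Longrightarrow>
      (x \<oplus>\<^bsub>M\<^esub> y) \<oplus>\<^bsub>M\<^esub> z = x \<oplus>\<^bsub>M\<^esub> (y \<oplus>\<^bsub>M\<^esub> z)"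
    and comm: "\<And>x y. x \<in> carrier M \<Longrightarrow> y \<in> carrier M \<Longrightarrow> x \<oplus>\<^bsub>M\<^esub> y = y \<oplus>\<^bsub>M\<^esub> x"
    and l_zero: "\<And>x. x \<in> carrier M \<Longrightarrow> \<zero>\<^bsub>M\<^esub> \<oplus>\<^bsub>M\<^esub> x = x"
    and l_inv: "\<And>x. x \<in> carrier M \<Longrightarrow> \<exists>y \<in> carrier M. y \<oplus>\<^bsub>M\<^esub> x = \<zero>\<^bsub>M\<^esub>"
    and "right_module_axioms R M"
  shows "right_module R M"
proof -
  have "abelian_group M"
    by (rule abelian_groupI) (use assms in auto)
  then show ?thesis
    using assms(1,8) by (simp add: right_module_def)
qed

lemma (in right_module) submodule_is_right_module:
  assumes "submodule H R M"
  shows "right_module R (M\<lparr>carrier := H\<rparr>)"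
proof -
  interpret H: submodule H R M by fact
  have sub: "x \<in> carrier M" if "x \<in> H" for x using that H.subset by auto
  have cl: "x \<oplus>\<^bsub>M\<^esub> y \<in> H" "\<zero>\<^bsub>M\<^esub> \<in> H" "\<ominus>\<^bsub>M\<^esub> x \<in> H" if "x \<in> H" "y \<in> H" for x y
    using that H.m_closed H.one_closed H.m_inv_closed by (simp_all add: a_inv_def)
  have zero: "\<zero>\<^bsub>M\<^esub> \<in> H" using H.one_closed by simp
  let ?N = "M\<lparr>carrier := H\<rparr>"
  show ?thesis
  proof (rule right_moduleI)
    show "right_module_axioms R ?N"
      by standard (simp_all add: sub smult_l_distr smult_r_distr smult_assoc H.smult_closed)
    show "\<exists>y\<in>carrier ?N. y \<oplus>\<^bsub>?N\<^esub> x = \<zero>\<^bsub>?N\<^esub>" if "x \<in> carrier ?N" for x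
      by (rule bexI[of _ "\<ominus>\<^bsub>M\<^esub> x"]) (use that in \<open>simp_all add: cl(3) sub M.l_neg\<close>)
    show "x \<oplus>\<^bsub>?N\<^esub> y = y \<oplus>\<^bsub>?N\<^esub> x" if "x \<in> carrier ?N" "y \<in> carrier ?N" for x y
      using that M.a_comm[OF sub sub, of x y] by simp
    show "(x \<oplus>\<^bsub>?N\<^esub> y) \<oplus>\<^bsub>?N\<^esub> z = x \<oplus>\<^bsub>?N\<^esub> (y \<oplus>\<^bsub>?N\<^esub> z)"
      if "x \<in> carrier ?N" "y \<in> carrier ?N" "z \<in> carrier ?N" for x y z
      using that M.a_assoc[OF sub sub sub, of x y z] by simp
  qed (simp_all add: sub cl(1) zero R.ring_axioms)
qed

lemma (in right_module) additive_subgroup_submodule: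
  assumes "submodule H R M"
  shows "abelian_subgroup H M"
  using assms M.abelian_group_axioms
  by (auto intro!: abelian_subgroupI3 additive_subgroup.intro submodule.axioms(1))

lemma (in right_module) smult_zero [simp]: "r \<in> carrier R \<Longrightarrow> r \<odot>\<^bsub>M\<^esub> \<zero>\<^bsub>M\<^esub> = \<zero>\<^bsub>M\<^esub>"
  using smult_r_distr[of r "\<zero>\<^bsub>M\<^esub>" "\<zero>\<^bsub>M\<^esub>"] by (simp add: M.add.l_cancel_one')

lemma (in right_module) factor_module_is_right_module:
  assumes "submodule Y R M"
  shows "right_module R (factor_module M Y)"
proof -
  interpret Y: abelian_subgroup Y M by (rule additive_subgroup_submodule) fact
  let ?F = "factor_module M Y"
  have sm: "r \<odot>\<^bsub>?F\<^esub> (Y +>\<^bsub>M\<^esub> x) = Y +>\<^bsub>M\<^esub> (r \<odot>\<^bsub>M\<^esub> x)" if r: "r \<in> carrier R" and x: "x \<in> carrier M" for r x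
  proof -
    have "Y +>\<^bsub>M\<^esub> (r \<odot>\<^bsub>M\<^esub> z) = Y +>\<^bsub>M\<^esub> (r \<odot>\<^bsub>M\<^esub> x)" if z: "z \<in> Y +>\<^bsub>M\<^esub> x" for z
    proof -
      obtain y where y: "y \<in> Y" "z = y \<oplus>\<^bsub>M\<^esub> x" using z by (auto simp: a_r_coset_def r_coset_def)
      have yM: "y \<in> carrier M" using y(1) Y.a_subset by auto
      have "r \<odot>\<^bsub>M\<^esub> z = r \<odot>\<^bsub>M\<^esub> y \<oplus>\<^bsub>M\<^esub> r \<odot>\<^bsub>M\<^esub> x" using y r x yM by (simp add: smult_r_distr)
      moreover have "r \<odot>\<^bsub>M\<^esub> y \<in> Y" using submodule.smult_closed[OF assms] r y by blast
      ultimately have "r \<odot>\<^bsub>M\<^esub> z \<in> Y +>\<^bsub>M\<^esub> (r \<odot>\<^bsub>M\<^esub> x)" by (auto simp: a_r_coset_def r_coset_def)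
      then show ?thesis
        using abelian_group.a_repr_independence[OF M.abelian_group_axioms, of _ Y] r x Y.a_subgroup
        by (metis smult_closed)
    qed
    then have "(\<Union>z\<in>Y +>\<^bsub>M\<^esub> x. Y +>\<^bsub>M\<^esub> (r \<odot>\<^bsub>M\<^esub> z)) = (\<Union>z\<in>Y +>\<^bsub>M\<^esub> x. Y +>\<^bsub>M\<^esub> (r \<odot>\<^bsub>M\<^esub> x))"
      by (rule SUP_cong[OF refl])
    also have "\<dots> = Y +>\<^bsub>M\<^esub> (r \<odot>\<^bsub>M\<^esub> x)" using Y.a_rcos_self[OF x] by blast
    finally show ?thesis by (simp add: factor_module_def)
  qed
  have ex: "\<exists>x\<in>carrier M. C = Y +>\<^bsub>M\<^esub> x" if "C \<in> carrier ?F" for C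
    using that by (auto simp: factor_module_def A_RCOSETS_def')
  have cl: "Y +>\<^bsub>M\<^esub> x \<in> carrier ?F" if "x \<in> carrier M" for x
    using that by (auto simp: factor_module_def A_RCOSETS_def')
  have ad: "(Y +>\<^bsub>M\<^esub> x) \<oplus>\<^bsub>?F\<^esub> (Y +>\<^bsub>M\<^esub> y) = Y +>\<^bsub>M\<^esub> (x \<oplus>\<^bsub>M\<^esub> y)" if "x \<in> carrier M" "y \<in> carrier M" for x y
    using that by (simp add: factor_module_def Y.a_rcos_sum)
  have zr: "\<zero>\<^bsub>?F\<^esub> = Y +>\<^bsub>M\<^esub> \<zero>\<^bsub>M\<^esub>" by (simp add: factor_module_def M.a_coset_add_zero[OF Y.a_subset])
  define rep where "rep C = (SOME x. x \<in> carrier M \<and> C = Y +>\<^bsub>M\<^esub> x)" for C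
  have rep: "rep C \<in> carrier M" "C = Y +>\<^bsub>M\<^esub> rep C" if "C \<in> carrier ?F" for C
    using someI_ex[of "\<lambda>x. x \<in> carrier M \<and> C = Y +>\<^bsub>M\<^esub> x"] ex[OF that] unfolding rep_def by blast+
  have ad': "C \<oplus>\<^bsub>?F\<^esub> D = Y +>\<^bsub>M\<^esub> (rep C \<oplus>\<^bsub>M\<^esub> rep D)" if "C \<in> carrier ?F" "D \<in> carrier ?F" for C D
    using ad[OF rep(1) rep(1), OF that] rep(2)[OF that(1)] rep(2)[OF that(2)] by argo
  have sm': "r \<odot>\<^bsub>?F\<^esub> C = Y +>\<^bsub>M\<^esub> (r \<odot>\<^bsub>M\<^esub> rep C)" if "r \<in> carrier R" "C \<in> carrier ?F" for r C
    using sm[OF that(1) rep(1)[OF that(2)]] rep(2)[OF that(2)] by argo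
  show ?thesis
  proof (rule right_moduleI)
    show "right_module_axioms R ?F"
    proof
      fix r s C D
      assume r: "r \<in> carrier R" and s: "s \<in> carrier R" and C: "C \<in> carrier ?F" and D: "D \<in> carrier ?F"
      show "(r \<oplus>\<^bsub>R\<^esub> s) \<odot>\<^bsub>?F\<^esub> C = r \<odot>\<^bsub>?F\<^esub> C \<oplus>\<^bsub>?F\<^esub> s \<odot>\<^bsub>?F\<^esub> C"
        using r s C rep(1)[OF C] by (simp add: sm' ad smult_l_distr)
      show "r \<odot>\<^bsub>?F\<^esub> (C \<oplus>\<^bsub>?F\<^esub> D) = r \<odot>\<^bsub>?F\<^esub> C \<oplus>\<^bsub>?F\<^esub> r \<odot>\<^bsub>?F\<^esub> D"
        using r C D rep(1)[OF C] rep(1)[OF D] by (simp add: sm' ad' sm ad smult_r_distr)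
      show "(r \<otimes>\<^bsub>R\<^esub> s) \<odot>\<^bsub>?F\<^esub> C = s \<odot>\<^bsub>?F\<^esub> (r \<odot>\<^bsub>?F\<^esub> C)"
        using r s C rep(1)[OF C] by (simp add: sm' sm smult_assoc)
    next
      fix r C assume r: "r \<in> carrier R" and C: "C \<in> carrier ?F"
      show "r \<odot>\<^bsub>?F\<^esub> C \<in> carrier ?F" using r C rep(1)[OF C] by (simp add: sm' cl)
    next
      fix C assume C: "C \<in> carrier ?F"
      show "\<one>\<^bsub>R\<^esub> \<odot>\<^bsub>?F\<^esub> C = C"
        using sm'[OF R.one_closed C] rep(2)[OF C] smult_one[OF rep(1)[OF C]] by argo
    qed
    fix C D E
    assume C: "C \<in> carrier ?F"
    show "\<zero>\<^bsub>?F\<^esub> \<oplus>\<^bsub>?F\<^esub> C = C"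
      using ad[OF M.zero_closed rep(1)[OF C]] rep[OF C] zr M.l_zero[OF rep(1)[OF C]] by argo
    have "(Y +>\<^bsub>M\<^esub> (\<ominus>\<^bsub>M\<^esub> rep C)) \<oplus>\<^bsub>?F\<^esub> C = \<zero>\<^bsub>?F\<^esub>"
      using ad[OF M.a_inv_closed[OF rep(1)[OF C]] rep(1)[OF C]] rep(2)[OF C] zr M.l_neg[OF rep(1)[OF C]] by argo
    then show "\<exists>D\<in>carrier ?F. D \<oplus>\<^bsub>?F\<^esub> C = \<zero>\<^bsub>?F\<^esub>"
      using cl[OF M.a_inv_closed[OF rep(1)[OF C]]] by blast
    assume D: "D \<in> carrier ?F"
    show "C \<oplus>\<^bsub>?F\<^esub> D \<in> carrier ?F" using C D rep(1)[OF C] rep(1)[OF D] by (simp add: ad' cl)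
    show "C \<oplus>\<^bsub>?F\<^esub> D = D \<oplus>\<^bsub>?F\<^esub> C"
      using ad'[OF C D] ad'[OF D C] M.a_comm[OF rep(1)[OF C] rep(1)[OF D]] by argo
    assume E: "E \<in> carrier ?F"
    note r = rep(1)[OF C] rep(1)[OF D] rep(1)[OF E]
    show "(C \<oplus>\<^bsub>?F\<^esub> D) \<oplus>\<^bsub>?F\<^esub> E = C \<oplus>\<^bsub>?F\<^esub> (D \<oplus>\<^bsub>?F\<^esub> E)"
      using ad[OF M.a_closed[OF r(1,2)] r(3)] ad[OF r(1) M.a_closed[OF r(2,3)]]
        ad'[OF C D] ad'[OF D E] rep(2)[OF C] rep(2)[OF E] M.a_assoc[OF r] by argo
  qed (simp_all only: zr cl M.zero_closed R.ring_axioms)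
qed

lemma direct_sum_is_right_module:
  fixes F :: "'i \<Rightarrow> ('a, 'b) module"
  assumes "ring R" and F: "\<And>i. i \<in> I \<Longrightarrow> right_module R (F i)"
  shows "right_module R (direct_sum I F)"
proof -
  have G: "abelian_group (F i)" and G': "abelian_monoid (F i)" if "i \<in> I" for i
    using F[OF that] by (simp_all add: right_module_def abelian_group_def)
  have minus_zero: "\<ominus>\<^bsub>F i\<^esub> \<zero>\<^bsub>F i\<^esub> = \<zero>\<^bsub>F i\<^esub>" if "i \<in> I" for i
    using abelian_group.minus_equality[OF G[OF that]] abelian_monoid.zero_closed[OF G'[OF that]]
      abelian_monoid.l_zero[OF G'[OF that]] by blast
  note simps = abelian_monoid.a_closed[OF G'] abelian_monoid.zero_closed[OF G']
    abelian_monoid.l_zero[OF G'] abelian_group.a_inv_closed[OF G]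
    minus_zero abelian_group.l_neg[OF G]
    right_module.smult_closed[OF F] right_module.smult_zero[OF F] right_module.smult_one[OF F]
  let ?D = "direct_sum I F"
  have fin: "finite {i. (i \<in> I \<longrightarrow> f i \<noteq> \<zero>\<^bsub>F i\<^esub>) \<and> i \<in> I}"
    if "finite {i \<in> I. x i \<noteq> \<zero>\<^bsub>F i\<^esub>}" "finite {i \<in> I. y i \<noteq> \<zero>\<^bsub>F i\<^esub>}"
      "\<And>i. i \<in> I \<Longrightarrow> x i = \<zero>\<^bsub>F i\<^esub> \<Longrightarrow> y i = \<zero>\<^bsub>F i\<^esub> \<Longrightarrow> f i = \<zero>\<^bsub>F i\<^esub>" for f x y
    by (rule finite_subset[of _ "{i \<in> I. x i \<noteq> \<zero>\<^bsub>F i\<^esub>} \<union> {i \<in> I. y i \<noteq> \<zero>\<^bsub>F i\<^esub>}"]) (use that in auto)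
  have fin': "finite {i \<in> I. x i \<noteq> \<zero>\<^bsub>F i\<^esub>}" if "x \<in> carrier ?D" for x
    using that by (simp add: direct_sum_def)
  have add: "x \<oplus>\<^bsub>?D\<^esub> y \<in> carrier ?D" if "x \<in> carrier ?D" "y \<in> carrier ?D" for x y
    using that fin[OF fin'[OF that(1)] fin'[OF that(2)], of "\<lambda>i. x i \<oplus>\<^bsub>F i\<^esub> y i"]
    by (auto simp: direct_sum_def PiE_iff simps)
  have sm: "r \<odot>\<^bsub>?D\<^esub> x \<in> carrier ?D" if "r \<in> carrier R" "x \<in> carrier ?D" for r x
    using that fin[OF fin'[OF that(2)] fin'[OF that(2)], of "\<lambda>i. r \<odot>\<^bsub>F i\<^esub> x i"]
    by (auto simp: direct_sum_def PiE_iff simps)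
  have neg: "(\<lambda>i\<in>I. \<ominus>\<^bsub>F i\<^esub> x i) \<in> carrier ?D" if "x \<in> carrier ?D" for x
    using that fin[OF fin'[OF that] fin'[OF that], of "\<lambda>i. \<ominus>\<^bsub>F i\<^esub> x i"]
    by (auto simp: direct_sum_def PiE_iff simps)
  show ?thesis
  proof (rule right_moduleI)
    show "\<exists>y\<in>carrier ?D. y \<oplus>\<^bsub>?D\<^esub> x = \<zero>\<^bsub>?D\<^esub>" if x: "x \<in> carrier ?D" for x
      by (rule bexI[OF _ neg[OF x]])
        (use x in \<open>auto simp: direct_sum_def PiE_iff simps intro!: restrict_ext\<close>)
    show "right_module_axioms R ?D"
    proof
      show "r \<odot>\<^bsub>?D\<^esub> x \<in> carrier ?D" if "r \<in> carrier R" "x \<in> carrier ?D" for r x by (rule sm[OF that])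
      show "\<one>\<^bsub>R\<^esub> \<odot>\<^bsub>?D\<^esub> x = x" if "x \<in> carrier ?D" for x
        using that by (auto simp: direct_sum_def PiE_iff simps intro!: extensionalityI[of _ I])
    qed (auto simp: direct_sum_def PiE_iff right_module.smult_l_distr[OF F]
          right_module.smult_r_distr[OF F] right_module.smult_assoc[OF F] intro!: restrict_ext)
    show "\<zero>\<^bsub>?D\<^esub> \<in> carrier ?D" by (auto simp: direct_sum_def simps)
    show "\<zero>\<^bsub>?D\<^esub> \<oplus>\<^bsub>?D\<^esub> x = x" if "x \<in> carrier ?D" for x
      using that by (auto simp: direct_sum_def PiE_iff simps intro!: extensionalityI[of _ I])
    show "(x \<oplus>\<^bsub>?D\<^esub> y) \<oplus>\<^bsub>?D\<^esub> z = x \<oplus>\<^bsub>?D\<^esub> (y \<oplus>\<^bsub>?D\<^esub> z)"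
      if "x \<in> carrier ?D" "y \<in> carrier ?D" "z \<in> carrier ?D" for x y z
      using that by (auto simp: direct_sum_def PiE_iff abelian_monoid.a_assoc[OF G'] intro!: restrict_ext)
    show "x \<oplus>\<^bsub>?D\<^esub> y = y \<oplus>\<^bsub>?D\<^esub> x" if "x \<in> carrier ?D" "y \<in> carrier ?D" for x y
      using that by (auto simp: direct_sum_def PiE_iff abelian_monoid.a_comm[OF G'] intro!: restrict_ext)
  qed (use assms(1) add in auto)
qed

text \<open>
  If some direct sum of copies of \<open>G\<close>, with index set of any type, maps onto \<open>X\<close>, then so does one
  whose index set has the type used in \<^const>\<open>generates\<close>.
\<close>

lemma generates_if_hom_image:
  fixes J :: "'j set" and G :: "('a, 'c) module" and X :: "('a, 'b) module"
  assumes G: "right_module R G" and X: "right_module R X"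
    and h: "hom_image R X (direct_sum J (\<lambda>_. G))"
  shows "generates R G X"
proof -
  interpret G: right_module R G by fact
  interpret X: right_module R X by fact
  define I where "I = mod_hom R G X"
  define D where "D = direct_sum I (\<lambda>_. G)"
  define supp where "supp x = {f \<in> I. x f \<noteq> \<zero>\<^bsub>G\<^esub>}" for x :: "('c \<Rightarrow> 'b) \<Rightarrow> 'c"
  define \<Phi> where "\<Phi> = (\<lambda>x\<in>carrier D. \<Oplus>\<^bsub>X\<^esub> f \<in> supp x. f (x f))"
  interpret D: right_module R D
    unfolding D_def by (rule direct_sum_is_right_module) (rule G.R.ring_axioms, rule G)
  have fin: "finite (supp x)" if "x \<in> carrier D" for x
    using that by (simp add: D_def direct_sum_def supp_def)
  have xG: "x f \<in> carrier G" if "x \<in> carrier D" "f \<in> I" for x f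
    using that by (auto simp: D_def direct_sum_def)
  have fX: "f g \<in> carrier X" if "f \<in> I" "g \<in> carrier G" for f g
    using that by (auto simp: I_def mod_hom_def)
  have fadd: "f (g \<oplus>\<^bsub>G\<^esub> g') = f g \<oplus>\<^bsub>X\<^esub> f g'" if "f \<in> I" "g \<in> carrier G" "g' \<in> carrier G" for f g g'
    using that by (auto simp: I_def mod_hom_def)
  have fsm: "f (r \<odot>\<^bsub>G\<^esub> g) = r \<odot>\<^bsub>X\<^esub> f g" if "f \<in> I" "g \<in> carrier G" "r \<in> carrier R" for f g r
    using that by (auto simp: I_def mod_hom_def)
  have f0: "f \<zero>\<^bsub>G\<^esub> = \<zero>\<^bsub>X\<^esub>" if "f \<in> I" for f
    using fadd[OF that, of "\<zero>\<^bsub>G\<^esub>" "\<zero>\<^bsub>G\<^esub>"] fX[OF that, of "\<zero>\<^bsub>G\<^esub>"] by (simp add: X.M.add.l_cancel_one')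
  have \<Phi>: "\<Phi> x = (\<Oplus>\<^bsub>X\<^esub> f \<in> A. f (x f))"
    if "x \<in> carrier D" "finite A" "supp x \<subseteq> A" "A \<subseteq> I" for x A
  proof -
    have "(\<Oplus>\<^bsub>X\<^esub> f \<in> supp x. f (x f)) = (\<Oplus>\<^bsub>X\<^esub> f \<in> A. f (x f))"
      by (rule X.M.add.finprod_mono_neutral_cong_left)
        (use that xG fX f0 in \<open>auto simp: supp_def\<close>)
    then show ?thesis using that by (simp add: \<Phi>_def)
  qed
  have \<Phi>_closed: "\<Phi> x \<in> carrier X" if "x \<in> carrier D" for x
    using that xG fX by (auto simp: \<Phi>_def supp_def intro!: X.M.finsum_closed)
  have suppI: "supp x \<subseteq> I" for x by (auto simp: supp_def)
  have addD: "(x \<oplus>\<^bsub>D\<^esub> y) f = x f \<oplus>\<^bsub>G\<^esub> y f" if "f \<in> I" for x y f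
    using that by (simp add: D_def direct_sum_def)
  have smD: "(r \<odot>\<^bsub>D\<^esub> x) f = r \<odot>\<^bsub>G\<^esub> x f" if "f \<in> I" for r x f
    using that by (simp add: D_def direct_sum_def)
  have \<Phi>_add: "\<Phi> (x \<oplus>\<^bsub>D\<^esub> y) = \<Phi> x \<oplus>\<^bsub>X\<^esub> \<Phi> y" if x: "x \<in> carrier D" and y: "y \<in> carrier D" for x y
  proof -
    let ?A = "supp x \<union> supp y"
    have A: "finite ?A" "?A \<subseteq> I" "f \<in> ?A \<Longrightarrow> f \<in> I" for f using fin x y suppI by auto
    have "supp (x \<oplus>\<^bsub>D\<^esub> y) \<subseteq> ?A" by (auto simp: supp_def addD)
    then have "\<Phi> (x \<oplus>\<^bsub>D\<^esub> y) = (\<Oplus>\<^bsub>X\<^esub> f \<in> ?A. f ((x \<oplus>\<^bsub>D\<^esub> y) f))" using A x y by (intro \<Phi>) auto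
    also have "\<dots> = (\<Oplus>\<^bsub>X\<^esub> f \<in> ?A. f (x f) \<oplus>\<^bsub>X\<^esub> f (y f))"
      by (rule X.M.finsum_cong') (use A(3) x y in \<open>auto simp: addD fadd xG fX\<close>)
    also have "\<dots> = (\<Oplus>\<^bsub>X\<^esub> f \<in> ?A. f (x f)) \<oplus>\<^bsub>X\<^esub> (\<Oplus>\<^bsub>X\<^esub> f \<in> ?A. f (y f))"
      by (rule X.M.finsum_addf) (use A(3) x y in \<open>auto simp: xG fX\<close>)
    also have "\<dots> = \<Phi> x \<oplus>\<^bsub>X\<^esub> \<Phi> y" using \<Phi>[OF x A(1) _ A(2)] \<Phi>[OF y A(1) _ A(2)] by simp
    finally show ?thesis .
  qed
  have finsum_smult: "(\<Oplus>\<^bsub>X\<^esub> f \<in> A. r \<odot>\<^bsub>X\<^esub> u f) = r \<odot>\<^bsub>X\<^esub> (\<Oplus>\<^bsub>X\<^esub> f \<in> A. u f)"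
    if "finite A" "u \<in> A \<rightarrow> carrier X" "r \<in> carrier R" for A and u :: "('c \<Rightarrow> 'b) \<Rightarrow> 'b" and r
    using that(1,2)
  proof (induction A)
    case (insert a A)
    then have "u \<in> A \<rightarrow> carrier X" "(\<lambda>f. r \<odot>\<^bsub>X\<^esub> u f) \<in> A \<rightarrow> carrier X" "u a \<in> carrier X"
      using that(3) by auto
    with insert that(3) show ?case by (simp add: X.smult_r_distr)
  qed (use that(3) in simp)
  have \<Phi>_sm: "\<Phi> (r \<odot>\<^bsub>D\<^esub> x) = r \<odot>\<^bsub>X\<^esub> \<Phi> x" if x: "x \<in> carrier D" and r: "r \<in> carrier R" for x r
  proof -
    have A: "f \<in> supp x \<Longrightarrow> f \<in> I" for f using suppI by auto
    have "supp (r \<odot>\<^bsub>D\<^esub> x) \<subseteq> supp x" using r by (auto simp: supp_def smD)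
    then have "\<Phi> (r \<odot>\<^bsub>D\<^esub> x) = (\<Oplus>\<^bsub>X\<^esub> f \<in> supp x. f ((r \<odot>\<^bsub>D\<^esub> x) f))"
      using fin[OF x] suppI x r by (intro \<Phi>) auto
    also have "\<dots> = (\<Oplus>\<^bsub>X\<^esub> f \<in> supp x. r \<odot>\<^bsub>X\<^esub> f (x f))"
      by (rule X.M.finsum_cong') (use A x r in \<open>auto simp: smD fsm xG fX\<close>)
    also have "\<dots> = r \<odot>\<^bsub>X\<^esub> (\<Oplus>\<^bsub>X\<^esub> f \<in> supp x. f (x f))"
      by (rule finsum_smult) (use fin[OF x] A x r xG fX in auto)
    finally show ?thesis using x by (simp add: \<Phi>_def)
  qed
  have \<Phi>_hom: "\<Phi> \<in> mod_hom R D X"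
    using \<Phi>_closed \<Phi>_add \<Phi>_sm by (auto simp: mod_hom_def \<Phi>_def)
  have in_im: "f g \<in> \<Phi> ` carrier D" if f: "f \<in> I" and g: "g \<in> carrier G" for f g
  proof -
    let ?x = "\<lambda>k\<in>I. if k = f then g else \<zero>\<^bsub>G\<^esub>"
    have s: "supp ?x \<subseteq> {f}" by (auto simp: supp_def)
    then have "finite (supp ?x)" using finite_subset by blast
    then have x: "?x \<in> carrier D" using g by (auto simp: D_def direct_sum_def supp_def)
    have "\<Phi> ?x = (\<Oplus>\<^bsub>X\<^esub> k \<in> {f}. k (?x k))" by (rule \<Phi>) (use x s f in auto)
    also have "\<dots> = f g" using f g fX[OF f g] by simp
    finally show ?thesis using imageI[OF x, of \<Phi>] by argo
  qed
  have im_add: "u \<oplus>\<^bsub>X\<^esub> v \<in> \<Phi> ` carrier D" if u: "u \<in> \<Phi> ` carrier D" and v: "v \<in> \<Phi> ` carrier D" for u v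
  proof -
    obtain x where x: "x \<in> carrier D" "u = \<Phi> x" using u by (rule imageE)
    obtain y where y: "y \<in> carrier D" "v = \<Phi> y" using v by (rule imageE)
    show ?thesis unfolding x(2) y(2) \<Phi>_add[OF x(1) y(1), symmetric]
      by (rule imageI) (rule D.M.a_closed[OF x(1) y(1)])
  qed
  have im_0: "\<zero>\<^bsub>X\<^esub> \<in> \<Phi> ` carrier D"
  proof (rule image_eqI)
    have "supp \<zero>\<^bsub>D\<^esub> = {}" by (auto simp: supp_def D_def direct_sum_def)
    then show "\<zero>\<^bsub>X\<^esub> = \<Phi> \<zero>\<^bsub>D\<^esub>" using \<Phi>[OF D.M.zero_closed, of "{}"] by simp
  qed (rule D.M.zero_closed)

  define E where "E = direct_sum J (\<lambda>_. G)"
  interpret E: right_module R E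
    unfolding E_def by (rule direct_sum_is_right_module) (rule G.R.ring_axioms, rule G)
  obtain h where h: "h \<in> mod_hom R E X" and onto: "h ` carrier E = carrier X"
    using h by (auto simp: hom_image_def E_def)
  have hadd: "h (x \<oplus>\<^bsub>E\<^esub> y) = h x \<oplus>\<^bsub>X\<^esub> h y" if "x \<in> carrier E" "y \<in> carrier E" for x y
    using that h by (auto simp: mod_hom_def)
  have hsm: "h (r \<odot>\<^bsub>E\<^esub> x) = r \<odot>\<^bsub>X\<^esub> h x" if "x \<in> carrier E" "r \<in> carrier R" for x r
    using that h by (auto simp: mod_hom_def)
  define \<iota> where "\<iota> j g = (\<lambda>k\<in>J. if k = j then g else \<zero>\<^bsub>G\<^esub>)" for j and g
  have \<iota>: "\<iota> j g \<in> carrier E" if "g \<in> carrier G" for j g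
  proof -
    have "finite {k \<in> J. \<iota> j g k \<noteq> \<zero>\<^bsub>G\<^esub>}"
      by (rule finite_subset[of _ "{j}"]) (auto simp: \<iota>_def)
    then show ?thesis using that by (auto simp: E_def direct_sum_def \<iota>_def)
  qed
  have comp: "(\<lambda>g\<in>carrier G. h (\<iota> j g)) \<in> I" for j
  proof -
    have a: "\<iota> j (g \<oplus>\<^bsub>G\<^esub> g') = \<iota> j g \<oplus>\<^bsub>E\<^esub> \<iota> j g'" if "g \<in> carrier G" "g' \<in> carrier G" for g g'
      using that by (auto simp: \<iota>_def E_def direct_sum_def intro!: restrict_ext)
    have b: "\<iota> j (r \<odot>\<^bsub>G\<^esub> g) = r \<odot>\<^bsub>E\<^esub> \<iota> j g" if "g \<in> carrier G" "r \<in> carrier R" for g r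
      using that by (auto simp: \<iota>_def E_def direct_sum_def intro!: restrict_ext)
    have "h (\<iota> j g) \<in> carrier X" if "g \<in> carrier G" for g
      using \<iota>[OF that] h by (auto simp: mod_hom_def)
    then show ?thesis
      by (simp add: I_def mod_hom_def a b hadd hsm \<iota>)
  qed
  have "h y \<in> \<Phi> ` carrier D" if "finite A" "y \<in> carrier E" "{j \<in> J. y j \<noteq> \<zero>\<^bsub>G\<^esub>} \<subseteq> A" for A y
    using that
  proof (induction A arbitrary: y)
    case empty
    then have "y = \<zero>\<^bsub>E\<^esub>"
      by (auto simp: E_def direct_sum_def PiE_iff intro!: extensionalityI[of _ J])
    moreover have "h \<zero>\<^bsub>E\<^esub> \<in> carrier X" using h by (auto simp: mod_hom_def)
    ultimately have "h y = \<zero>\<^bsub>X\<^esub>"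
      using hadd[of "\<zero>\<^bsub>E\<^esub>" "\<zero>\<^bsub>E\<^esub>"] by (simp add: X.M.add.l_cancel_one')
    then show ?case using im_0 by simp
  next
    case (insert a A)
    show ?case
    proof (cases "a \<in> J")
      case False
      with insert show ?thesis by blast
    next
      case True
      let ?y = "\<lambda>k\<in>J. if k = a then \<zero>\<^bsub>G\<^esub> else y k"
      have ya: "y a \<in> carrier G" using insert.prems True by (auto simp: E_def direct_sum_def)
      have s: "{j \<in> J. ?y j \<noteq> \<zero>\<^bsub>G\<^esub>} \<subseteq> A" using insert.prems by auto
      then have "finite {j \<in> J. ?y j \<noteq> \<zero>\<^bsub>G\<^esub>}" using insert.hyps finite_subset by blast
      then have y': "?y \<in> carrier E" using insert.prems by (auto simp: E_def direct_sum_def)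
      have y: "y = \<iota> a (y a) \<oplus>\<^bsub>E\<^esub> ?y"
        using insert.prems
        by (auto simp: E_def direct_sum_def \<iota>_def PiE_iff intro!: extensionalityI[of _ J])
      have "h y = h (\<iota> a (y a)) \<oplus>\<^bsub>X\<^esub> h ?y"
        using arg_cong[OF y, of h] hadd[OF \<iota>[OF ya] y'] by (rule trans)
      moreover have im: "h (\<iota> a (y a)) \<in> \<Phi> ` carrier D" using in_im[OF comp ya, of a] ya by simp
      ultimately show ?thesis using im_add[OF im insert.IH[OF y' s]] by argo
    qed
  qed
  then have "carrier X \<subseteq> \<Phi> ` carrier D"
    unfolding onto[symmetric] by (auto simp: E_def direct_sum_def)
  then have "\<Phi> ` carrier D = carrier X" using \<Phi>_closed by auto
  with \<Phi>_hom show ?thesis by (auto simp: generates_def hom_image_def D_def)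
qed

lemma (in right_module) End_ring_is_ring: "ring (End_ring R M)"
proof (rule ringI)
  show "abelian_group (End_ring R M)"
  proof (rule abelian_groupI)
    show "\<exists>g\<in>carrier (End_ring R M). g \<oplus>\<^bsub>End_ring R M\<^esub> f = \<zero>\<^bsub>End_ring R M\<^esub>"
      if "f \<in> carrier (End_ring R M)" for f
    proof (rule bexI)
      show "(\<lambda>x\<in>carrier M. \<ominus>\<^bsub>M\<^esub> f x) \<oplus>\<^bsub>End_ring R M\<^esub> f = \<zero>\<^bsub>End_ring R M\<^esub>"
        using that by (auto simp: End_ring_def mod_hom_def zero_hom_def PiE_iff M.l_neg intro!: restrict_ext)
      have sneg: "\<ominus>\<^bsub>M\<^esub> (r \<odot>\<^bsub>M\<^esub> x) = r \<odot>\<^bsub>M\<^esub> (\<ominus>\<^bsub>M\<^esub> x)" if "r \<in> carrier R" "x \<in> carrier M" for r x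
        using that smult_r_distr[of r "\<ominus>\<^bsub>M\<^esub> x" x] by (simp add: M.l_neg M.minus_equality)
      show "(\<lambda>x\<in>carrier M. \<ominus>\<^bsub>M\<^esub> f x) \<in> carrier (End_ring R M)"
        using that by (auto simp: End_ring_def mod_hom_def PiE_iff M.minus_add sneg)
    qed
  qed (auto simp: End_ring_def mod_hom_def zero_hom_def PiE_iff extensional_def restrict_def fun_eq_iff M.a_ac smult_r_distr)
  show "Group.monoid (End_ring R M)"
    by (rule monoidI) (auto simp: End_ring_def mod_hom_def PiE_iff compose_def extensional_def restrict_def fun_eq_iff)
qed (auto simp: End_ring_def mod_hom_def PiE_iff compose_def extensional_def restrict_def fun_eq_iff)

end

theory Submission
  imports Defs
begin

text \<open>
  If \<open>M\<close> is dual Baer, then any sum of images of endomorphisms of \<open>M\<close> is a direct summand. So unions of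
  chains of summands are summands, and Zorn's lemma writes \<open>M\<close> as a direct sum of indecomposable
  summands \<open>Z\<close>; moreover every non-zero map from a summand to some \<open>Z\<close> is onto. Co-retractability of
  \<open>Z\<close> then makes it co-compressible and makes the relation ``\<open>Z'\<close> is an image of \<open>Z\<close>'' symmetric. The
  sums over the classes of this relation are the \<open>M\<^sub>i\<close>: there are no non-zero maps between different ones,
  and for a proper submodule \<open>Y\<close> of \<open>M\<^sub>i\<close>, a non-zero endomorphism killing \<open>Y\<close> followed by a projection
  maps \<open>M\<^sub>i / Y\<close> onto one, hence onto every, indecomposable summand of \<open>M\<^sub>i\<close>.

  Conversely, each \<open>M\<^sub>i\<close> is fully invariant, so a summand \<open>P\<close> of \<open>M\<close> is the sum of its parts
  \<open>P \<inter> M\<^sub>i\<close>, which are co-retractable because the \<open>M\<^sub>i\<close> are co-prime. If no non-zero endomorphism of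
  \<open>P\<close> kills the proper submodule \<open>Y\<close>, then adding the finitely many \<open>P \<inter> M\<^sub>i\<close> to \<open>Y\<close> one by one never
  reaches \<open>P\<close>, a contradiction.
\<close>

text \<open>The dual Baer condition is used only through the splitting of sums of images. That these
  sums may be infinite makes it a replacement for chain conditions; applied to a single map it
  replaces Schur's lemma. Condition (a) is needed at two levels: for one indecomposable summand,
  where a non-zero endomorphism is automatically onto, and for the sum of a whole class, where it
  supplies the endomorphism that kills \<open>Y\<close>. In the converse the obstacle is that
  co-primeness is given for M_i but wanted for the part of \<open>P\<close> inside M_i. It is
  therefore tested against the projection \<open>e\<close> onto \<open>P\<close>: some endomorphism
  \<open>h\<close> of M_i that kills the right submodule stays non-zero when followed by
  \<open>e\<close>, and the composite lands in \<open>P\<close>. Finiteness of \<open>I\<close>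
  allows the passage from one index to all of them, since a union of infinitely many proper
  submodules can be everything.\<close>

section \<open>Submodules and linear maps\<close>

text \<open>
  Unlike \<^const>\<open>mod_hom\<close>, this does not require \<open>f\<close> to be extensional, so that no restrictions are needed
  when maps between submodules are composed.
\<close>

definition linear_on ::
    "'a ring \<Rightarrow> ('a, 'b) module \<Rightarrow> 'b set \<Rightarrow> 'b set \<Rightarrow> ('b \<Rightarrow> 'b) \<Rightarrow> bool" where
  "linear_on R M A B f \<longleftrightarrow> f \<in> A \<rightarrow> B \<and>
     (\<forall>x\<in>A. \<forall>y\<in>A. f (x \<oplus>\<^bsub>M\<^esub> y) = f x \<oplus>\<^bsub>M\<^esub> f y) \<and>
     (\<forall>r\<in>carrier R. \<forall>x\<in>A. f (r \<odot>\<^bsub>M\<^esub> x) = r \<odot>\<^bsub>M\<^esub> f x)"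

text \<open>Sums of arbitrary families of submodules are written as the submodule generated by their
  union, so that no finite sums of elements have to be handled. If \<open>S\<close> is not contained
  in the carrier, the intersection is over the empty set and gives \<open>UNIV\<close>; hence the
  side conditions \<open>S \<subseteq> carrier M\<close> below.\<close>

definition generated_submodule :: "'a ring \<Rightarrow> ('a, 'b) module \<Rightarrow> 'b set \<Rightarrow> 'b set" where
  "generated_submodule R M S = \<Inter>{N. submodule N R M \<and> S \<subseteq> N}"

text \<open>Everything is a subset of the fixed module \<open>M\<close>, and the complement is
  named. Decompositions of nested submodules can then be refined and restricted without a change of
  the carrier.\<close>

definition direct_sum_of_two ::
    "'a ring \<Rightarrow> ('a, 'b) module \<Rightarrow> 'b set \<Rightarrow> 'b set \<Rightarrow> 'b set \<Rightarrow> bool" where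
  "direct_sum_of_two R M A B X \<longleftrightarrow>
     submodule A R M \<and> submodule B R M \<and> A \<inter> B = {\<zero>\<^bsub>M\<^esub>} \<and> A <+>\<^bsub>M\<^esub> B = X"

lemma set_add_iff: "x \<in> A <+>\<^bsub>G\<^esub> B \<longleftrightarrow> (\<exists>a\<in>A. \<exists>b\<in>B. x = a \<oplus>\<^bsub>G\<^esub> b)"
  by (auto simp: set_add_def set_mult_def)

lemma set_add_carrier_update [simp]: "A <+>\<^bsub>M\<lparr>carrier := X\<rparr>\<^esub> B = A <+>\<^bsub>M\<^esub> B"
  by (auto simp: set_add_iff)

lemma linear_on_carrier_update [simp]:
  "linear_on R (M\<lparr>carrier := X\<rparr>) A B f = linear_on R M A B f"
  by (simp add: linear_on_def)

lemma linear_on_closed: "linear_on R M A B f \<Longrightarrow> x \<in> A \<Longrightarrow> f x \<in> B"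
  by (simp add: linear_on_def Pi_iff subset_iff image_subset_iff)

lemma linear_on_add:
  "linear_on R M A B f \<Longrightarrow> x \<in> A \<Longrightarrow> y \<in> A \<Longrightarrow> f (x \<oplus>\<^bsub>M\<^esub> y) = f x \<oplus>\<^bsub>M\<^esub> f y"
  by (simp add: linear_on_def Pi_iff subset_iff image_subset_iff)

lemma linear_on_smult:
  "linear_on R M A B f \<Longrightarrow> r \<in> carrier R \<Longrightarrow> x \<in> A \<Longrightarrow> f (r \<odot>\<^bsub>M\<^esub> x) = r \<odot>\<^bsub>M\<^esub> f x"
  by (simp add: linear_on_def Pi_iff subset_iff image_subset_iff)

lemma linear_on_subset:
  "linear_on R M A B f \<Longrightarrow> A' \<subseteq> A \<Longrightarrow> B \<subseteq> B' \<Longrightarrow> linear_on R M A' B' f"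
  by (simp add: linear_on_def Pi_iff subset_iff)

lemma linear_on_codomain:
  "linear_on R M A B f \<Longrightarrow> f ` A \<subseteq> B' \<Longrightarrow> linear_on R M A B' f"
  by (simp add: linear_on_def Pi_iff subset_iff image_subset_iff)

lemma linear_on_compose:
  "linear_on R M A B f \<Longrightarrow> linear_on R M B C g \<Longrightarrow> linear_on R M A C (\<lambda>x. g (f x))"
  by (simp add: linear_on_def Pi_iff)

lemma linear_on_id: "A \<subseteq> B \<Longrightarrow> linear_on R M A B (\<lambda>x. x)"
  by (simp add: linear_on_def Pi_iff subset_iff image_subset_iff)

lemma mod_hom_imp_linear_on:
  "f \<in> mod_hom R (M\<lparr>carrier := A\<rparr>) (M\<lparr>carrier := B\<rparr>) \<Longrightarrow> linear_on R M A B f"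
  by (auto simp: linear_on_def mod_hom_def)

lemma mod_hom_self_imp_linear_on:
  "f \<in> mod_hom R M M \<Longrightarrow> linear_on R M (carrier M) (carrier M) f"
  by (auto simp: linear_on_def mod_hom_def)

context right_module
begin

lemma smult_uminus_one: "x \<in> carrier M \<Longrightarrow> (\<ominus>\<^bsub>R\<^esub> \<one>\<^bsub>R\<^esub>) \<odot>\<^bsub>M\<^esub> x = \<ominus>\<^bsub>M\<^esub> x"
proof -
  assume x: "x \<in> carrier M"
  have z: "\<zero>\<^bsub>R\<^esub> \<odot>\<^bsub>M\<^esub> x = \<zero>\<^bsub>M\<^esub>"
    using smult_l_distr[of "\<zero>\<^bsub>R\<^esub>" "\<zero>\<^bsub>R\<^esub>" x] x by (simp add: M.add.l_cancel_one')
  have "(\<ominus>\<^bsub>R\<^esub> \<one>\<^bsub>R\<^esub>) \<odot>\<^bsub>M\<^esub> x \<oplus>\<^bsub>M\<^esub> x = \<zero>\<^bsub>M\<^esub>"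
    using smult_l_distr[of "\<ominus>\<^bsub>R\<^esub> \<one>\<^bsub>R\<^esub>" "\<one>\<^bsub>R\<^esub>" x] x z by (simp add: R.l_neg)
  then show ?thesis using x by (simp add: M.minus_equality)
qed

text \<open>Negation is the action of \<open>\<ominus> \<one>\<close>, so closure under the action
  already yields additive inverses.\<close>

lemma submodule_iff:
  "submodule H R M \<longleftrightarrow> H \<subseteq> carrier M \<and> \<zero>\<^bsub>M\<^esub> \<in> H \<and> (\<forall>x\<in>H. \<forall>y\<in>H. x \<oplus>\<^bsub>M\<^esub> y \<in> H) \<and>
     (\<forall>r\<in>carrier R. \<forall>x\<in>H. r \<odot>\<^bsub>M\<^esub> x \<in> H)" (is "_ \<longleftrightarrow> ?r")
proof
  assume "submodule H R M"
  then interpret H: submodule H R M .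
  show ?r using H.subset H.one_closed H.m_closed by auto
next
  assume r: ?r
  have "\<ominus>\<^bsub>M\<^esub> x \<in> H" if "x \<in> H" for x
    using r that smult_uminus_one[of x] by (metis R.a_inv_closed R.one_closed subsetD)
  with r show "submodule H R M"
    by (intro submodule.intro subgroup.intro submodule_axioms.intro) (auto simp: a_inv_def)
qed

lemma submoduleD:
  assumes "submodule H R M"
  shows "H \<subseteq> carrier M" "x \<in> H \<Longrightarrow> x \<in> carrier M" "\<zero>\<^bsub>M\<^esub> \<in> H" "x \<in> H \<Longrightarrow> y \<in> H \<Longrightarrow> x \<oplus>\<^bsub>M\<^esub> y \<in> H"
    "r \<in> carrier R \<Longrightarrow> x \<in> H \<Longrightarrow> r \<odot>\<^bsub>M\<^esub> x \<in> H"
  using assms by (auto simp: submodule_iff)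

lemma submodule_uminus: "submodule H R M \<Longrightarrow> x \<in> H \<Longrightarrow> \<ominus>\<^bsub>M\<^esub> x \<in> H"
  using smult_uminus_one[of x] submoduleD(2,5)[of H] by (metis R.a_inv_closed R.one_closed)

lemma submodule_minus: "submodule H R M \<Longrightarrow> x \<in> H \<Longrightarrow> y \<in> H \<Longrightarrow> x \<ominus>\<^bsub>M\<^esub> y \<in> H"
  by (simp add: a_minus_def submodule_uminus submoduleD(4))

lemma minus_eq_zero_iff [simp]: "x \<in> carrier M \<Longrightarrow> y \<in> carrier M \<Longrightarrow> x \<ominus>\<^bsub>M\<^esub> y = \<zero>\<^bsub>M\<^esub> \<longleftrightarrow> x = y"
  using M.minus_equality[of x "\<ominus>\<^bsub>M\<^esub> y"] by (auto simp: a_minus_def M.r_neg)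

lemma diff_eq_if_sums_eq:
  assumes "a \<in> carrier M" "b \<in> carrier M" "c \<in> carrier M" "d \<in> carrier M" "a \<oplus>\<^bsub>M\<^esub> b = c \<oplus>\<^bsub>M\<^esub> d"
  shows "a \<ominus>\<^bsub>M\<^esub> c = d \<ominus>\<^bsub>M\<^esub> b"
proof -
  have "a \<ominus>\<^bsub>M\<^esub> c = (a \<oplus>\<^bsub>M\<^esub> b) \<ominus>\<^bsub>M\<^esub> b \<ominus>\<^bsub>M\<^esub> c"
    using assms(1-4) by (simp add: a_minus_def M.a_assoc M.r_neg)
  also have "\<dots> = (c \<oplus>\<^bsub>M\<^esub> \<ominus>\<^bsub>M\<^esub> c) \<oplus>\<^bsub>M\<^esub> (d \<ominus>\<^bsub>M\<^esub> b)"
    unfolding assms(5) using assms(1-4) by (simp add: a_minus_def M.a_ac)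
  also have "\<dots> = d \<ominus>\<^bsub>M\<^esub> b" using assms(1-4) by (simp add: M.r_neg)
  finally show ?thesis .
qed

lemma add_minus_cancel: "x \<in> carrier M \<Longrightarrow> y \<in> carrier M \<Longrightarrow> y \<oplus>\<^bsub>M\<^esub> (x \<ominus>\<^bsub>M\<^esub> y) = x"
  by (simp add: a_minus_def M.a_ac M.r_neg2 M.r_neg)

lemma add_diff_cancel_left:
  "x \<in> carrier M \<Longrightarrow> y \<in> carrier M \<Longrightarrow> (x \<oplus>\<^bsub>M\<^esub> y) \<ominus>\<^bsub>M\<^esub> x = y"
  using M.a_comm[of x y] by (simp add: a_minus_def M.a_assoc M.r_neg)

lemma submodule_carrier_update_iff:
  assumes "submodule X R M"
  shows "submodule H R (M\<lparr>carrier := X\<rparr>) \<longleftrightarrow> submodule H R M \<and> H \<subseteq> X"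
proof -
  interpret X: right_module R "M\<lparr>carrier := X\<rparr>" by (rule submodule_is_right_module) fact
  show ?thesis using submoduleD(1)[OF assms] by (auto simp: X.submodule_iff submodule_iff)
qed

lemma submodule_carrier: "submodule (carrier M) R M"
  by (simp add: submodule_iff)

lemma submodule_zero: "submodule {\<zero>\<^bsub>M\<^esub>} R M"
  by (simp add: submodule_iff)

lemma submodule_Int: "submodule A R M \<Longrightarrow> submodule B R M \<Longrightarrow> submodule (A \<inter> B) R M"
  by (auto simp: submodule_iff)

lemma submodule_set_add:
  assumes "submodule A R M" "submodule B R M"
  shows "submodule (A <+>\<^bsub>M\<^esub> B) R M"
  unfolding submodule_iff
proof (intro conjI ballI)
  note a = submoduleD[OF assms(1)] and b = submoduleD[OF assms(2)]
  show "A <+>\<^bsub>M\<^esub> B \<subseteq> carrier M" using a b by (auto simp: set_add_iff)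
  show "\<zero>\<^bsub>M\<^esub> \<in> A <+>\<^bsub>M\<^esub> B" using a(3) b(3) by (force simp: set_add_iff)
  fix x assume "x \<in> A <+>\<^bsub>M\<^esub> B"
  then obtain u v where x: "u \<in> A" "v \<in> B" "x = u \<oplus>\<^bsub>M\<^esub> v" by (auto simp: set_add_iff)
  have uv: "u \<in> carrier M" "v \<in> carrier M" using x a(2) b(2) by auto
  {
    fix r assume "r \<in> carrier R"
    then show "r \<odot>\<^bsub>M\<^esub> x \<in> A <+>\<^bsub>M\<^esub> B" using x a(5) b(5) uv
      by (metis set_add_iff smult_r_distr)
  next
    fix y assume "y \<in> A <+>\<^bsub>M\<^esub> B"
    then obtain u' v' where y: "u' \<in> A" "v' \<in> B" "y = u' \<oplus>\<^bsub>M\<^esub> v'" by (auto simp: set_add_iff)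
    then have "u' \<in> carrier M" "v' \<in> carrier M" using a(2) b(2) by auto
    then have "x \<oplus>\<^bsub>M\<^esub> y = (u \<oplus>\<^bsub>M\<^esub> u') \<oplus>\<^bsub>M\<^esub> (v \<oplus>\<^bsub>M\<^esub> v')"
      using x(3) y(3) uv by (simp add: M.a_ac)
    then show "x \<oplus>\<^bsub>M\<^esub> y \<in> A <+>\<^bsub>M\<^esub> B" using a(4)[OF x(1) y(1)] b(4)[OF x(2) y(2)] by (metis set_add_iff)
  }
qed

lemma subset_set_add1: "submodule A R M \<Longrightarrow> submodule B R M \<Longrightarrow> A \<subseteq> A <+>\<^bsub>M\<^esub> B"
  using submoduleD(2)[of A] submoduleD(3)[of B] by (force simp: set_add_iff)

lemma subset_set_add2: "submodule A R M \<Longrightarrow> submodule B R M \<Longrightarrow> B \<subseteq> A <+>\<^bsub>M\<^esub> B"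
  using submoduleD(2)[of B] submoduleD(3)[of A] by (force simp: set_add_iff)

lemma set_add_least: "submodule C R M \<Longrightarrow> A \<subseteq> C \<Longrightarrow> B \<subseteq> C \<Longrightarrow> A <+>\<^bsub>M\<^esub> B \<subseteq> C"
  using submoduleD(4)[of C] by (auto simp: set_add_iff subset_iff)

lemma set_add_commute: "submodule A R M \<Longrightarrow> submodule B R M \<Longrightarrow> A <+>\<^bsub>M\<^esub> B = B <+>\<^bsub>M\<^esub> A"
  by (meson set_add_least submodule_set_add subset_set_add1 subset_set_add2 subset_antisym)

lemma submodule_generated:
  assumes "S \<subseteq> carrier M" shows "submodule (generated_submodule R M S) R M"
proof -
  have "generated_submodule R M S \<subseteq> carrier M"
    using assms submodule_carrier by (auto simp: generated_submodule_def)
  then show ?thesis unfolding submodule_iff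
    by (auto simp: generated_submodule_def submoduleD)
qed

lemma generated_least: "submodule N R M \<Longrightarrow> S \<subseteq> N \<Longrightarrow> generated_submodule R M S \<subseteq> N"
  by (auto simp: generated_submodule_def)

lemma generated_superset: "S \<subseteq> generated_submodule R M S"
  by (auto simp: generated_submodule_def)

lemma generated_mono: "S \<subseteq> T \<Longrightarrow> generated_submodule R M S \<subseteq> generated_submodule R M T"
  by (auto simp: generated_submodule_def)

text \<open>Splits one member \<open>A\<close> off the sum of a family; this is how a member is
  compared with the sum of the others.\<close>

lemma generated_Un:
  assumes "S \<subseteq> carrier M" "submodule A R M"
  shows "generated_submodule R M (S \<union> A) = generated_submodule R M S <+>\<^bsub>M\<^esub> A"
proof
  note s = submodule_generated[OF assms(1)]
  show "generated_submodule R M (S \<union> A) \<subseteq> generated_submodule R M S <+>\<^bsub>M\<^esub> A"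
    using subset_set_add1[OF s assms(2)] subset_set_add2[OF s assms(2)] generated_superset[of S]
    by (intro generated_least submodule_set_add s assms) auto
  show "generated_submodule R M S <+>\<^bsub>M\<^esub> A \<subseteq> generated_submodule R M (S \<union> A)"
    using assms(1) submoduleD(1)[OF assms(2)] generated_mono[of S "S \<union> A"]
      generated_superset[of "S \<union> A"]
    by (intro set_add_least submodule_generated) auto
qed

lemma submodule_Union_chain:
  assumes "\<C> \<noteq> {}" "\<And>A. A \<in> \<C> \<Longrightarrow> submodule A R M"
    and "\<And>A B. A \<in> \<C> \<Longrightarrow> B \<in> \<C> \<Longrightarrow> A \<subseteq> B \<or> B \<subseteq> A"
  shows "submodule (\<Union>\<C>) R M"
  unfolding submodule_iff
proof (intro conjI ballI)
  show "\<Union>\<C> \<subseteq> carrier M" using submoduleD(1)[OF assms(2)] by blast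
  show "\<zero>\<^bsub>M\<^esub> \<in> \<Union>\<C>" using assms(1) submoduleD(3)[OF assms(2)] by blast
  fix x assume "x \<in> \<Union>\<C>"
  then obtain A where A: "A \<in> \<C>" "x \<in> A" by blast
  show "r \<odot>\<^bsub>M\<^esub> x \<in> \<Union>\<C>" if "r \<in> carrier R" for r
    using A submoduleD(5)[OF assms(2)[OF A(1)] that] by blast
  fix y assume "y \<in> \<Union>\<C>"
  then obtain B where B: "B \<in> \<C>" "y \<in> B" by blast
  show "x \<oplus>\<^bsub>M\<^esub> y \<in> \<Union>\<C>"
    using A B assms(3)[OF A(1) B(1)] submoduleD(4)[OF assms(2)[OF A(1)], of x y]
      submoduleD(4)[OF assms(2)[OF B(1)], of x y] by blast
qed

lemma linear_on_zero:
  assumes "linear_on R M A B f" "submodule A R M" "B \<subseteq> carrier M"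
  shows "f \<zero>\<^bsub>M\<^esub> = \<zero>\<^bsub>M\<^esub>"
proof -
  have z: "\<zero>\<^bsub>M\<^esub> \<in> A" using submoduleD(3)[OF assms(2)] .
  then have "f \<zero>\<^bsub>M\<^esub> \<in> carrier M" using linear_on_closed[OF assms(1)] assms(3) by auto
  then show ?thesis using linear_on_add[OF assms(1) z z] by (simp add: M.add.l_cancel_one')
qed

lemma linear_on_minus:
  assumes "linear_on R M A B f" "submodule A R M" "B \<subseteq> carrier M" "x \<in> A" "y \<in> A"
  shows "f (x \<ominus>\<^bsub>M\<^esub> y) = f x \<ominus>\<^bsub>M\<^esub> f y"
proof -
  have c: "x \<in> carrier M" "y \<in> carrier M" "f x \<in> carrier M" "f y \<in> carrier M"
    using assms submoduleD(2)[OF assms(2)] linear_on_closed[OF assms(1)] by auto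
  have "f (\<ominus>\<^bsub>M\<^esub> y) = \<ominus>\<^bsub>M\<^esub> f y"
    using linear_on_smult[OF assms(1) _ assms(5), of "\<ominus>\<^bsub>R\<^esub> \<one>\<^bsub>R\<^esub>"] c by (simp add: smult_uminus_one)
  then show ?thesis
    using linear_on_add[OF assms(1,4) submodule_uminus[OF assms(2,5)]] by (simp add: a_minus_def)
qed

lemma submodule_vimage:
  assumes "linear_on R M A B f" "submodule A R M" "submodule B R M" "submodule C R M"
  shows "submodule {x \<in> A. f x \<in> C} R M"
  unfolding submodule_iff
  using submoduleD[OF assms(2)] submoduleD[OF assms(4)] linear_on_add[OF assms(1)]
    linear_on_smult[OF assms(1)] linear_on_zero[OF assms(1,2) submoduleD(1)[OF assms(3)]]
  by auto

lemma submodule_kernel: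
  assumes "linear_on R M A B f" "submodule A R M" "submodule B R M"
  shows "submodule {x \<in> A. f x = \<zero>\<^bsub>M\<^esub>} R M"
  using submodule_vimage[OF assms submodule_zero] by simp

lemma submodule_image:
  assumes "linear_on R M A B f" "submodule A R M" "submodule B R M"
  shows "submodule (f ` A) R M"
  unfolding submodule_iff
proof (intro conjI ballI)
  note a = submoduleD[OF assms(2)]
  show "f ` A \<subseteq> carrier M" using linear_on_closed[OF assms(1)] submoduleD(2)[OF assms(3)] by auto
  show "\<zero>\<^bsub>M\<^esub> \<in> f ` A"
    using linear_on_zero[OF assms(1,2) submoduleD(1)[OF assms(3)]] a(3) by (metis imageI)
  show "x \<oplus>\<^bsub>M\<^esub> y \<in> f ` A" if "x \<in> f ` A" "y \<in> f ` A" for x y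
    using that linear_on_add[OF assms(1)] a(4) by (auto simp: image_iff) metis
  show "r \<odot>\<^bsub>M\<^esub> x \<in> f ` A" if "r \<in> carrier R" "x \<in> f ` A" for r x
    using that linear_on_smult[OF assms(1)] a(5) by (auto simp: image_iff) metis
qed

text \<open>The map sends \<open>u \<oplus> v\<close> to \<open>g v\<close>. Two decompositions of
  the same element differ by an element of \<open>A \<inter> B\<close>, where \<open>g\<close>
  vanishes. The condition is on \<open>g\<close> rather than on \<open>A \<inter> B\<close> because,
  besides projections, it has to cover extensions by zero across overlapping submodules.\<close>

lemma linear_on_glue:
  assumes A: "submodule A R M" and B: "submodule B R M" and C: "submodule C R M"
    and g: "linear_on R M B C g" and 0: "\<And>x. x \<in> A \<Longrightarrow> x \<in> B \<Longrightarrow> g x = \<zero>\<^bsub>M\<^esub>"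
  obtains f where "linear_on R M (A <+>\<^bsub>M\<^esub> B) C f" "\<And>x. x \<in> A \<Longrightarrow> f x = \<zero>\<^bsub>M\<^esub>" "\<And>x. x \<in> B \<Longrightarrow> f x = g x"
proof -
  note a = submoduleD[OF A] and b = submoduleD[OF B] and c = submoduleD[OF C]
  define f where "f z = g (SOME v. v \<in> B \<and> (\<exists>u\<in>A. z = u \<oplus>\<^bsub>M\<^esub> v))" for z
  have f: "f (u \<oplus>\<^bsub>M\<^esub> v) = g v" if u: "u \<in> A" and v: "v \<in> B" for u v
  proof -
    define v' where "v' = (SOME v'. v' \<in> B \<and> (\<exists>u'\<in>A. u \<oplus>\<^bsub>M\<^esub> v = u' \<oplus>\<^bsub>M\<^esub> v'))"
    have "v' \<in> B \<and> (\<exists>u'\<in>A. u \<oplus>\<^bsub>M\<^esub> v = u' \<oplus>\<^bsub>M\<^esub> v')"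
      unfolding v'_def by (rule someI[of _ v]) (use u v in auto)
    then obtain u' where v': "v' \<in> B" and u': "u' \<in> A" and e: "u \<oplus>\<^bsub>M\<^esub> v = u' \<oplus>\<^bsub>M\<^esub> v'" by auto
    have e': "u \<ominus>\<^bsub>M\<^esub> u' = v' \<ominus>\<^bsub>M\<^esub> v"
      by (rule diff_eq_if_sums_eq) (use u u' v v' a(2) b(2) e in auto)
    have "g (v' \<ominus>\<^bsub>M\<^esub> v) = \<zero>\<^bsub>M\<^esub>"
      by (rule 0) (use e' submodule_minus[OF A u u'] submodule_minus[OF B v' v] in auto)
    then have "g v' \<ominus>\<^bsub>M\<^esub> g v = \<zero>\<^bsub>M\<^esub>" using linear_on_minus[OF g B c(1) v' v] by simp
    then have "g v' = g v"
      using linear_on_closed[OF g v] linear_on_closed[OF g v'] c(2) by simp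
    then show ?thesis by (simp add: f_def v'_def)
  qed
  show ?thesis
  proof
    show "f x = \<zero>\<^bsub>M\<^esub>" if "x \<in> A" for x
      using f[OF that b(3)] that a(2) linear_on_zero[OF g B c(1)] by simp
    show "f x = g x" if "x \<in> B" for x using f[OF a(3) that] that b(2) by simp
    show "linear_on R M (A <+>\<^bsub>M\<^esub> B) C f"
      unfolding linear_on_def
    proof (intro conjI ballI funcsetI)
      fix x assume "x \<in> A <+>\<^bsub>M\<^esub> B"
      then obtain u v where x: "u \<in> A" "v \<in> B" "x = u \<oplus>\<^bsub>M\<^esub> v" by (auto simp: set_add_iff)
      have uv: "u \<in> carrier M" "v \<in> carrier M" using x a(2) b(2) by auto
      show "f x \<in> C" using x f linear_on_closed[OF g] by simp
      {
        fix r assume r: "r \<in> carrier R"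
        have "f (r \<odot>\<^bsub>M\<^esub> x) = f (r \<odot>\<^bsub>M\<^esub> u \<oplus>\<^bsub>M\<^esub> r \<odot>\<^bsub>M\<^esub> v)" using x(3) uv r by (simp add: smult_r_distr)
        also have "\<dots> = r \<odot>\<^bsub>M\<^esub> f x"
          using f[OF a(5) b(5), OF r x(1) r x(2)] f[OF x(1,2)] x(3) linear_on_smult[OF g r x(2)] by simp
        finally show "f (r \<odot>\<^bsub>M\<^esub> x) = r \<odot>\<^bsub>M\<^esub> f x" .
      next
        fix y assume "y \<in> A <+>\<^bsub>M\<^esub> B"
        then obtain u' v' where y: "u' \<in> A" "v' \<in> B" "y = u' \<oplus>\<^bsub>M\<^esub> v'" by (auto simp: set_add_iff)
        then have "u' \<in> carrier M" "v' \<in> carrier M" using a(2) b(2) by auto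
        then have "x \<oplus>\<^bsub>M\<^esub> y = (u \<oplus>\<^bsub>M\<^esub> u') \<oplus>\<^bsub>M\<^esub> (v \<oplus>\<^bsub>M\<^esub> v')"
          using x(3) y(3) uv by (simp add: M.a_ac)
        then show "f (x \<oplus>\<^bsub>M\<^esub> y) = f x \<oplus>\<^bsub>M\<^esub> f y"
          using x y a(4) b(4) f linear_on_add[OF g] by simp
      }
    qed
  qed
qed

text \<open>The homomorphism theorem without a factor module: \<open>B\<close> plays the role of
  \<open>A\<close> modulo the kernel of \<open>f\<close>. Preimages of the same element differ by
  the kernel, on which \<open>h\<close> vanishes.\<close>

lemma linear_on_factor:
  assumes f: "linear_on R M A B f" and A: "submodule A R M" and B: "submodule B R M" and onto: "f ` A = B"
    and h: "linear_on R M A C h" and C: "submodule C R M"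
    and ker: "\<And>x. x \<in> A \<Longrightarrow> f x = \<zero>\<^bsub>M\<^esub> \<Longrightarrow> h x = \<zero>\<^bsub>M\<^esub>"
  obtains g where "linear_on R M B C g" "\<And>x. x \<in> A \<Longrightarrow> g (f x) = h x"
proof -
  note a = submoduleD[OF A] and b = submoduleD[OF B] and c = submoduleD[OF C]
  define g where "g y = h (SOME x. x \<in> A \<and> f x = y)" for y
  have g: "g (f x) = h x" if x: "x \<in> A" for x
  proof -
    define x' where "x' = (SOME x'. x' \<in> A \<and> f x' = f x)"
    have x': "x' \<in> A" "f x' = f x"
      using someI[of "\<lambda>x'. x' \<in> A \<and> f x' = f x" x] x by (auto simp: x'_def)
    have cl: "f x \<in> carrier M" "h x \<in> carrier M" "h x' \<in> carrier M"
      using linear_on_closed[OF f x] linear_on_closed[OF h x] linear_on_closed[OF h x'(1)] b(2) c(2) by auto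
    have "h (x' \<ominus>\<^bsub>M\<^esub> x) = \<zero>\<^bsub>M\<^esub>"
      by (rule ker) (use x x' cl in \<open>simp_all add: submodule_minus[OF A] linear_on_minus[OF f A b(1)]\<close>)
    then have "h x' = h x" using linear_on_minus[OF h A c(1) x'(1) x] cl by simp
    then show ?thesis by (simp add: g_def x'_def)
  qed
  show ?thesis
  proof
    show "linear_on R M B C g"
      unfolding linear_on_def
    proof (intro conjI ballI funcsetI)
      fix y assume "y \<in> B"
      then obtain x where x: "x \<in> A" "y = f x" using onto by auto
      show "g y \<in> C" using x g linear_on_closed[OF h] by simp
      show "g (r \<odot>\<^bsub>M\<^esub> y) = r \<odot>\<^bsub>M\<^esub> g y" if "r \<in> carrier R" for r
        using that x g[OF a(5)] g linear_on_smult[OF h] linear_on_smult[OF f] by metis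
      fix y' assume "y' \<in> B"
      then obtain x' where x': "x' \<in> A" "y' = f x'" using onto by auto
      show "g (y \<oplus>\<^bsub>M\<^esub> y') = g y \<oplus>\<^bsub>M\<^esub> g y'"
        using x x' g[OF a(4)] g linear_on_add[OF h] linear_on_add[OF f] by metis
    qed
  qed (rule g)
qed

section \<open>Direct sums\<close>

lemma direct_sum_of_two_commute: "direct_sum_of_two R M A B X \<Longrightarrow> direct_sum_of_two R M B A X"
  using set_add_commute by (auto simp: direct_sum_of_two_def)

lemma direct_sum_of_two_submodule:
  assumes "direct_sum_of_two R M A B X"
  shows "submodule A R M" "submodule B R M" "submodule X R M" "A \<subseteq> X" "B \<subseteq> X"
  using assms submodule_set_add subset_set_add1[of A B] subset_set_add2[of A B]
  unfolding direct_sum_of_two_def by blast+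

lemma direct_sum_of_two_elem:
  assumes "direct_sum_of_two R M A B X" "x \<in> X"
  obtains a b where "a \<in> A" "b \<in> B" "x = a \<oplus>\<^bsub>M\<^esub> b"
  using assms unfolding direct_sum_of_two_def by (metis set_add_iff)

lemma direct_sum_of_two_projection:
  assumes "direct_sum_of_two R M A B X"
  obtains p where "linear_on R M X A p" "\<And>x. x \<in> A \<Longrightarrow> p x = x" "\<And>x. x \<in> B \<Longrightarrow> p x = \<zero>\<^bsub>M\<^esub>"
proof -
  note s = direct_sum_of_two_submodule[OF assms]
  have "B <+>\<^bsub>M\<^esub> A = X" "\<And>x. x \<in> B \<Longrightarrow> x \<in> A \<Longrightarrow> x = \<zero>\<^bsub>M\<^esub>"
    using assms set_add_commute[OF s(1,2)] by (auto simp: direct_sum_of_two_def)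
  then show ?thesis
    using linear_on_glue[OF s(2,1,1) linear_on_id[of A A], of thesis] that by auto
qed

text \<open>The Peirce decomposition of \<open>z\<close> into \<open>p z\<close> and
  \<open>z \<ominus> p z\<close>; it turns idempotents of the endomorphism ring into
  summands.\<close>

lemma direct_sum_of_two_idempotent:
  assumes p: "linear_on R M X X p" and X: "submodule X R M"
    and idem: "\<And>x. x \<in> X \<Longrightarrow> p (p x) = p x"
  shows "direct_sum_of_two R M (p ` X) {x \<in> X. p x = \<zero>\<^bsub>M\<^esub>} X"
proof -
  note x = submoduleD[OF X] and c = linear_on_closed[OF p]
  have "p ` X <+>\<^bsub>M\<^esub> {x \<in> X. p x = \<zero>\<^bsub>M\<^esub>} = X"
  proof
    show "p ` X <+>\<^bsub>M\<^esub> {x \<in> X. p x = \<zero>\<^bsub>M\<^esub>} \<subseteq> X" using c by (intro set_add_least X) auto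
    show "X \<subseteq> p ` X <+>\<^bsub>M\<^esub> {x \<in> X. p x = \<zero>\<^bsub>M\<^esub>}"
    proof
      fix z assume z: "z \<in> X"
      have "z = p z \<oplus>\<^bsub>M\<^esub> (z \<ominus>\<^bsub>M\<^esub> p z)" using z c x(2) by (simp add: add_minus_cancel)
      moreover have "z \<ominus>\<^bsub>M\<^esub> p z \<in> {x \<in> X. p x = \<zero>\<^bsub>M\<^esub>}"
        using z c idem x(2) by (simp add: submodule_minus[OF X] linear_on_minus[OF p X x(1)])
      ultimately show "z \<in> p ` X <+>\<^bsub>M\<^esub> {x \<in> X. p x = \<zero>\<^bsub>M\<^esub>}" using z by (auto simp: set_add_iff)
    qed
  qed
  moreover have "p ` X \<inter> {x \<in> X. p x = \<zero>\<^bsub>M\<^esub>} = {\<zero>\<^bsub>M\<^esub>}"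
    using x(3) linear_on_zero[OF p X x(1)] idem by (auto simp: image_iff) metis
  ultimately show ?thesis
    using submodule_image[OF p X X] submodule_kernel[OF p X X] by (auto simp: direct_sum_of_two_def)
qed

text \<open>The modular law: if \<open>y = a \<oplus> b\<close> lies in \<open>Y\<close> and
  \<open>a \<in> A \<subseteq> Y\<close>, then \<open>b = y \<ominus> a\<close> stays in
  \<open>Y\<close>.\<close>

lemma direct_sum_of_two_restrict:
  assumes "direct_sum_of_two R M A B X" "submodule Y R M" "A \<subseteq> Y" "Y \<subseteq> X"
  shows "direct_sum_of_two R M A (B \<inter> Y) Y"
proof -
  note s = direct_sum_of_two_submodule[OF assms(1)]
  have "Y \<subseteq> A <+>\<^bsub>M\<^esub> (B \<inter> Y)"
  proof
    fix y assume y: "y \<in> Y"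
    obtain a b where ab: "a \<in> A" "b \<in> B" "y = a \<oplus>\<^bsub>M\<^esub> b"
      using direct_sum_of_two_elem[OF assms(1) subsetD[OF assms(4) y]] .
    have "a \<in> carrier M" "b \<in> carrier M"
      using submoduleD(2)[OF s(1) ab(1)] submoduleD(2)[OF s(2) ab(2)] .
    then have "b = y \<ominus>\<^bsub>M\<^esub> a"
      unfolding ab(3) using add_diff_cancel_left by simp
    then have "b \<in> Y" using y ab(1) assms(3) submodule_minus[OF assms(2)] by auto
    then show "y \<in> A <+>\<^bsub>M\<^esub> (B \<inter> Y)" using ab by (auto simp: set_add_iff)
  qed
  moreover have "A <+>\<^bsub>M\<^esub> (B \<inter> Y) \<subseteq> Y" using assms by (intro set_add_least) auto
  ultimately show ?thesis
    using assms s submodule_Int submoduleD(3) by (auto simp: direct_sum_of_two_def)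
qed

text \<open>If \<open>y \<oplus> a\<close> lies in \<open>B\<close>, subtracting \<open>a\<close>
  puts \<open>y\<close> into \<open>Y \<inter> Z\<close>, so \<open>y\<close> vanishes and
  \<open>a\<close> lies in \<open>A \<inter> B\<close>.\<close>

lemma direct_sum_of_two_assoc:
  assumes "direct_sum_of_two R M Y Z X" "direct_sum_of_two R M A B Z"
  shows "direct_sum_of_two R M (Y <+>\<^bsub>M\<^esub> A) B X"
proof -
  note s = direct_sum_of_two_submodule[OF assms(1)] and t = direct_sum_of_two_submodule[OF assms(2)]
  note u = submodule_set_add[OF s(1) t(1)]
  have "x = \<zero>\<^bsub>M\<^esub>" if x: "x \<in> Y <+>\<^bsub>M\<^esub> A" "x \<in> B" for x
  proof -
    obtain y a where ya: "y \<in> Y" "a \<in> A" "x = y \<oplus>\<^bsub>M\<^esub> a" using x(1) by (auto simp: set_add_iff)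
    have c: "y \<in> carrier M" "a \<in> carrier M" using ya submoduleD(2) s t by blast+
    then have "y = x \<ominus>\<^bsub>M\<^esub> a" using ya(3) by (simp add: a_minus_def M.a_assoc M.r_neg)
    then have "y \<in> Z" using x(2) ya(2) t submodule_minus[OF t(3)] by auto
    then have "y = \<zero>\<^bsub>M\<^esub>" using ya(1) assms(1) by (auto simp: direct_sum_of_two_def)
    then have "x = a" using ya c by simp
    then show ?thesis using x(2) ya(2) assms(2) by (auto simp: direct_sum_of_two_def)
  qed
  moreover have "(Y <+>\<^bsub>M\<^esub> A) <+>\<^bsub>M\<^esub> B = X"
  proof
    show "(Y <+>\<^bsub>M\<^esub> A) <+>\<^bsub>M\<^esub> B \<subseteq> X" using s t by (intro set_add_least) auto
    have "Z \<subseteq> (Y <+>\<^bsub>M\<^esub> A) <+>\<^bsub>M\<^esub> B"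
      using assms(2) subset_set_add1[OF u t(2)] subset_set_add2[OF u t(2)] subset_set_add2[OF s(1) t(1)]
        set_add_least[OF submodule_set_add[OF u t(2)], of A B]
      by (auto simp: direct_sum_of_two_def)
    moreover have "Y \<subseteq> (Y <+>\<^bsub>M\<^esub> A) <+>\<^bsub>M\<^esub> B"
      using subset_set_add1[OF u t(2)] subset_set_add1[OF s(1) t(1)] by auto
    ultimately show "X \<subseteq> (Y <+>\<^bsub>M\<^esub> A) <+>\<^bsub>M\<^esub> B"
      using assms(1) set_add_least[OF submodule_set_add[OF u t(2)], of Y Z]
      by (auto simp: direct_sum_of_two_def)
  qed
  ultimately show ?thesis
    using u t(2) submoduleD(3) by (auto simp: direct_sum_of_two_def)
qed

lemma direct_sum_of_two_trans:
  assumes "direct_sum_of_two R M A B X" "direct_sum_of_two R M X C Y"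
  obtains D where "direct_sum_of_two R M A D Y"
  using direct_sum_of_two_commute[OF direct_sum_of_two_assoc[OF direct_sum_of_two_commute[OF assms(2)]
      direct_sum_of_two_commute[OF assms(1)]]] by blast

lemma direct_sum_of_two_zero: "submodule X R M \<Longrightarrow> direct_sum_of_two R M {\<zero>\<^bsub>M\<^esub>} X X"
  using submoduleD(2,3)[of X] submodule_zero
  by (auto simp: direct_sum_of_two_def set_add_iff)

lemma direct_sum_of_two_right_zero:
  assumes "direct_sum_of_two R M A {\<zero>\<^bsub>M\<^esub>} X" shows "A = X"
  using assms submoduleD(2)[OF direct_sum_of_two_submodule(1)[OF assms]]
  by (auto simp: direct_sum_of_two_def set_add_iff)

lemma direct_summand_carrier_update_iff:
  assumes "submodule X R M"
  shows "direct_summand R A (M\<lparr>carrier := X\<rparr>) \<longleftrightarrow> (\<exists>B. direct_sum_of_two R M A B X)"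
  using subset_set_add1 subset_set_add2
  by (simp add: direct_summand_def direct_sum_of_two_def submodule_carrier_update_iff[OF assms]) blast

lemma direct_summand_iff: "direct_summand R A M \<longleftrightarrow> (\<exists>B. direct_sum_of_two R M A B (carrier M))"
  by (auto simp: direct_summand_def direct_sum_of_two_def)

lemma restrict_in_mod_hom:
  assumes "linear_on R M A B f" "submodule A R M"
  shows "restrict f A \<in> mod_hom R (M\<lparr>carrier := A\<rparr>) (M\<lparr>carrier := B\<rparr>)"
  using assms(1) submoduleD[OF assms(2)] by (auto simp: linear_on_def mod_hom_def)

lemma hom_image_carrier_update_iff:
  assumes "submodule A R M"
  shows "hom_image R (M\<lparr>carrier := B\<rparr>) (M\<lparr>carrier := A\<rparr>) \<longleftrightarrow> (\<exists>f. linear_on R M A B f \<and> f ` A = B)"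
    (is "?l \<longleftrightarrow> ?r")
proof
  assume ?l
  then obtain f where "f \<in> mod_hom R (M\<lparr>carrier := A\<rparr>) (M\<lparr>carrier := B\<rparr>)" "f ` A = B"
    by (auto simp: hom_image_def)
  then show ?r using mod_hom_imp_linear_on by blast
next
  assume ?r
  then obtain f where f: "linear_on R M A B f" "f ` A = B" by auto
  have "restrict f A ` A = B" using f(2) by simp
  then show ?l
    unfolding hom_image_def by (intro bexI[OF _ restrict_in_mod_hom[OF f(1) assms]]) simp
qed

end

section \<open>Homomorphisms, external direct sums and generation\<close>

lemma mod_homD:
  assumes "f \<in> mod_hom R X Y"
  shows "x \<in> carrier X \<Longrightarrow> f x \<in> carrier Y"
    and "x \<in> carrier X \<Longrightarrow> y \<in> carrier X \<Longrightarrow> f (x \<oplus>\<^bsub>X\<^esub> y) = f x \<oplus>\<^bsub>Y\<^esub> f y"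
    and "r \<in> carrier R \<Longrightarrow> x \<in> carrier X \<Longrightarrow> f (r \<odot>\<^bsub>X\<^esub> x) = r \<odot>\<^bsub>Y\<^esub> f x"
  using assms by (auto simp: mod_hom_def)

lemma mod_hom_zero:
  assumes f: "f \<in> mod_hom R X Y" and X: "right_module R X" and Y: "right_module R Y"
  shows "f \<zero>\<^bsub>X\<^esub> = \<zero>\<^bsub>Y\<^esub>"
proof -
  interpret X: right_module R X by fact
  interpret Y: right_module R Y by fact
  have z: "\<zero>\<^bsub>X\<^esub> \<in> carrier X" by simp
  show ?thesis using mod_homD(2)[OF f z z] mod_homD(1)[OF f z] by (simp add: Y.M.add.l_cancel_one')
qed

lemma mod_hom_compose:
  assumes f: "f \<in> mod_hom R X Y" and g: "g \<in> mod_hom R Y Z" and X: "right_module R X"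
  shows "(\<lambda>x\<in>carrier X. g (f x)) \<in> mod_hom R X Z"
proof -
  interpret X: right_module R X by fact
  show ?thesis using mod_homD[OF f] mod_homD[OF g] by (auto simp: mod_hom_def)
qed

text \<open>Both maps are extensional, so they can differ only inside the carrier.\<close>

lemma mod_hom_nonzeroE:
  assumes "f \<in> mod_hom R X Y" "f \<noteq> zero_hom X Y"
  obtains x where "x \<in> carrier X" "f x \<noteq> \<zero>\<^bsub>Y\<^esub>"
proof -
  have "\<not> (\<forall>x\<in>carrier X. f x = \<zero>\<^bsub>Y\<^esub>)"
    using assms by (auto simp: zero_hom_def mod_hom_def PiE_iff intro!: extensionalityI[of _ "carrier X"])
  then show ?thesis using that by blast
qed

lemma zero_hom_in_mod_hom:
  assumes "right_module R X" "right_module R Y"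
  shows "zero_hom X Y \<in> mod_hom R X Y"
proof -
  interpret X: right_module R X by fact
  interpret Y: right_module R Y by fact
  show ?thesis by (auto simp: zero_hom_def mod_hom_def)
qed

definition direct_sum_inj ::
    "'i set \<Rightarrow> ('i \<Rightarrow> ('a, 'b) module) \<Rightarrow> 'i \<Rightarrow> 'b \<Rightarrow> 'i \<Rightarrow> 'b" where
  "direct_sum_inj I F i g = (\<lambda>k\<in>I. if k = i then g else \<zero>\<^bsub>F k\<^esub>)"

lemma direct_sum_inj_closed:
  assumes F: "\<And>i. i \<in> I \<Longrightarrow> right_module R (F i)" and g: "i \<in> I" "g \<in> carrier (F i)"
  shows "direct_sum_inj I F i g \<in> carrier (direct_sum I F)"
proof -
  have "\<zero>\<^bsub>F k\<^esub> \<in> carrier (F k)" if "k \<in> I" for k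
    using F[OF that] by (simp add: right_module_def abelian_group_def abelian_monoid.zero_closed)
  moreover have "finite {k \<in> I. direct_sum_inj I F i g k \<noteq> \<zero>\<^bsub>F k\<^esub>}"
    by (rule finite_subset[of _ "{i}"]) (auto simp: direct_sum_inj_def)
  ultimately show ?thesis using g by (auto simp: direct_sum_def direct_sum_inj_def)
qed

lemma direct_sum_inj_in_mod_hom:
  assumes F: "\<And>i. i \<in> I \<Longrightarrow> right_module R (F i)" and i: "i \<in> I"
  shows "(\<lambda>g\<in>carrier (F i). direct_sum_inj I F i g) \<in> mod_hom R (F i) (direct_sum I F)"
proof -
  interpret Fi: right_module R "F i" using F i by blast
  have "\<zero>\<^bsub>F k\<^esub> = \<zero>\<^bsub>F k\<^esub> \<oplus>\<^bsub>F k\<^esub> \<zero>\<^bsub>F k\<^esub>" "\<And>r. r \<in> carrier R \<Longrightarrow> \<zero>\<^bsub>F k\<^esub> = r \<odot>\<^bsub>F k\<^esub> \<zero>\<^bsub>F k\<^esub>" if "k \<in> I" for k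
    using F[OF that] right_module.smult_zero[OF F[OF that]]
    by (simp_all add: right_module_def abelian_group_def abelian_monoid.l_zero abelian_monoid.zero_closed)
  then have "direct_sum_inj I F i (g \<oplus>\<^bsub>F i\<^esub> g') =
        direct_sum_inj I F i g \<oplus>\<^bsub>direct_sum I F\<^esub> direct_sum_inj I F i g'"
      "r \<in> carrier R \<Longrightarrow> direct_sum_inj I F i (r \<odot>\<^bsub>F i\<^esub> g) = r \<odot>\<^bsub>direct_sum I F\<^esub> direct_sum_inj I F i g" for g g' r
    by (auto simp: direct_sum_inj_def direct_sum_def intro!: restrict_ext)
  then show ?thesis using direct_sum_inj_closed[of I R F i, OF F i] by (auto simp: mod_hom_def)
qed

text \<open>Supports are finite, so coordinates can be split off one at a time. The induction runs
  over a finite set that merely contains the support, which lets the hypothesis apply directly to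
  the remaining element.\<close>

lemma direct_sum_induct:
  assumes R: "ring R" and F: "\<And>i. i \<in> I \<Longrightarrow> right_module R (F i)"
    and x: "x \<in> carrier (direct_sum I F)"
    and zero: "P \<zero>\<^bsub>direct_sum I F\<^esub>"
    and inj: "\<And>i g. i \<in> I \<Longrightarrow> g \<in> carrier (F i) \<Longrightarrow> P (direct_sum_inj I F i g)"
    and add: "\<And>x y. x \<in> carrier (direct_sum I F) \<Longrightarrow> y \<in> carrier (direct_sum I F) \<Longrightarrow>
      P x \<Longrightarrow> P y \<Longrightarrow> P (x \<oplus>\<^bsub>direct_sum I F\<^esub> y)"
  shows "P x"
proof -
  have am: "abelian_monoid (F i)" if "i \<in> I" for i
    using F[OF that] by (simp add: right_module_def abelian_group_def)
  note s = abelian_monoid.l_zero[OF am] abelian_monoid.r_zero[OF am] abelian_monoid.zero_closed[OF am]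
  let ?D = "direct_sum I F"
  have "P x" if "finite A" "x \<in> carrier ?D" "{i \<in> I. x i \<noteq> \<zero>\<^bsub>F i\<^esub>} \<subseteq> A" for A x
    using that
  proof (induction A arbitrary: x)
    case empty
    then have "x = \<zero>\<^bsub>?D\<^esub>"
      by (auto simp: direct_sum_def PiE_iff intro!: extensionalityI[of _ I])
    then show ?case using zero by simp
  next
    case (insert a A)
    show ?case
    proof (cases "a \<in> I")
      case False
      with insert show ?thesis by blast
    next
      case True
      let ?y = "\<lambda>k\<in>I. if k = a then \<zero>\<^bsub>F a\<^esub> else x k"
      have xa: "x a \<in> carrier (F a)" using insert.prems True by (auto simp: direct_sum_def)
      have y0: "{j \<in> I. ?y j \<noteq> \<zero>\<^bsub>F j\<^esub>} \<subseteq> A" using insert.prems by auto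
      then have "finite {j \<in> I. ?y j \<noteq> \<zero>\<^bsub>F j\<^esub>}" using insert.hyps finite_subset by blast
      then have y: "?y \<in> carrier ?D" using insert.prems s by (auto simp: direct_sum_def)
      have e: "x = direct_sum_inj I F a (x a) \<oplus>\<^bsub>?D\<^esub> ?y"
        using insert.prems
        by (auto simp: direct_sum_def direct_sum_inj_def PiE_iff s intro!: extensionalityI[of _ I])
      have "P (direct_sum_inj I F a (x a) \<oplus>\<^bsub>?D\<^esub> ?y)"
        by (rule add[OF direct_sum_inj_closed[of I R F a "x a", OF F True xa] y inj[OF True xa]
              insert.IH[OF y y0]])
      then show ?thesis using e by argo
    qed
  qed
  then show ?thesis using x by (auto simp: direct_sum_def)
qed

lemma mod_hom_finsum_smult:
  assumes "right_module R X" "finite A" "u \<in> A \<rightarrow> carrier X" "r \<in> carrier R"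
  shows "(\<Oplus>\<^bsub>X\<^esub> i \<in> A. r \<odot>\<^bsub>X\<^esub> u i) = r \<odot>\<^bsub>X\<^esub> (\<Oplus>\<^bsub>X\<^esub> i \<in> A. u i)"
proof -
  interpret X: right_module R X by fact
  show ?thesis using assms(2,3)
  proof (induction A)
    case (insert a A)
    then have "u \<in> A \<rightarrow> carrier X" "(\<lambda>f. r \<odot>\<^bsub>X\<^esub> u f) \<in> A \<rightarrow> carrier X" "u a \<in> carrier X"
      using assms(4) by auto
    with insert assms(4) show ?case by (simp add: X.smult_r_distr)
  qed (use assms(4) in simp)
qed

text \<open>The universal map out of an external direct sum. The sum runs over the support because
  \<open>finsum\<close> over an infinite index set is zero by default.\<close>

definition direct_sum_lift ::
    "'i set \<Rightarrow> ('i \<Rightarrow> ('a, 'b) module) \<Rightarrow> ('a, 'c) module \<Rightarrow> ('i \<Rightarrow> 'b \<Rightarrow> 'c) \<Rightarrow> ('i \<Rightarrow> 'b) \<Rightarrow> 'c" where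
  "direct_sum_lift I F X h =
     (\<lambda>x\<in>carrier (direct_sum I F). \<Oplus>\<^bsub>X\<^esub> i \<in> {i \<in> I. x i \<noteq> \<zero>\<^bsub>F i\<^esub>}. h i (x i))"

lemma direct_sum_lift:
  assumes F: "\<And>i. i \<in> I \<Longrightarrow> right_module R (F i)" and X: "right_module R X"
    and h: "\<And>i. i \<in> I \<Longrightarrow> h i \<in> mod_hom R (F i) X"
  shows "direct_sum_lift I F X h \<in> mod_hom R (direct_sum I F) X"
    and "i \<in> I \<Longrightarrow> g \<in> carrier (F i) \<Longrightarrow> direct_sum_lift I F X h (direct_sum_inj I F i g) = h i g"
proof -
  interpret X: right_module R X by fact
  let ?D = "direct_sum I F" and ?\<Phi> = "direct_sum_lift I F X h"
  define supp where "supp x = {i \<in> I. x i \<noteq> \<zero>\<^bsub>F i\<^esub>}" for x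
  interpret D: right_module R ?D by (rule direct_sum_is_right_module[OF X.R.ring_axioms F])
  have fin: "finite (supp x)" if "x \<in> carrier ?D" for x
    using that by (simp add: direct_sum_def supp_def)
  have xF: "x i \<in> carrier (F i)" if "x \<in> carrier ?D" "i \<in> I" for x i
    using that by (auto simp: direct_sum_def)
  have h0: "h i \<zero>\<^bsub>F i\<^esub> = \<zero>\<^bsub>X\<^esub>" if "i \<in> I" for i by (rule mod_hom_zero[OF h[OF that] F[OF that] X])
  have hX: "h i (x i) \<in> carrier X" if "x \<in> carrier ?D" "i \<in> I" for x i
    using that xF mod_homD(1)[OF h] by blast
  have supp: "supp x \<subseteq> I" for x by (auto simp: supp_def)
  \<comment> \<open>The support may be enlarged to any finite subset of \<open>I\<close>, so that
    \<open>x\<close>, \<open>y\<close> and their sum can be evaluated over the same index set; the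
    extra terms vanish by \<open>h0\<close>.\<close>
  have \<Phi>: "?\<Phi> x = (\<Oplus>\<^bsub>X\<^esub> i \<in> A. h i (x i))"
    if "x \<in> carrier ?D" "finite A" "supp x \<subseteq> A" "A \<subseteq> I" for x A
  proof -
    have "(\<Oplus>\<^bsub>X\<^esub> i \<in> supp x. h i (x i)) = (\<Oplus>\<^bsub>X\<^esub> i \<in> A. h i (x i))"
      by (rule X.M.add.finprod_mono_neutral_cong_left)
        (use that hX h0 in \<open>auto simp: supp_def\<close>)
    then show ?thesis using that by (simp add: direct_sum_lift_def supp_def)
  qed
  have D_app: "(x \<oplus>\<^bsub>?D\<^esub> y) i = x i \<oplus>\<^bsub>F i\<^esub> y i" "(r \<odot>\<^bsub>?D\<^esub> x) i = r \<odot>\<^bsub>F i\<^esub> x i" if "i \<in> I" for x y r i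
    using that by (simp_all add: direct_sum_def)
  have closed: "?\<Phi> x \<in> carrier X" if "x \<in> carrier ?D" for x
    unfolding \<Phi>[OF that fin[OF that] order_refl supp]
    by (rule X.M.finsum_closed) (use hX[OF that] supp in blast)
  have add: "?\<Phi> (x \<oplus>\<^bsub>?D\<^esub> y) = ?\<Phi> x \<oplus>\<^bsub>X\<^esub> ?\<Phi> y" if x: "x \<in> carrier ?D" and y: "y \<in> carrier ?D" for x y
  proof -
    let ?A = "supp x \<union> supp y"
    have A: "finite ?A" "?A \<subseteq> I" "i \<in> ?A \<Longrightarrow> i \<in> I" for i using fin x y supp by auto
    have "supp (x \<oplus>\<^bsub>?D\<^esub> y) \<subseteq> ?A"
      using F by (auto simp: supp_def D_app right_module_def abelian_group_def
          abelian_monoid.l_zero abelian_monoid.zero_closed)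
    then have "?\<Phi> (x \<oplus>\<^bsub>?D\<^esub> y) = (\<Oplus>\<^bsub>X\<^esub> i \<in> ?A. h i ((x \<oplus>\<^bsub>?D\<^esub> y) i))"
      using A x y by (intro \<Phi>) auto
    also have "\<dots> = (\<Oplus>\<^bsub>X\<^esub> i \<in> ?A. h i (x i) \<oplus>\<^bsub>X\<^esub> h i (y i))"
      by (rule X.M.finsum_cong') (use A(3) x y in \<open>auto simp: D_app mod_homD(2)[OF h] xF hX\<close>)
    also have "\<dots> = (\<Oplus>\<^bsub>X\<^esub> i \<in> ?A. h i (x i)) \<oplus>\<^bsub>X\<^esub> (\<Oplus>\<^bsub>X\<^esub> i \<in> ?A. h i (y i))"
      by (rule X.M.finsum_addf) (use A(3) x y in \<open>auto simp: hX\<close>)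
    also have "\<dots> = ?\<Phi> x \<oplus>\<^bsub>X\<^esub> ?\<Phi> y" using \<Phi>[OF x A(1) _ A(2)] \<Phi>[OF y A(1) _ A(2)] by simp
    finally show ?thesis .
  qed
  have sm: "?\<Phi> (r \<odot>\<^bsub>?D\<^esub> x) = r \<odot>\<^bsub>X\<^esub> ?\<Phi> x" if x: "x \<in> carrier ?D" and r: "r \<in> carrier R" for x r
  proof -
    have A: "i \<in> supp x \<Longrightarrow> i \<in> I" for i using supp by auto
    have "supp (r \<odot>\<^bsub>?D\<^esub> x) \<subseteq> supp x" using r right_module.smult_zero[OF F] by (auto simp: supp_def D_app)
    then have "?\<Phi> (r \<odot>\<^bsub>?D\<^esub> x) = (\<Oplus>\<^bsub>X\<^esub> i \<in> supp x. h i ((r \<odot>\<^bsub>?D\<^esub> x) i))"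
      using fin[OF x] supp x r by (intro \<Phi>) auto
    also have "\<dots> = (\<Oplus>\<^bsub>X\<^esub> i \<in> supp x. r \<odot>\<^bsub>X\<^esub> h i (x i))"
      by (rule X.M.finsum_cong') (use A x r in \<open>auto simp: D_app mod_homD(3)[OF h] xF hX\<close>)
    also have "\<dots> = r \<odot>\<^bsub>X\<^esub> (\<Oplus>\<^bsub>X\<^esub> i \<in> supp x. h i (x i))"
      by (rule mod_hom_finsum_smult[OF X]) (use fin[OF x] A x r hX in auto)
    finally show ?thesis using \<Phi>[OF x fin[OF x] order_refl supp] by simp
  qed
  show "?\<Phi> \<in> mod_hom R ?D X"
    using closed add sm by (auto simp: mod_hom_def direct_sum_lift_def)
  assume i: "i \<in> I" and g: "g \<in> carrier (F i)"
  let ?x = "direct_sum_inj I F i g"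
  have "?\<Phi> ?x = (\<Oplus>\<^bsub>X\<^esub> k \<in> {i}. h k (?x k))"
    by (rule \<Phi>) (use i direct_sum_inj_closed[of I R F i g, OF F i g] in \<open>auto simp: supp_def direct_sum_inj_def\<close>)
  also have "\<dots> = h i g" using i g mod_homD(1)[OF h[OF i] g] by (simp add: direct_sum_inj_def)
  finally show "?\<Phi> ?x = h i g" .
qed

lemma submodule_mod_hom_image:
  assumes f: "f \<in> mod_hom R X Y" and X: "right_module R X" and Y: "right_module R Y"
  shows "submodule (f ` carrier X) R Y"
proof -
  interpret X: right_module R X by fact
  interpret Y: right_module R Y by fact
  note d = mod_homD[OF f]
  show ?thesis
    unfolding Y.submodule_iff
  proof (intro conjI ballI)
    show "f ` carrier X \<subseteq> carrier Y" using d(1) by auto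
    show "\<zero>\<^bsub>Y\<^esub> \<in> f ` carrier X" unfolding mod_hom_zero[OF assms, symmetric] by (intro imageI) simp
    fix x assume "x \<in> f ` carrier X"
    then obtain u where u: "u \<in> carrier X" "x = f u" by auto
    show "r \<odot>\<^bsub>Y\<^esub> x \<in> f ` carrier X" if "r \<in> carrier R" for r
      unfolding u(2) d(3)[OF that u(1), symmetric] using that u(1) by (intro imageI) auto
    fix y assume "y \<in> f ` carrier X"
    then obtain v where v: "v \<in> carrier X" "y = f v" by auto
    show "x \<oplus>\<^bsub>Y\<^esub> y \<in> f ` carrier X"
      unfolding u(2) v(2) d(2)[OF u(1) v(1), symmetric] using u(1) v(1) by (intro imageI) auto
  qed
qed

text \<open>Each \<open>h\<close> in \<open>H\<close> serves as its own index, which is exactly what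
  the index type in \<open>generates\<close> provides. The image of the resulting map is a submodule
  that contains the image of every \<open>h\<close>.\<close>

lemma generatesI:
  assumes G: "right_module R G" and X: "right_module R X" and H: "H \<subseteq> mod_hom R G X"
    and least: "\<And>N. submodule N R X \<Longrightarrow> (\<And>h. h \<in> H \<Longrightarrow> h ` carrier G \<subseteq> N) \<Longrightarrow> carrier X \<subseteq> N"
  shows "generates R G X"
proof -
  let ?F = "\<lambda>_. G" let ?\<Phi> = "direct_sum_lift H ?F X (\<lambda>h. h)"
  have \<Phi>: "?\<Phi> \<in> mod_hom R (direct_sum H ?F) X"
    by (rule direct_sum_lift(1)) (use G X H in auto)
  have "right_module R (direct_sum H ?F)"
    using direct_sum_is_right_module[of R H ?F] G by (auto simp: right_module_def)
  then have sub: "submodule (?\<Phi> ` carrier (direct_sum H ?F)) R X"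
    by (rule submodule_mod_hom_image[OF \<Phi> _ X])
  have "h g \<in> ?\<Phi> ` carrier (direct_sum H ?F)" if h: "h \<in> H" and g: "g \<in> carrier G" for h g
  proof (rule image_eqI)
    show "h g = ?\<Phi> (direct_sum_inj H ?F h g)"
      by (rule direct_sum_lift(2)[symmetric]) (use G X H h g in auto)
    show "direct_sum_inj H ?F h g \<in> carrier (direct_sum H ?F)"
      by (rule direct_sum_inj_closed) (use G h g in auto)
  qed
  then have "carrier X \<subseteq> ?\<Phi> ` carrier (direct_sum H ?F)" by (intro least sub) auto
  moreover have "?\<Phi> ` carrier (direct_sum H ?F) \<subseteq> carrier X" using mod_homD(1)[OF \<Phi>] by auto
  ultimately show ?thesis unfolding generates_def hom_image_def by (metis \<Phi> subset_antisym)
qed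

text \<open>If \<open>q\<close> vanished on the image of every map from \<open>G\<close> to
  \<open>X\<close>, it would vanish on each copy of \<open>G\<close> in the direct sum and hence on
  all of \<open>X\<close>. In this form generation yields a map that a given test map
  \<open>q\<close> does not kill.\<close>

lemma generatesE:
  fixes G :: "('a, 'c) module" and X :: "('a, 'b) module"
  assumes "generates R G X" and G: "right_module R G" and X: "right_module R X" and Y: "right_module R Y"
    and q: "q \<in> mod_hom R X Y" and nz: "x \<in> carrier X" "q x \<noteq> \<zero>\<^bsub>Y\<^esub>"
  obtains h g where "h \<in> mod_hom R G X" "g \<in> carrier G" "q (h g) \<noteq> \<zero>\<^bsub>Y\<^esub>"
proof -
  interpret Y: right_module R Y by fact
  let ?F = "\<lambda>_. G"
  obtain I :: "('c \<Rightarrow> 'b) set" and f where f: "f \<in> mod_hom R (direct_sum I ?F) X"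
    and onto: "f ` carrier (direct_sum I ?F) = carrier X"
    using assms(1) by (auto simp: generates_def hom_image_def)
  have D: "right_module R (direct_sum I ?F)"
    using direct_sum_is_right_module[of R I ?F] G by (auto simp: right_module_def)
  note witness = that
  show ?thesis
  proof (rule ccontr)
    assume no: "\<not> thesis"
    have *: "q (h g) = \<zero>\<^bsub>Y\<^esub>" if "h \<in> mod_hom R G X" "g \<in> carrier G" for h g
      using witness[OF that] no by blast
    have "q (f z) = \<zero>\<^bsub>Y\<^esub>" if "z \<in> carrier (direct_sum I ?F)" for z
    proof (rule direct_sum_induct[of R I ?F z])
      show "q (f \<zero>\<^bsub>direct_sum I ?F\<^esub>) = \<zero>\<^bsub>Y\<^esub>"
        using mod_hom_zero[OF f D X] mod_hom_zero[OF q X Y] by simp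
      show "q (f (direct_sum_inj I ?F i g)) = \<zero>\<^bsub>Y\<^esub>" if i: "i \<in> I" and g: "g \<in> carrier G" for i g
        using *[OF mod_hom_compose[OF direct_sum_inj_in_mod_hom[of I R ?F i] f G] g] G i g by simp
      show "q (f (x \<oplus>\<^bsub>direct_sum I ?F\<^esub> y)) = \<zero>\<^bsub>Y\<^esub>"
        if "x \<in> carrier (direct_sum I ?F)" "y \<in> carrier (direct_sum I ?F)"
          "q (f x) = \<zero>\<^bsub>Y\<^esub>" "q (f y) = \<zero>\<^bsub>Y\<^esub>" for x y
        using that mod_homD[OF f] mod_homD[OF q] by simp
    qed (use G that in \<open>auto simp: right_module_def\<close>)
    moreover have "x \<in> f ` carrier (direct_sum I ?F)" using nz(1) onto by simp
    ultimately show False using nz(2) by auto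
  qed
qed

text \<open>The usual condition that the projections sum to the identity is replaced by the last
  clause: the \<open>N i\<close> lie together in no proper submodule. This keeps finite sums out of
  the later arguments, for infinite \<open>I\<close> as well.\<close>

definition projection_system ::
    "'a ring \<Rightarrow> ('a, 'b) module \<Rightarrow> 'i set \<Rightarrow> ('i \<Rightarrow> 'b set) \<Rightarrow> ('i \<Rightarrow> 'b \<Rightarrow> 'b) \<Rightarrow> bool" where
  "projection_system R M I N \<pi> \<longleftrightarrow>
     (\<forall>i\<in>I. submodule (N i) R M \<and> linear_on R M (carrier M) (N i) (\<pi> i)) \<and>
     (\<forall>i\<in>I. \<forall>x\<in>N i. \<pi> i x = x) \<and>
     (\<forall>i\<in>I. \<forall>j\<in>I. i \<noteq> j \<longrightarrow> (\<forall>x\<in>N j. \<pi> i x = \<zero>\<^bsub>M\<^esub>)) \<and>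
     (\<forall>L. submodule L R M \<longrightarrow> (\<forall>i\<in>I. N i \<subseteq> L) \<longrightarrow> L = carrier M)"

text \<open>
  An internal direct sum is the same as a projection system; the map \<open>\<phi>\<close> below is the canonical map
  from the external direct sum.
\<close>

context right_module
begin

context
  fixes I :: "'i set" and N :: "'i \<Rightarrow> 'b set" and D \<phi>
  assumes sub: "\<And>i. i \<in> I \<Longrightarrow> submodule (N i) R M"
  defines "D \<equiv> direct_sum I (\<lambda>i. M\<lparr>carrier := N i\<rparr>)"
  defines "\<phi> \<equiv> direct_sum_lift I (\<lambda>i. M\<lparr>carrier := N i\<rparr>) M (\<lambda>i. \<lambda>x\<in>N i. x)"
begin

lemma internal_sum_summands: "i \<in> I \<Longrightarrow> right_module R (M\<lparr>carrier := N i\<rparr>)"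
  by (rule submodule_is_right_module) (rule sub)

lemma internal_sum_module: "right_module R D"
  unfolding D_def by (rule direct_sum_is_right_module[OF R.ring_axioms internal_sum_summands])

lemma internal_sum_hom: "\<phi> \<in> mod_hom R D M"
  and internal_sum_inj: "i \<in> I \<Longrightarrow> x \<in> N i \<Longrightarrow>
    \<phi> (direct_sum_inj I (\<lambda>i. M\<lparr>carrier := N i\<rparr>) i x) = x"
proof -
  have h: "(\<lambda>x\<in>N i. x) \<in> mod_hom R (M\<lparr>carrier := N i\<rparr>) M" if "i \<in> I" for i
    using submoduleD[OF sub[OF that]] by (auto simp: mod_hom_def)
  note l = direct_sum_lift[of I R "\<lambda>i. M\<lparr>carrier := N i\<rparr>" M "\<lambda>i. \<lambda>x\<in>N i. x",
      OF internal_sum_summands right_module_axioms h]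
  show "\<phi> \<in> mod_hom R D M" unfolding \<phi>_def D_def by (rule l(1))
  show "\<phi> (direct_sum_inj I (\<lambda>i. M\<lparr>carrier := N i\<rparr>) i x) = x" if "i \<in> I" "x \<in> N i"
    unfolding \<phi>_def using l(2)[of i x] that by simp
qed

lemma internal_sum_inj_closed:
  "i \<in> I \<Longrightarrow> x \<in> N i \<Longrightarrow> direct_sum_inj I (\<lambda>i. M\<lparr>carrier := N i\<rparr>) i x \<in> carrier D"
  unfolding D_def by (rule direct_sum_inj_closed) (use internal_sum_summands in auto)

lemma internal_sum_induct:
  assumes "x \<in> carrier D" "P \<zero>\<^bsub>D\<^esub>"
    and "\<And>i g. i \<in> I \<Longrightarrow> g \<in> N i \<Longrightarrow> P (direct_sum_inj I (\<lambda>i. M\<lparr>carrier := N i\<rparr>) i g)"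
    and "\<And>x y. x \<in> carrier D \<Longrightarrow> y \<in> carrier D \<Longrightarrow> P x \<Longrightarrow> P y \<Longrightarrow> P (x \<oplus>\<^bsub>D\<^esub> y)"
  shows "P x"
  by (rule direct_sum_induct[OF R.ring_axioms internal_sum_summands assms(1)[unfolded D_def]])
    (use assms(2-) in \<open>auto simp: D_def\<close>)

lemma is_internal_direct_sum_iff_bij:
  "is_internal_direct_sum R M I N \<longleftrightarrow> bij_betw \<phi> (carrier D) (carrier M)"
proof -
  have "(\<Oplus>\<^bsub>M\<^esub> i \<in> {i \<in> I. x i \<noteq> \<zero>\<^bsub>M\<^esub>}. x i) = \<phi> x" if x: "x \<in> carrier D" for x
  proof -
    have "x i \<in> N i" "x i \<in> carrier M" if "i \<in> I" for i
      using x that submoduleD(1)[OF sub] by (auto simp: D_def direct_sum_def)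
    then have "(\<Oplus>\<^bsub>M\<^esub> i \<in> {i \<in> I. x i \<noteq> \<zero>\<^bsub>M\<^esub>}. x i) =
        (\<Oplus>\<^bsub>M\<^esub> i \<in> {i \<in> I. x i \<noteq> \<zero>\<^bsub>M\<^esub>}. (\<lambda>x\<in>N i. x) (x i))"
      by (intro M.finsum_cong') auto
    then show ?thesis using x by (simp add: \<phi>_def D_def direct_sum_lift_def)
  qed
  then have "bij_betw (\<lambda>x. \<Oplus>\<^bsub>M\<^esub> i \<in> {i \<in> I. x i \<noteq> \<zero>\<^bsub>M\<^esub>}. x i) (carrier D) (carrier M) =
      bij_betw \<phi> (carrier D) (carrier M)"
    by (rule bij_betw_cong)
  then show ?thesis using sub by (simp add: is_internal_direct_sum_def D_def)
qed

lemma internal_sum_image_least: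
  assumes "submodule L R M" "\<And>i. i \<in> I \<Longrightarrow> N i \<subseteq> L" "x \<in> carrier D"
  shows "\<phi> x \<in> L"
  by (rule internal_sum_induct[OF assms(3)])
    (use assms(2) internal_sum_inj submoduleD(3,4)[OF assms(1)] mod_homD(2)[OF internal_sum_hom]
        mod_hom_zero[OF internal_sum_hom internal_sum_module right_module_axioms] in auto)

context
  fixes \<pi> assumes ps: "projection_system R M I N \<pi>"
begin

text \<open>Both sides are additive in \<open>x\<close>, so it suffices to compare them on the
  injections. Injectivity of \<phi> is a consequence.\<close>

lemma projection_of_internal_sum:
  assumes i: "i \<in> I" and x: "x \<in> carrier D" shows "\<pi> i (\<phi> x) = x i"
proof (rule internal_sum_induct[OF x])
  have p: "linear_on R M (carrier M) (N i) (\<pi> i)" using ps i by (simp add: projection_system_def)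
  show "\<pi> i (\<phi> \<zero>\<^bsub>D\<^esub>) = \<zero>\<^bsub>D\<^esub> i"
    using i mod_hom_zero[OF internal_sum_hom internal_sum_module right_module_axioms]
      linear_on_zero[OF p submodule_carrier submoduleD(1)[OF sub[OF i]]]
    by (simp add: D_def direct_sum_def)
  show "\<pi> i (\<phi> (direct_sum_inj I (\<lambda>i. M\<lparr>carrier := N i\<rparr>) j g)) =
      direct_sum_inj I (\<lambda>i. M\<lparr>carrier := N i\<rparr>) j g i" if "j \<in> I" "g \<in> N j" for j g
    using that i ps internal_sum_inj[OF that] by (simp add: direct_sum_inj_def projection_system_def)
  show "\<pi> i (\<phi> (x \<oplus>\<^bsub>D\<^esub> y)) = (x \<oplus>\<^bsub>D\<^esub> y) i"
    if "x \<in> carrier D" "y \<in> carrier D" "\<pi> i (\<phi> x) = x i" "\<pi> i (\<phi> y) = y i" for x y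
    using that(3,4) i mod_homD(2)[OF internal_sum_hom that(1,2)]
      linear_on_add[OF p mod_homD(1)[OF internal_sum_hom that(1)] mod_homD(1)[OF internal_sum_hom that(2)]]
    by (simp add: D_def direct_sum_def)
qed

lemma internal_sum_onto: "\<phi> ` carrier D = carrier M"
proof -
  have "submodule (\<phi> ` carrier D) R M"
    by (rule submodule_mod_hom_image[OF internal_sum_hom internal_sum_module right_module_axioms])
  moreover have "N i \<subseteq> \<phi> ` carrier D" if "i \<in> I" for i
  proof
    fix x assume x: "x \<in> N i"
    show "x \<in> \<phi> ` carrier D"
      using imageI[OF internal_sum_inj_closed[OF that x], of \<phi>] internal_sum_inj[OF that x] by simp
  qed
  ultimately show ?thesis using ps by (simp add: projection_system_def)
qed

text \<open>By surjectivity \<open>x = \<phi> y\<close>, and the coordinates of \<open>y\<close> are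
  the projections of \<open>x\<close>. The contrapositive finds a summand in which a given non-zero
  element is visible.\<close>

lemma projections_faithful:
  assumes x: "x \<in> carrier M" and z: "\<And>i. i \<in> I \<Longrightarrow> \<pi> i x = \<zero>\<^bsub>M\<^esub>"
  shows "x = \<zero>\<^bsub>M\<^esub>"
proof -
  obtain y where y: "y \<in> carrier D" "x = \<phi> y" using internal_sum_onto x by blast
  then have "y i = \<zero>\<^bsub>M\<^esub>" if "i \<in> I" for i using projection_of_internal_sum[OF that y(1)] z[OF that] by simp
  then have "y = \<zero>\<^bsub>D\<^esub>"
    using y(1) by (auto simp: D_def direct_sum_def PiE_iff intro!: extensionalityI[of _ I])
  then show ?thesis
    using y(2) mod_hom_zero[OF internal_sum_hom internal_sum_module right_module_axioms] by simp
qed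

lemma internal_direct_sum_if_projections: "is_internal_direct_sum R M I N"
proof -
  have "inj_on \<phi> (carrier D)"
  proof (rule inj_onI)
    fix x y assume "x \<in> carrier D" "y \<in> carrier D" "\<phi> x = \<phi> y"
    then show "x = y"
      using projection_of_internal_sum[of _ x] projection_of_internal_sum[of _ y]
      by (intro extensionalityI[of _ I]) (auto simp: D_def direct_sum_def PiE_iff)
  qed
  then show ?thesis using internal_sum_onto by (simp add: is_internal_direct_sum_iff_bij bij_betw_def)
qed

end

text \<open>The projections are the coordinates of the inverse of \<phi>.\<close>

lemma projections_if_internal_direct_sum:
  assumes "is_internal_direct_sum R M I N"
  obtains \<pi> where "projection_system R M I N \<pi>"
proof -
  have inj: "inj_on \<phi> (carrier D)" and onto: "\<phi> ` carrier D = carrier M"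
    using assms by (simp_all add: is_internal_direct_sum_iff_bij bij_betw_def)
  interpret D: right_module R D by (rule internal_sum_module)
  define \<psi> where "\<psi> = the_inv_into (carrier D) \<phi>"
  have \<psi>: "\<psi> (\<phi> x) = x" if "x \<in> carrier D" for x
    unfolding \<psi>_def by (rule the_inv_into_f_f[OF inj that])
  have ex: "\<exists>u\<in>carrier D. x = \<phi> u" if "x \<in> carrier M" for x using onto that by blast
  have \<psi>': "\<psi> x = direct_sum_inj I (\<lambda>i. M\<lparr>carrier := N i\<rparr>) i x" if "i \<in> I" "x \<in> N i" for i x
    using \<psi>[OF internal_sum_inj_closed[OF that]] internal_sum_inj[OF that] by simp
  have "linear_on R M (carrier M) (N i) (\<lambda>x. \<psi> x i)" if i: "i \<in> I" for i
    unfolding linear_on_def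
  proof (intro conjI ballI funcsetI)
    fix x assume "x \<in> carrier M"
    then obtain u where u: "u \<in> carrier D" "x = \<phi> u" using ex by blast
    show "\<psi> x i \<in> N i" using u \<psi> i by (auto simp: D_def direct_sum_def)
    show "\<psi> (r \<odot>\<^bsub>M\<^esub> x) i = r \<odot>\<^bsub>M\<^esub> \<psi> x i" if "r \<in> carrier R" for r
      using u \<psi>[OF u(1)] \<psi>[OF D.smult_closed[OF that u(1)]] i mod_homD(3)[OF internal_sum_hom that u(1)]
      by (simp add: D_def direct_sum_def)
    fix y assume "y \<in> carrier M"
    then obtain v where v: "v \<in> carrier D" "y = \<phi> v" using ex by blast
    show "\<psi> (x \<oplus>\<^bsub>M\<^esub> y) i = \<psi> x i \<oplus>\<^bsub>M\<^esub> \<psi> y i"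
      using u v \<psi>[OF u(1)] \<psi>[OF v(1)] \<psi>[OF D.M.a_closed[OF u(1) v(1)]] i
        mod_homD(2)[OF internal_sum_hom u(1) v(1)]
      by (simp add: D_def direct_sum_def)
  qed
  moreover have "L = carrier M" if L: "submodule L R M" "\<forall>i\<in>I. N i \<subseteq> L" for L
  proof
    show "L \<subseteq> carrier M" by (rule submoduleD(1)[OF L(1)])
    show "carrier M \<subseteq> L" unfolding onto[symmetric] using internal_sum_image_least[OF L(1)] L(2) by blast
  qed
  ultimately have "projection_system R M I N (\<lambda>i x. \<psi> x i)"
    unfolding projection_system_def using sub \<psi>' by (auto simp: direct_sum_inj_def)
  then show ?thesis by (rule that)
qed

end

section \<open>Maps on factor modules\<close>

lemma factor_module_carrier: "carrier (factor_module M Y) = (\<lambda>x. Y +>\<^bsub>M\<^esub> x) ` carrier M"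
  by (auto simp: factor_module_def A_RCOSETS_def')

lemma factor_module_proj:
  assumes "submodule Y R M"
  shows "(\<lambda>x\<in>carrier M. Y +>\<^bsub>M\<^esub> x) \<in> mod_hom R M (factor_module M Y)"
    and "x \<in> carrier M \<Longrightarrow> y \<in> carrier M \<Longrightarrow> Y +>\<^bsub>M\<^esub> x = Y +>\<^bsub>M\<^esub> y \<Longrightarrow> x \<ominus>\<^bsub>M\<^esub> y \<in> Y"
    and "x \<in> Y \<Longrightarrow> Y +>\<^bsub>M\<^esub> x = \<zero>\<^bsub>factor_module M Y\<^esub>"
proof -
  interpret Y: abelian_subgroup Y M by (rule additive_subgroup_submodule) fact
  let ?F = "factor_module M Y"
  \<comment> \<open>The action on a coset is defined as a union over its representatives. All of
    them yield the same coset \<open>Y +> (r \<odot> x)\<close>, so the union collapses to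
    it.\<close>
  have sm: "r \<odot>\<^bsub>?F\<^esub> (Y +>\<^bsub>M\<^esub> x) = Y +>\<^bsub>M\<^esub> (r \<odot>\<^bsub>M\<^esub> x)" if r: "r \<in> carrier R" and x: "x \<in> carrier M" for r x
  proof -
    have "Y +>\<^bsub>M\<^esub> (r \<odot>\<^bsub>M\<^esub> z) = Y +>\<^bsub>M\<^esub> (r \<odot>\<^bsub>M\<^esub> x)" if z: "z \<in> Y +>\<^bsub>M\<^esub> x" for z
    proof -
      obtain y where y: "y \<in> Y" "z = y \<oplus>\<^bsub>M\<^esub> x" using z by (auto simp: a_r_coset_def r_coset_def)
      have "r \<odot>\<^bsub>M\<^esub> z = r \<odot>\<^bsub>M\<^esub> y \<oplus>\<^bsub>M\<^esub> r \<odot>\<^bsub>M\<^esub> x" using y r x Y.a_subset by (auto simp: smult_r_distr)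
      then have "r \<odot>\<^bsub>M\<^esub> z \<in> Y +>\<^bsub>M\<^esub> (r \<odot>\<^bsub>M\<^esub> x)"
        using submoduleD(5)[OF assms r y(1)] by (auto simp: a_r_coset_def r_coset_def)
      then show ?thesis
        using M.a_repr_independence[of _ Y "r \<odot>\<^bsub>M\<^esub> x"] r x Y.a_subgroup by simp
    qed
    then have "(\<Union>z\<in>Y +>\<^bsub>M\<^esub> x. Y +>\<^bsub>M\<^esub> (r \<odot>\<^bsub>M\<^esub> z)) = (\<Union>z\<in>Y +>\<^bsub>M\<^esub> x. Y +>\<^bsub>M\<^esub> (r \<odot>\<^bsub>M\<^esub> x))"
      by (rule SUP_cong[OF refl])
    also have "\<dots> = Y +>\<^bsub>M\<^esub> (r \<odot>\<^bsub>M\<^esub> x)" using Y.a_rcos_self[OF x] by blast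
    finally show ?thesis by (simp add: factor_module_def)
  qed
  have "(Y +>\<^bsub>M\<^esub> x) \<oplus>\<^bsub>?F\<^esub> (Y +>\<^bsub>M\<^esub> y) = Y +>\<^bsub>M\<^esub> (x \<oplus>\<^bsub>M\<^esub> y)"
    if "x \<in> carrier M" "y \<in> carrier M" for x y
    using that by (simp add: factor_module_def Y.a_rcos_sum)
  then show "(\<lambda>x\<in>carrier M. Y +>\<^bsub>M\<^esub> x) \<in> mod_hom R M ?F"
    using sm by (simp add: mod_hom_def factor_module_carrier)
  show "x \<ominus>\<^bsub>M\<^esub> y \<in> Y" if "x \<in> carrier M" "y \<in> carrier M" "Y +>\<^bsub>M\<^esub> x = Y +>\<^bsub>M\<^esub> y"
    using Y.a_rcos_module_imp[of y x] that Y.a_rcos_self[OF that(1)] by (simp add: a_minus_def)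
  show "Y +>\<^bsub>M\<^esub> x = \<zero>\<^bsub>?F\<^esub>" if "x \<in> Y"
    using M.a_coset_join2[OF _ Y.a_subgroup that] that Y.a_subset by (auto simp: factor_module_def)
qed

lemma factor_module_hom_restrict:
  assumes Y: "submodule Y R M" and T: "right_module R T" and g: "g \<in> mod_hom R (factor_module M Y) T"
  shows "(\<lambda>x\<in>carrier M. g (Y +>\<^bsub>M\<^esub> x)) \<in> mod_hom R M T" "x \<in> Y \<Longrightarrow> g (Y +>\<^bsub>M\<^esub> x) = \<zero>\<^bsub>T\<^esub>"
proof -
  have "(\<lambda>x\<in>carrier M. g ((\<lambda>x\<in>carrier M. Y +>\<^bsub>M\<^esub> x) x)) \<in> mod_hom R M T"
    by (rule mod_hom_compose[OF factor_module_proj(1)[OF Y] g right_module_axioms])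
  then show "(\<lambda>x\<in>carrier M. g (Y +>\<^bsub>M\<^esub> x)) \<in> mod_hom R M T" by (simp cong: restrict_cong)
  show "g (Y +>\<^bsub>M\<^esub> x) = \<zero>\<^bsub>T\<^esub>" if "x \<in> Y"
    using mod_hom_zero[OF g factor_module_is_right_module[OF Y] T] factor_module_proj(3)[OF Y that] by simp
qed

text \<open>The value at a coset is that of \<open>f\<close> at a chosen representative; any other
  representative differs from it by an element of \<open>Y\<close>, which \<open>f\<close>
  kills.\<close>

lemma factor_module_hom_lift:
  assumes Y: "submodule Y R M" and T: "right_module R T" and f: "f \<in> mod_hom R M T"
    and 0: "\<And>x. x \<in> Y \<Longrightarrow> f x = \<zero>\<^bsub>T\<^esub>"
  obtains g where "g \<in> mod_hom R (factor_module M Y) T" "\<And>x. x \<in> carrier M \<Longrightarrow> g (Y +>\<^bsub>M\<^esub> x) = f x"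
proof -
  interpret T: right_module R T by fact
  let ?F = "factor_module M Y"
  note p = mod_homD(2,3)[OF factor_module_proj(1)[OF Y]]
  define rep where "rep C = (SOME x. x \<in> carrier M \<and> C = Y +>\<^bsub>M\<^esub> x)" for C
  define g where "g = (\<lambda>C\<in>carrier ?F. f (rep C))"
  have g: "g (Y +>\<^bsub>M\<^esub> x) = f x" if x: "x \<in> carrier M" for x
  proof -
    have r: "rep (Y +>\<^bsub>M\<^esub> x) \<in> carrier M" "Y +>\<^bsub>M\<^esub> x = Y +>\<^bsub>M\<^esub> rep (Y +>\<^bsub>M\<^esub> x)"
      using someI[of "\<lambda>z. z \<in> carrier M \<and> Y +>\<^bsub>M\<^esub> x = Y +>\<^bsub>M\<^esub> z" x] x by (auto simp: rep_def)
    let ?d = "x \<ominus>\<^bsub>M\<^esub> rep (Y +>\<^bsub>M\<^esub> x)"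
    have d: "?d \<in> Y" "?d \<in> carrier M" using factor_module_proj(2)[OF Y x r] r(1) x by auto
    have "f x = f (rep (Y +>\<^bsub>M\<^esub> x) \<oplus>\<^bsub>M\<^esub> ?d)" using add_minus_cancel[OF x r(1)] by simp
    also have "\<dots> = f (rep (Y +>\<^bsub>M\<^esub> x))"
      using mod_homD(2)[OF f r(1) d(2)] 0[OF d(1)] mod_homD(1)[OF f r(1)] by simp
    finally show ?thesis using x by (simp add: g_def factor_module_carrier)
  qed
  have "g \<in> mod_hom R ?F T"
  proof -
    have "g C \<in> carrier T" if C: "C \<in> carrier ?F" for C
      using C mod_homD(1)[OF f] g by (auto simp: factor_module_carrier)
    moreover have "g (C \<oplus>\<^bsub>?F\<^esub> D) = g C \<oplus>\<^bsub>T\<^esub> g D" if C: "C \<in> carrier ?F" and D: "D \<in> carrier ?F" for C D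
    proof -
      obtain x y where x: "x \<in> carrier M" "C = Y +>\<^bsub>M\<^esub> x" and y: "y \<in> carrier M" "D = Y +>\<^bsub>M\<^esub> y"
        using C D by (auto simp: factor_module_carrier)
      show ?thesis
        using p(1)[OF x(1) y(1)] g[OF x(1)] g[OF y(1)] g[OF M.a_closed[OF x(1) y(1)]]
          mod_homD(2)[OF f x(1) y(1)] x y by simp
    qed
    moreover have "g (r \<odot>\<^bsub>?F\<^esub> C) = r \<odot>\<^bsub>T\<^esub> g C" if C: "C \<in> carrier ?F" and r: "r \<in> carrier R" for C r
    proof -
      obtain x where x: "x \<in> carrier M" "C = Y +>\<^bsub>M\<^esub> x" using C by (auto simp: factor_module_carrier)
      show ?thesis
        using p(2)[OF r x(1)] g[OF x(1)] g[OF smult_closed[OF r x(1)]] mod_homD(3)[OF f r x(1)] x r by simp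
    qed
    ultimately show ?thesis by (auto simp: mod_hom_def g_def)
  qed
  then show ?thesis using g by (rule that)
qed

lemma factor_module_hom_image:
  "(\<And>x. x \<in> carrier M \<Longrightarrow> g (Y +>\<^bsub>M\<^esub> x) = f x) \<Longrightarrow> g ` carrier (factor_module M Y) = f ` carrier M"
  by (force simp: factor_module_carrier)

text \<open>A map from \<open>X / Y\<close> to \<open>X\<close> is an endomorphism of
  \<open>X\<close> that kills \<open>Y\<close>. Outside this section the conditions on factor
  modules are used only in this form.\<close>

lemma co_retractableD:
  assumes "co_retractable R (M\<lparr>carrier := X\<rparr>)" and X: "submodule X R M"
    and Y: "submodule Y R M" "Y \<subseteq> X" "Y \<noteq> X"
  obtains f x where "linear_on R M X X f" "\<And>y. y \<in> Y \<Longrightarrow> f y = \<zero>\<^bsub>M\<^esub>" "x \<in> X" "f x \<noteq> \<zero>\<^bsub>M\<^esub>"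
proof -
  let ?X = "M\<lparr>carrier := X\<rparr>"
  interpret X: right_module R ?X by (rule submodule_is_right_module) fact
  have Y': "submodule Y R ?X" using Y X by (simp add: submodule_carrier_update_iff)
  note F = X.factor_module_is_right_module[OF Y']
  \<comment> \<open>A set different from a singleton could still be empty; as the zero map belongs
    to it, a second element exists.\<close>
  have "zero_hom (factor_module ?X Y) ?X \<in> mod_hom R (factor_module ?X Y) ?X"
    by (rule zero_hom_in_mod_hom[OF F X.right_module_axioms])
  moreover have "mod_hom R (factor_module ?X Y) ?X \<noteq> {zero_hom (factor_module ?X Y) ?X}"
    using assms(1) Y(3) Y' by (simp add: co_retractable_def)
  ultimately obtain g where g: "g \<in> mod_hom R (factor_module ?X Y) ?X" "g \<noteq> zero_hom (factor_module ?X Y) ?X"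
    by blast
  obtain C where C: "C \<in> carrier (factor_module ?X Y)" "g C \<noteq> \<zero>\<^bsub>?X\<^esub>" using mod_hom_nonzeroE[OF g] .
  then obtain x where x: "x \<in> X" "C = Y +>\<^bsub>?X\<^esub> x" by (auto simp: X.factor_module_carrier)
  let ?f = "\<lambda>x\<in>carrier ?X. g (Y +>\<^bsub>?X\<^esub> x)"
  note r = X.factor_module_hom_restrict[OF Y' X.right_module_axioms g(1)]
  show ?thesis
  proof
    show "linear_on R M X X ?f" by (rule mod_hom_imp_linear_on[OF r(1)])
    show "?f y = \<zero>\<^bsub>M\<^esub>" if "y \<in> Y" for y using r(2)[OF that] that Y(2) by auto
    show "x \<in> X" "?f x \<noteq> \<zero>\<^bsub>M\<^esub>" using x C by auto
  qed
qed

lemma factor_module_lift: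
  assumes X: "submodule X R M" and Y: "submodule Y R M" "Y \<subseteq> X" and Z: "submodule Z R M"
    and f: "linear_on R M X Z f" and 0: "\<And>y. y \<in> Y \<Longrightarrow> f y = \<zero>\<^bsub>M\<^esub>"
  obtains g where "g \<in> mod_hom R (factor_module (M\<lparr>carrier := X\<rparr>) Y) (M\<lparr>carrier := Z\<rparr>)"
    "g ` carrier (factor_module (M\<lparr>carrier := X\<rparr>) Y) = f ` X"
proof -
  let ?X = "M\<lparr>carrier := X\<rparr>" and ?Z = "M\<lparr>carrier := Z\<rparr>"
  interpret X: right_module R ?X by (rule submodule_is_right_module) fact
  have Y': "submodule Y R ?X" using Y X by (simp add: submodule_carrier_update_iff)
  have z: "restrict f X y = \<zero>\<^bsub>?Z\<^esub>" if "y \<in> Y" for y using that Y(2) 0 by auto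
  obtain g where g: "g \<in> mod_hom R (factor_module ?X Y) ?Z"
      "\<And>x. x \<in> carrier ?X \<Longrightarrow> g (Y +>\<^bsub>?X\<^esub> x) = restrict f X x"
    using X.factor_module_hom_lift[OF Y' submodule_is_right_module[OF Z] restrict_in_mod_hom[OF f X] z]
    by blast
  have "g ` carrier (factor_module ?X Y) = restrict f X ` carrier ?X"
    by (rule X.factor_module_hom_image) (rule g(2))
  then show ?thesis using g(1) that by simp
qed

lemma co_retractableI:
  assumes X: "submodule X R M"
    and ex: "\<And>Y. submodule Y R M \<Longrightarrow> Y \<subseteq> X \<Longrightarrow> Y \<noteq> X \<Longrightarrow>
      \<exists>f. linear_on R M X X f \<and> (\<forall>y\<in>Y. f y = \<zero>\<^bsub>M\<^esub>) \<and> (\<exists>x\<in>X. f x \<noteq> \<zero>\<^bsub>M\<^esub>)"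
  shows "co_retractable R (M\<lparr>carrier := X\<rparr>)"
  unfolding co_retractable_def
proof (intro allI impI)
  let ?X = "M\<lparr>carrier := X\<rparr>"
  fix Y assume "submodule Y R ?X \<and> Y \<noteq> carrier ?X"
  then have Y: "submodule Y R M" "Y \<subseteq> X" "Y \<noteq> X"
    using X by (simp_all add: submodule_carrier_update_iff)
  obtain f where f: "linear_on R M X X f" "\<And>y. y \<in> Y \<Longrightarrow> f y = \<zero>\<^bsub>M\<^esub>" "\<exists>x\<in>X. f x \<noteq> \<zero>\<^bsub>M\<^esub>"
    using ex[OF Y] by blast
  obtain g where g: "g \<in> mod_hom R (factor_module ?X Y) ?X" "g ` carrier (factor_module ?X Y) = f ` X"
    using factor_module_lift[OF X Y(1,2) X f(1,2)] by blast
  \<comment> \<open>What is known of \<open>g\<close> is its image, so \<open>g\<close> is told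
    apart from the zero map by its image.\<close>
  have "zero_hom (factor_module ?X Y) ?X ` carrier (factor_module ?X Y) \<subseteq> {\<zero>\<^bsub>M\<^esub>}"
    by (auto simp: zero_hom_def)
  moreover have "\<not> f ` X \<subseteq> {\<zero>\<^bsub>M\<^esub>}" using f(3) by blast
  ultimately have "g \<noteq> zero_hom (factor_module ?X Y) ?X" using g(2) by metis
  then show "mod_hom R (factor_module ?X Y) ?X \<noteq> {zero_hom (factor_module ?X Y) ?X}"
    using g(1) by blast
qed

lemma co_compressibleI:
  assumes X: "submodule X R M"
    and ex: "\<And>Y. submodule Y R M \<Longrightarrow> Y \<subseteq> X \<Longrightarrow> Y \<noteq> X \<Longrightarrow>
      \<exists>f. linear_on R M X X f \<and> (\<forall>y\<in>Y. f y = \<zero>\<^bsub>M\<^esub>) \<and> f ` X = X"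
  shows "co_compressible R (M\<lparr>carrier := X\<rparr>)"
  unfolding co_compressible_def
proof (intro allI impI)
  let ?X = "M\<lparr>carrier := X\<rparr>"
  interpret X: right_module R ?X by (rule submodule_is_right_module) fact
  fix Y assume Y': "submodule Y R ?X \<and> nonzero_module (factor_module ?X Y)"
  then have Y: "submodule Y R M" "Y \<subseteq> X"
    using X by (simp_all add: submodule_carrier_update_iff)
  have "Y \<noteq> X"
  proof
    assume "Y = X"
    then have "Y +>\<^bsub>?X\<^esub> x = \<zero>\<^bsub>factor_module ?X Y\<^esub>" if "x \<in> X" for x
      using X.factor_module_proj(3)[OF conjunct1[OF Y']] that by simp
    moreover have "\<zero>\<^bsub>?X\<^esub> \<in> X" using submoduleD(3)[OF X] by simp
    ultimately have "carrier (factor_module ?X Y) = {\<zero>\<^bsub>factor_module ?X Y\<^esub>}"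
      by (auto simp: X.factor_module_carrier)
    then show False using Y' by (simp add: nonzero_module_def)
  qed
  then obtain f where f: "linear_on R M X X f" "\<And>y. y \<in> Y \<Longrightarrow> f y = \<zero>\<^bsub>M\<^esub>" "f ` X = X"
    using ex[OF Y] by blast
  obtain g where "g \<in> mod_hom R (factor_module ?X Y) ?X" "g ` carrier (factor_module ?X Y) = f ` X"
    using factor_module_lift[OF X Y X f(1,2)] by blast
  then show "hom_image R ?X (factor_module ?X Y)" using f(3) by (auto simp: hom_image_def)
qed

text \<open>The test map \<open>q\<close> will be the projection onto a summand; co-primeness
  supplies an endomorphism that kills \<open>Y\<close> and survives composition with
  \<open>q\<close>.\<close>

lemma co_primeD:
  assumes "co_prime R (M\<lparr>carrier := X\<rparr>)" and X: "submodule X R M"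
    and Y: "submodule Y R M" "Y \<subseteq> X" "Y \<noteq> X" and q: "linear_on R M X X q" "x \<in> X" "q x \<noteq> \<zero>\<^bsub>M\<^esub>"
  obtains h z where "linear_on R M X X h" "\<And>y. y \<in> Y \<Longrightarrow> h y = \<zero>\<^bsub>M\<^esub>" "z \<in> X" "q (h z) \<noteq> \<zero>\<^bsub>M\<^esub>"
proof -
  let ?X = "M\<lparr>carrier := X\<rparr>"
  interpret X: right_module R ?X by (rule submodule_is_right_module) fact
  have Y': "submodule Y R ?X" using Y X by (simp add: submodule_carrier_update_iff)
  note F = X.factor_module_is_right_module[OF Y']
  have gen: "generates R (factor_module ?X Y) ?X" using assms(1) Y(3) Y' by (simp add: co_prime_def)
  have "x \<in> carrier ?X" "restrict q X x \<noteq> \<zero>\<^bsub>?X\<^esub>" using q by auto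
  then obtain g C where g: "g \<in> mod_hom R (factor_module ?X Y) ?X" "C \<in> carrier (factor_module ?X Y)"
      "restrict q X (g C) \<noteq> \<zero>\<^bsub>?X\<^esub>"
    using generatesE[OF gen F X.right_module_axioms X.right_module_axioms restrict_in_mod_hom[OF q(1) X]]
    by blast
  then obtain z where z: "z \<in> X" "C = Y +>\<^bsub>?X\<^esub> z" by (auto simp: X.factor_module_carrier)
  have "g C \<in> X" using mod_homD(1)[OF g(1,2)] by simp
  let ?f = "\<lambda>x\<in>carrier ?X. g (Y +>\<^bsub>?X\<^esub> x)"
  note r = X.factor_module_hom_restrict[OF Y' X.right_module_axioms g(1)]
  show ?thesis
  proof
    show "linear_on R M X X ?f" by (rule mod_hom_imp_linear_on[OF r(1)])
    show "?f y = \<zero>\<^bsub>M\<^esub>" if "y \<in> Y" for y using r(2)[OF that] that Y(2) by auto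
    show "z \<in> X" "q (?f z) \<noteq> \<zero>\<^bsub>M\<^esub>" using z g(3) \<open>g C \<in> X\<close> by auto
  qed
qed

text \<open>The members of \<open>H\<close> factor through \<open>X / Y\<close> with the same
  images; a submodule containing all these images is the whole of \<open>X\<close>, which is what
  generation asks for.\<close>

lemma co_primeI:
  assumes X: "submodule X R M"
    and ex: "\<And>Y. submodule Y R M \<Longrightarrow> Y \<subseteq> X \<Longrightarrow> Y \<noteq> X \<Longrightarrow>
      \<exists>H. (\<forall>h\<in>H. linear_on R M X X h \<and> (\<forall>y\<in>Y. h y = \<zero>\<^bsub>M\<^esub>)) \<and>
        (\<forall>L. submodule L R M \<longrightarrow> (\<forall>h\<in>H. h ` X \<subseteq> L) \<longrightarrow> X \<subseteq> L)"
  shows "co_prime R (M\<lparr>carrier := X\<rparr>)"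
  unfolding co_prime_def
proof (intro allI impI)
  let ?X = "M\<lparr>carrier := X\<rparr>"
  interpret X: right_module R ?X by (rule submodule_is_right_module) fact
  fix Y assume Y': "submodule Y R ?X \<and> Y \<noteq> carrier ?X"
  then have Y: "submodule Y R M" "Y \<subseteq> X" "Y \<noteq> X"
    using X by (simp_all add: submodule_carrier_update_iff)
  obtain H where HH: "(\<forall>h\<in>H. linear_on R M X X h \<and> (\<forall>y\<in>Y. h y = \<zero>\<^bsub>M\<^esub>)) \<and>
      (\<forall>L. submodule L R M \<longrightarrow> (\<forall>h\<in>H. h ` X \<subseteq> L) \<longrightarrow> X \<subseteq> L)"
    using ex[OF Y] by (rule exE)
  have H: "linear_on R M X X h" "y \<in> Y \<Longrightarrow> h y = \<zero>\<^bsub>M\<^esub>" if "h \<in> H" for h y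
    using conjunct1[OF HH] that by simp_all
  have least: "X \<subseteq> L" if "submodule L R M" "\<And>h. h \<in> H \<Longrightarrow> h ` X \<subseteq> L" for L
    using conjunct2[OF HH] that by simp
  show "generates R (factor_module ?X Y) ?X"
  proof (rule generatesI[OF X.factor_module_is_right_module X.right_module_axioms order_refl])
    show "submodule Y R ?X" using Y' ..
    fix L assume L: "submodule L R ?X"
      and im: "\<And>h. h \<in> mod_hom R (factor_module ?X Y) ?X \<Longrightarrow> h ` carrier (factor_module ?X Y) \<subseteq> L"
    have "X \<subseteq> L"
    proof (rule least)
      show "submodule L R M" using L X by (simp add: submodule_carrier_update_iff)
      fix h assume h: "h \<in> H"
      obtain g where "g \<in> mod_hom R (factor_module ?X Y) ?X" "g ` carrier (factor_module ?X Y) = h ` X"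
        using factor_module_lift[OF X Y(1,2) X H[OF h]] by blast
      then show "h ` X \<subseteq> L" using im by metis
    qed
    then show "carrier ?X \<subseteq> L" by simp
  qed
qed

lemma indecomposable_carrier_update_iff:
  assumes "submodule Z R M"
  shows "indecomposable R (M\<lparr>carrier := Z\<rparr>) \<longleftrightarrow>
    Z \<noteq> {\<zero>\<^bsub>M\<^esub>} \<and> (\<forall>A B. direct_sum_of_two R M A B Z \<longrightarrow> A = {\<zero>\<^bsub>M\<^esub>} \<or> A = Z)"
  by (auto simp: indecomposable_def nonzero_module_def direct_summand_carrier_update_iff[OF assms])

lemma direct_summandD: "direct_summand R A M \<Longrightarrow> submodule A R M"
  by (simp add: direct_summand_def)

lemma direct_summand_trans:
  "direct_sum_of_two R M A B X \<Longrightarrow> direct_summand R X M \<Longrightarrow> direct_summand R A M"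
  using direct_sum_of_two_trans by (metis direct_summand_iff)

lemma direct_summand_zero: "direct_summand R {\<zero>\<^bsub>M\<^esub>} M"
  using direct_sum_of_two_zero[OF submodule_carrier] by (auto simp: direct_summand_iff)

lemma direct_summand_projection:
  assumes "direct_summand R X M"
  obtains p where "linear_on R M (carrier M) X p" "p ` carrier M = X"
proof -
  obtain X' where "direct_sum_of_two R M X X' (carrier M)" using assms by (auto simp: direct_summand_iff)
  then obtain p where p: "linear_on R M (carrier M) X p" "\<And>x. x \<in> X \<Longrightarrow> p x = x"
    using direct_sum_of_two_projection by metis
  have "X \<subseteq> p ` carrier M"
  proof
    fix x assume x: "x \<in> X"
    then show "x \<in> p ` carrier M"
      using p(2)[OF x] submoduleD(2)[OF direct_summandD[OF assms] x] by (intro image_eqI[of _ _ x]) auto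
  qed
  then have "p ` carrier M = X" using linear_on_closed[OF p(1)] by blast
  then show ?thesis using p(1) that by blast
qed

section \<open>Finite co-prime decompositions\<close>

lemma summands_co_retractable_if_finite_co_prime_decomposition:
  assumes fin: "finite I" and dec: "co_prime_decomposition R M I N"
  shows "summands_co_retractable R M"
  unfolding summands_co_retractable_def
proof (intro allI impI)
  have sub: "submodule (N i) R M" if "i \<in> I" for i
    using dec that by (auto simp: co_prime_decomposition_def is_internal_direct_sum_def)
  have ids: "is_internal_direct_sum R M I N" using dec by (simp add: co_prime_decomposition_def)
  obtain \<pi> where ps: "projection_system R M I N \<pi>"
    by (rule projections_if_internal_direct_sum[of I N, OF sub ids])
  have \<pi>: "linear_on R M (carrier M) (N i) (\<pi> i)" "x \<in> N i \<Longrightarrow> \<pi> i x = x" if "i \<in> I" for i x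
    using ps that by (simp_all add: projection_system_def)
  have \<pi>0: "\<pi> i x = \<zero>\<^bsub>M\<^esub>" if "i \<in> I" "j \<in> I" "i \<noteq> j" "x \<in> N j" for i j x
    using ps that by (simp add: projection_system_def)
  have least: "L = carrier M" if "submodule L R M" "\<forall>i\<in>I. N i \<subseteq> L" for L
    using ps that by (simp add: projection_system_def)
  have hom0: "f x = \<zero>\<^bsub>M\<^esub>" if "i \<in> I" "j \<in> I" "i \<noteq> j" "linear_on R M (N i) (N j) f" "x \<in> N i" for i j f x
  proof -
    have "restrict f (N i) \<in> {zero_hom (M\<lparr>carrier := N i\<rparr>) (M\<lparr>carrier := N j\<rparr>)}"
      using restrict_in_mod_hom[OF that(4) sub[OF that(1)]] dec that(1,2,3)
      by (simp add: co_prime_decomposition_def)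
    then have "restrict f (N i) x = zero_hom (M\<lparr>carrier := N i\<rparr>) (M\<lparr>carrier := N j\<rparr>) x" by simp
    then show ?thesis using that(5) by (simp add: zero_hom_def)
  qed
  fix P assume "direct_summand R P M"
  then obtain P' where P': "direct_sum_of_two R M P P' (carrier M)" by (auto simp: direct_summand_iff)
  note sP = direct_sum_of_two_submodule[OF P']
  obtain e where e: "linear_on R M (carrier M) P e" and eP: "\<And>x. x \<in> P \<Longrightarrow> e x = x"
    and eP': "\<And>x. x \<in> P' \<Longrightarrow> e x = \<zero>\<^bsub>M\<^esub>"
    using direct_sum_of_two_projection[OF P'] by blast
  have N_carrier: "N i \<subseteq> carrier M" if "i \<in> I" for i by (rule submoduleD(1)[OF sub[OF that]])
  txt \<open>There being no non-zero maps between different \<open>N i\<close>, each of them is fully invariant.\<close>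
  have eN: "e x \<in> N i" if i: "i \<in> I" and x: "x \<in> N i" for i x
  proof -
    have xM: "x \<in> carrier M" using x N_carrier[OF i] by auto
    have y: "e x \<in> carrier M" using linear_on_closed[OF e xM] sP by auto
    have py: "\<pi> i (e x) \<in> N i" by (rule linear_on_closed[OF \<pi>(1)[OF i] y])
    then have py': "\<pi> i (e x) \<in> carrier M" using N_carrier[OF i] by auto
    \<comment> \<open>This difference is killed by every projection: by the \<open>i\<close>-th
      because it fixes \<open>N i\<close>, by any other \<open>j\<close> because \<pi>
      \<open>j\<close> kills \<open>N i\<close> and \<open>x \<mapsto> \<pi> j (e x)\<close> is a
      map from \<open>N i\<close> to \<open>N j\<close>, hence zero.\<close>
    have "e x \<ominus>\<^bsub>M\<^esub> \<pi> i (e x) = \<zero>\<^bsub>M\<^esub>"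
    proof (rule projections_faithful[of I N, OF sub ps])
      show "e x \<ominus>\<^bsub>M\<^esub> \<pi> i (e x) \<in> carrier M" using y py' by simp
      fix j assume j: "j \<in> I"
      have m: "\<pi> j (e x \<ominus>\<^bsub>M\<^esub> \<pi> i (e x)) = \<pi> j (e x) \<ominus>\<^bsub>M\<^esub> \<pi> j (\<pi> i (e x))"
        by (rule linear_on_minus[OF \<pi>(1)[OF j] submodule_carrier N_carrier[OF j] y py'])
      show "\<pi> j (e x \<ominus>\<^bsub>M\<^esub> \<pi> i (e x)) = \<zero>\<^bsub>M\<^esub>"
      proof (cases "j = i")
        case True
        then show ?thesis using m \<pi>(2)[OF i py] py' by simp
      next
        case False
        have "linear_on R M (N i) (N j) (\<lambda>x. \<pi> j (e x))"
          by (rule linear_on_compose[OF linear_on_subset[OF e N_carrier[OF i] order_refl]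
                linear_on_subset[OF \<pi>(1)[OF j] sP(4) order_refl]])
        then have "\<pi> j (e x) = \<zero>\<^bsub>M\<^esub>" using hom0[OF i j] False x by blast
        then show ?thesis using m \<pi>0[OF j i False py] by simp
      qed
    qed
    then have "e x = \<pi> i (e x)" using y py' by simp
    then show ?thesis using py by simp
  qed
  show "co_retractable R (M\<lparr>carrier := P\<rparr>)"
  proof (rule co_retractableI[OF sP(1)], rule ccontr)
    fix Y assume Y: "submodule Y R M" "Y \<subseteq> P" "Y \<noteq> P"
      and "\<not> (\<exists>f. linear_on R M P P f \<and> (\<forall>y\<in>Y. f y = \<zero>\<^bsub>M\<^esub>) \<and> (\<exists>x\<in>P. f x \<noteq> \<zero>\<^bsub>M\<^esub>))"
    then have no: "f x = \<zero>\<^bsub>M\<^esub>" if "linear_on R M P P f" "\<And>y. y \<in> Y \<Longrightarrow> f y = \<zero>\<^bsub>M\<^esub>" "x \<in> P" for f x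
      using that by blast
    have step: "L <+>\<^bsub>M\<^esub> (P \<inter> N i) \<noteq> P"
      if i: "i \<in> I" and L: "submodule L R M" "Y \<subseteq> L" "L \<subseteq> P" "L \<noteq> P" for i L
    proof
      assume eq: "L <+>\<^bsub>M\<^esub> (P \<inter> N i) = P"
      txt \<open>A non-zero endomorphism of \<open>P \<inter> N i\<close> killing \<open>L \<inter> N i\<close> would extend by \<open>0\<close> on \<open>L\<close> to \<open>P\<close>.\<close>
      let ?Pi = "P \<inter> N i" and ?T = "(L \<inter> (P \<inter> N i)) <+>\<^bsub>M\<^esub> (P' \<inter> N i)"
      have sPi: "submodule ?Pi R M" "submodule (L \<inter> ?Pi) R M" "submodule (P' \<inter> N i) R M"
        using sP L(1) sub[OF i] by (simp_all add: submodule_Int)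
      have "\<not> ?Pi \<subseteq> L" using set_add_least[OF L(1) order_refl, of ?Pi] eq L(3,4) by auto
      then obtain p where p: "p \<in> ?Pi" "p \<notin> L" by blast
      \<comment> \<open>Co-primeness concerns \<open>N i\<close>, which is the sum of
        \<open>?Pi\<close> and \<open>P' \<inter> N i\<close> because \<open>e\<close> maps it into
        itself. The second part is included in \<open>?T\<close> so that an endomorphism killing
        \<open>?T\<close> is determined by its values on \<open>?Pi\<close>.\<close>
      have T: "submodule ?T R M" by (rule submodule_set_add[OF sPi(2,3)])
      have TN: "?T \<subseteq> N i" by (rule set_add_least[OF sub[OF i]]) auto
      \<comment> \<open>Applying \<open>e\<close> to \<open>y \<oplus> p'\<close> erases
        \<open>p'\<close>, so a decomposition of \<open>p\<close> in \<open>?T\<close> would give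
        \<open>p = y \<in> L\<close>.\<close>
      have "p \<notin> ?T"
      proof
        assume "p \<in> ?T"
        then obtain y p' where yp: "y \<in> L" "y \<in> P" "p' \<in> P'" "p = y \<oplus>\<^bsub>M\<^esub> p'" by (auto simp: set_add_iff)
        have c: "y \<in> carrier M" "p' \<in> carrier M" using yp sP by auto
        have "p = y" using linear_on_add[OF e c] eP[of p] eP[OF yp(2)] eP'[OF yp(3)] yp(4) p(1) c by simp
        then show False using p(2) yp(1) by simp
      qed
      then have TN': "?T \<noteq> N i" using p(1) by blast
      \<comment> \<open>With \<open>e\<close> as the test map, co-primeness gives an
        \<open>h\<close> whose composite with \<open>e\<close> is non-zero and takes values in
        \<open>?Pi\<close>; \<open>h\<close> alone might map into \<open>P'\<close>.\<close>
      have "e p \<noteq> \<zero>\<^bsub>M\<^esub>" using eP[of p] p submoduleD(3)[OF L(1)] by auto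
      moreover have eNi: "linear_on R M (N i) (N i) e"
        by (rule linear_on_codomain[OF linear_on_subset[OF e N_carrier[OF i] order_refl]])
          (use eN[OF i] in auto)
      moreover have "co_prime R (M\<lparr>carrier := N i\<rparr>)" using dec i by (simp add: co_prime_decomposition_def)
      ultimately obtain h z where h: "linear_on R M (N i) (N i) h" "\<And>y. y \<in> ?T \<Longrightarrow> h y = \<zero>\<^bsub>M\<^esub>"
        and z: "z \<in> N i" "e (h z) \<noteq> \<zero>\<^bsub>M\<^esub>"
        using co_primeD[OF _ sub[OF i] T TN TN', of e p] p(1) by blast
      have zM: "z \<in> carrier M" using z(1) N_carrier[OF i] by auto
      \<comment> \<open>The component \<open>v\<close> of \<open>z\<close> lies in
        \<open>?T\<close>, where \<open>h\<close> vanishes, so the witness can be moved from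
        \<open>z\<close> to its component \<open>u\<close> in \<open>?Pi\<close>.\<close>
      obtain u v where uv: "u \<in> P" "v \<in> P'" "z = u \<oplus>\<^bsub>M\<^esub> v"
        using direct_sum_of_two_elem[OF P' zM] .
      have c: "u \<in> carrier M" "v \<in> carrier M" using uv sP by auto
      have "u = e z" using linear_on_add[OF e c] eP[OF uv(1)] eP'[OF uv(2)] uv(3) c by simp
      then have uN: "u \<in> N i" using eN[OF i z(1)] by simp
      have "z \<ominus>\<^bsub>M\<^esub> u = v" unfolding uv(3) using add_diff_cancel_left[OF c] .
      then have vN: "v \<in> N i" using submodule_minus[OF sub[OF i] z(1) uN] by simp
      then have "v \<in> ?T" using uv(2) subset_set_add2[OF sPi(2,3)] by auto
      then have "h z = h u"
        using linear_on_add[OF h(1) uN vN] uv(3) h(2) linear_on_closed[OF h(1) uN] N_carrier[OF i] by auto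
      then have u0: "e (h u) \<noteq> \<zero>\<^bsub>M\<^esub>" using z(2) by simp
      have "linear_on R M (N i) ?Pi (\<lambda>x. e (h x))"
        by (rule linear_on_codomain[OF linear_on_compose[OF h(1) eNi]])
          (use linear_on_closed[OF h(1)] linear_on_closed[OF e] eN[OF i] N_carrier[OF i] in blast)
      then have g: "linear_on R M ?Pi ?Pi (\<lambda>x. e (h x))" by (rule linear_on_subset) auto
      have g0: "e (h x) = \<zero>\<^bsub>M\<^esub>" if "x \<in> L" "x \<in> ?Pi" for x
      proof -
        have "x \<in> ?T" using that subset_set_add1[OF sPi(2,3)] by auto
        then show ?thesis using h(2) eP[OF submoduleD(3)[OF sP(1)]] by simp
      qed
      \<comment> \<open>The sum of \<open>L\<close> and \<open>?Pi\<close> is \<open>P\<close> by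
        \<open>eq\<close>. The extension by zero on \<open>L\<close>, which contains
        \<open>Y\<close>, is an endomorphism of \<open>P\<close> that \<open>no\<close> forces to
        vanish, although its value at \<open>u\<close> is non-zero.\<close>
      obtain f where f: "linear_on R M P ?Pi f" "\<And>x. x \<in> L \<Longrightarrow> f x = \<zero>\<^bsub>M\<^esub>" "\<And>x. x \<in> ?Pi \<Longrightarrow> f x = e (h x)"
        using linear_on_glue[OF L(1) sPi(1,1) g g0] unfolding eq by blast
      have "f u = \<zero>\<^bsub>M\<^esub>"
        by (rule no[OF linear_on_subset[OF f(1)]]) (use f(2) L(2) uv(1) in auto)
      then show False using f(3)[of u] uv(1) uN u0 by simp
    qed
    \<comment> \<open>The induction keeps \<open>L\<close> proper and above \<open>Y\<close>, which
      is what \<open>step\<close> requires before the next part is added.\<close>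
    have "\<exists>L. submodule L R M \<and> Y \<subseteq> L \<and> L \<subseteq> P \<and> L \<noteq> P \<and> (\<forall>i\<in>F. P \<inter> N i \<subseteq> L)"
      if "finite F" "F \<subseteq> I" for F
      using that
    proof (induction F)
      case empty
      then show ?case using Y by (intro exI[of _ Y]) auto
    next
      case (insert i F)
      then obtain L where L: "submodule L R M" "Y \<subseteq> L" "L \<subseteq> P" "L \<noteq> P" "\<forall>i\<in>F. P \<inter> N i \<subseteq> L" by auto
      have i: "i \<in> I" using insert.prems by simp
      have Pi: "submodule (P \<inter> N i) R M" by (rule submodule_Int[OF sP(1) sub[OF i]])
      let ?L = "L <+>\<^bsub>M\<^esub> (P \<inter> N i)"
      note add = subset_set_add1[OF L(1) Pi] subset_set_add2[OF L(1) Pi]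
      have "\<forall>k\<in>insert i F. P \<inter> N k \<subseteq> ?L" using add order_trans[OF _ add(1)] L(5) by auto
      moreover have "Y \<subseteq> ?L" by (rule order_trans[OF L(2) add(1)])
      moreover have "?L \<subseteq> P" by (rule set_add_least[OF sP(1) L(3)]) simp
      ultimately show ?case
        using step[OF i L(1-4)] submodule_set_add[OF L(1) Pi] by blast
    qed
    from this[OF fin order_refl]
    obtain L where L: "submodule L R M" "L \<subseteq> P" "L \<noteq> P" "\<forall>i\<in>I. P \<inter> N i \<subseteq> L"
      by (elim exE conjE)
    \<comment> \<open>Since \<open>e\<close> maps \<open>N i\<close> into
      \<open>P \<inter> N i \<subseteq> L\<close>, the preimage of \<open>L\<close> under
      \<open>e\<close> contains every \<open>N i\<close> and is therefore everything;
      \<open>e\<close> being the identity on \<open>P\<close>, this gives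
      \<open>P \<subseteq> L\<close>.\<close>
    have "{x \<in> carrier M. e x \<in> L} = carrier M"
    proof (rule least)
      show "submodule {x \<in> carrier M. e x \<in> L} R M"
        by (rule submodule_vimage[OF e submodule_carrier sP(1) L(1)])
      show "\<forall>i\<in>I. N i \<subseteq> {x \<in> carrier M. e x \<in> L}"
      proof (intro ballI subsetI CollectI conjI)
        fix i x assume i: "i \<in> I" and x: "x \<in> N i"
        show xM: "x \<in> carrier M" using N_carrier[OF i] x by auto
        show "e x \<in> L" using linear_on_closed[OF e xM] eN[OF i x] L(4) i by auto
      qed
    qed
    then have "P \<subseteq> L" using eP sP(4) by (metis (no_types, lifting) mem_Collect_eq subset_iff)
    then show False using L by auto
  qed
qed

end

section \<open>Decomposition into indecomposable summands\<close>

text \<open>The summands are indexed by themselves, so that independence becomes a property of sets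
  of submodules and can be maximised with respect to inclusion.\<close>

definition independent_submodules :: "'a ring \<Rightarrow> ('a, 'b) module \<Rightarrow> 'b set set \<Rightarrow> bool" where
  "independent_submodules R M \<Z> \<longleftrightarrow>
     (\<forall>Z\<in>\<Z>. Z \<inter> generated_submodule R M (\<Union>(\<Z> - {Z})) = {\<zero>\<^bsub>M\<^esub>})"

lemma independent_submodulesD:
  "independent_submodules R M \<Z> \<Longrightarrow> Z \<in> \<Z> \<Longrightarrow> x \<in> Z \<Longrightarrow>
    x \<in> generated_submodule R M (\<Union>(\<Z> - {Z})) \<Longrightarrow> x = \<zero>\<^bsub>M\<^esub>"
  unfolding independent_submodules_def by blast

context right_module
begin

text \<open>Along a chain the sums of the other members are nested, so their union is a submodule
  and contains the sum for the whole union. A common element is thus already seen at a single stage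
  of the chain.\<close>

lemma independent_submodules_Union_chain:
  assumes chain: "subset.chain {\<Z>. \<Z> \<subseteq> \<A> \<and> independent_submodules R M \<Z>} \<C>"
    and ne: "\<C> \<noteq> {}" and \<A>: "\<And>Z. Z \<in> \<A> \<Longrightarrow> submodule Z R M"
  shows "independent_submodules R M (\<Union>\<C>)"
  unfolding independent_submodules_def
proof
  have mem: "\<Z> \<subseteq> \<A>" "independent_submodules R M \<Z>" if "\<Z> \<in> \<C>" for \<Z>
    using chain that by (auto simp: subset_chain_def)
  have tot: "\<Z> \<subseteq> \<Z>' \<or> \<Z>' \<subseteq> \<Z>" if "\<Z> \<in> \<C>" "\<Z>' \<in> \<C>" for \<Z> \<Z>'
    using chain that by (auto simp: subset_chain_def)
  fix Z assume "Z \<in> \<Union>\<C>"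
  then obtain \<Z>0 where \<Z>0: "\<Z>0 \<in> \<C>" "Z \<in> \<Z>0" by blast
  let ?g = "\<lambda>\<Z>. generated_submodule R M (\<Union>(\<Z> - {Z}))"
  have carr: "\<Union>(\<Z> - {Z}) \<subseteq> carrier M" if "\<Z> \<in> \<C>" for \<Z>
    using mem(1)[OF that] \<A> submoduleD(1) by blast
  have mono: "?g \<Z> \<subseteq> ?g \<Z>'" if "\<Z> \<subseteq> \<Z>'" for \<Z> \<Z>'
    by (rule generated_mono) (use that in blast)
  have "submodule (\<Union>(?g ` \<C>)) R M"
  proof (rule submodule_Union_chain)
    show "?g ` \<C> \<noteq> {}" using ne by simp
    show "submodule A R M" if "A \<in> ?g ` \<C>" for A using that submodule_generated[OF carr] by auto
    show "A \<subseteq> B \<or> B \<subseteq> A" if A: "A \<in> ?g ` \<C>" and B: "B \<in> ?g ` \<C>" for A B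
    proof -
      obtain \<Z> \<Z>' where z: "\<Z> \<in> \<C>" "\<Z>' \<in> \<C>" "A = ?g \<Z>" "B = ?g \<Z>'" using A B by auto
      show ?thesis using tot[OF z(1,2)] mono unfolding z(3,4) by blast
    qed
  qed
  then have sub: "?g (\<Union>\<C>) \<subseteq> \<Union>(?g ` \<C>)"
  proof (rule generated_least)
    show "\<Union>(\<Union>\<C> - {Z}) \<subseteq> \<Union>(?g ` \<C>)"
    proof
      fix x assume "x \<in> \<Union>(\<Union>\<C> - {Z})"
      then obtain Z' \<Z> where "\<Z> \<in> \<C>" "Z' \<in> \<Z>" "Z' \<noteq> Z" "x \<in> Z'" by blast
      then have "x \<in> ?g \<Z>" using generated_superset[of "\<Union>(\<Z> - {Z})"] by blast
      then show "x \<in> \<Union>(?g ` \<C>)" using \<open>\<Z> \<in> \<C>\<close> by blast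
    qed
  qed
  show "Z \<inter> ?g (\<Union>\<C>) = {\<zero>\<^bsub>M\<^esub>}"
  proof
    show "Z \<inter> ?g (\<Union>\<C>) \<subseteq> {\<zero>\<^bsub>M\<^esub>}"
    proof
      fix x assume x: "x \<in> Z \<inter> ?g (\<Union>\<C>)"
      then obtain \<Z>1 where \<Z>1: "\<Z>1 \<in> \<C>" "x \<in> ?g \<Z>1" using sub by blast
      \<comment> \<open>The larger of two stages: one contains \<open>Z\<close>, the other has
        \<open>x\<close> in its sum.\<close>
      obtain \<Z> where \<Z>: "\<Z> \<in> \<C>" "\<Z>0 \<subseteq> \<Z>" "\<Z>1 \<subseteq> \<Z>" using tot[OF \<Z>0(1) \<Z>1(1)] \<Z>0(1) \<Z>1(1) by blast
      have "x \<in> Z \<inter> ?g \<Z>" using x mono[OF \<Z>(3)] \<Z>1(2) by blast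
      moreover have "Z \<in> \<Z>" using \<Z>0(2) \<Z>(2) by blast
      ultimately show "x \<in> {\<zero>\<^bsub>M\<^esub>}" using independent_submodulesD[OF mem(2)[OF \<Z>(1)]] by blast
    qed
    have "submodule Z R M" using \<A> mem(1)[OF \<Z>0(1)] \<Z>0(2) by blast
    moreover have "submodule (?g (\<Union>\<C>)) R M"
      by (rule submodule_generated) (use carr in blast)
    ultimately show "{\<zero>\<^bsub>M\<^esub>} \<subseteq> Z \<inter> ?g (\<Union>\<C>)" by (simp add: submoduleD(3))
  qed
qed

text \<open>The new member is covered by \<open>d\<close>. For an old member, write a common element
  as \<open>x = u \<oplus> z\<close> with \<open>z \<in> Z\<close>; then
  \<open>z = x \<ominus> u\<close> lies in the old sum, so \<open>z\<close> vanishes and the old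
  independence applies to \<open>x\<close>.\<close>

lemma independent_submodules_insert:
  assumes ind: "independent_submodules R M \<Z>" and sub: "\<And>Z. Z \<in> \<Z> \<Longrightarrow> submodule Z R M"
    and Z: "submodule Z R M" and d: "generated_submodule R M (\<Union>\<Z>) \<inter> Z = {\<zero>\<^bsub>M\<^esub>}"
  shows "independent_submodules R M (insert Z \<Z>)"
  unfolding independent_submodules_def
proof
  have carr: "\<Union>\<Y> \<subseteq> carrier M" if "\<Y> \<subseteq> \<Z>" for \<Y>
    using that sub submoduleD(1) by blast
  fix Z' assume Z': "Z' \<in> insert Z \<Z>"
  let ?g = "generated_submodule R M (\<Union>(insert Z \<Z> - {Z'}))"
  have "x = \<zero>\<^bsub>M\<^esub>" if x: "x \<in> Z'" "x \<in> ?g" for x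
  proof (cases "Z' = Z")
    case True
    have "?g \<subseteq> generated_submodule R M (\<Union>\<Z>)" by (rule generated_mono) (use True in blast)
    then show ?thesis using x d True by blast
  next
    case False
    let ?h = "generated_submodule R M (\<Union>(\<Z> - {Z'}))"
    have hs: "submodule ?h R M" by (rule submodule_generated) (rule carr, blast)
    have "\<Union>(insert Z \<Z> - {Z'}) = \<Union>(\<Z> - {Z'}) \<union> Z" using False by blast
    then have "x \<in> ?h <+>\<^bsub>M\<^esub> Z" using x(2) generated_Un[OF carr Z, of "\<Z> - {Z'}"] by auto
    then obtain u z where uz: "u \<in> ?h" "z \<in> Z" "x = u \<oplus>\<^bsub>M\<^esub> z" by (auto simp: set_add_iff)
    have c: "u \<in> carrier M" "z \<in> carrier M" using uz submoduleD(2)[OF hs] submoduleD(2)[OF Z] by auto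
    let ?W = "generated_submodule R M (\<Union>\<Z>)"
    have W: "submodule ?W R M" by (rule submodule_generated[OF carr]) simp
    have "u \<in> ?W" using uz(1) generated_mono[of "\<Union>(\<Z> - {Z'})" "\<Union>\<Z>"] by blast
    moreover have "x \<in> ?W" using x(1) Z' False generated_superset[of "\<Union>\<Z>"] by blast
    moreover have "x \<ominus>\<^bsub>M\<^esub> u = z"
      unfolding uz(3) using add_diff_cancel_left[OF c] .
    ultimately have "z \<in> ?W" using submodule_minus[OF W, of x u] by simp
    then have "z = \<zero>\<^bsub>M\<^esub>" using uz(2) d by blast
    then have "x \<in> ?h" using uz(1,3) c by simp
    then show ?thesis using independent_submodulesD[OF ind _ x(1)] Z' False by blast
  qed
  moreover have "submodule ?g R M"
    by (rule submodule_generated) (use carr[of \<Z>] submoduleD(1)[OF Z] in blast)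
  moreover have "submodule Z' R M" using Z' Z sub by blast
  ultimately show "Z' \<inter> ?g = {\<zero>\<^bsub>M\<^esub>}" using submoduleD(3) by blast
qed

section \<open>Consequences of the dual Baer property\<close>

context
  assumes DB: "dual_Baer R M"
begin

text \<open>Let \<open>N\<close> be the sum of the images and \<open>e\<close> the idempotent with
  \<open>Hom(M, N) = e S\<close>. As \<open>e = e e\<close> lies in \<open>e S\<close>, the image of
  \<open>e\<close> lies in \<open>N\<close>; every \<open>f\<close> of the family factors as
  \<open>f = e h\<close>, so its image lies in that of \<open>e\<close>. Hence \<open>N\<close> is
  the image of \<open>e\<close>.\<close>

lemma sum_of_images_direct_summand:
  assumes F: "\<And>f. f \<in> F \<Longrightarrow> linear_on R M (carrier M) (carrier M) f"
  shows "direct_summand R (generated_submodule R M (\<Union>f\<in>F. f ` carrier M)) M"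
proof -
  define N where "N = generated_submodule R M (\<Union>f\<in>F. f ` carrier M)"
  let ?S = "End_ring R M"
  have N: "submodule N R M"
    unfolding N_def by (rule submodule_generated) (use linear_on_closed[OF F] in blast)
  obtain e where e: "e \<in> carrier ?S" "e \<otimes>\<^bsub>?S\<^esub> e = e"
      "mod_hom R M (M\<lparr>carrier := N\<rparr>) = e <#\<^bsub>?S\<^esub> carrier ?S"
    using DB N unfolding dual_Baer_def by blast
  have eh: "linear_on R M (carrier M) (carrier M) e"
    using e(1) by (intro mod_hom_self_imp_linear_on) (simp add: End_ring_def)
  have idem: "e (e x) = e x" if "x \<in> carrier M" for x
    using fun_cong[OF e(2), of x] that by (simp add: End_ring_def compose_def)
  have eN: "e x \<in> N" if "x \<in> carrier M" for x
  proof -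
    have "e \<otimes>\<^bsub>?S\<^esub> e \<in> mod_hom R M (M\<lparr>carrier := N\<rparr>)" unfolding e(3) l_coset_def using e(1) by blast
    then have "e \<in> mod_hom R M (M\<lparr>carrier := N\<rparr>)" using e(2) by simp
    then show ?thesis using that by (auto simp: mod_hom_def)
  qed
  have ef: "f x \<in> e ` carrier M" if f: "f \<in> F" and x: "x \<in> carrier M" for f x
  proof -
    have "f x \<in> N" if "x \<in> carrier M" for x
      unfolding N_def by (rule subsetD[OF generated_superset]) (use f that in blast)
    then have "restrict f (carrier M) \<in> mod_hom R M (M\<lparr>carrier := N\<rparr>)"
      using F[OF f] by (auto simp: mod_hom_def linear_on_def)
    then obtain h where h: "h \<in> carrier ?S" "restrict f (carrier M) = e \<otimes>\<^bsub>?S\<^esub> h"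
      unfolding e(3) l_coset_def by blast
    have "f x = e (h x)" using fun_cong[OF h(2), of x] x by (simp add: End_ring_def compose_def)
    moreover have "h x \<in> carrier M" using h(1) x by (auto simp: End_ring_def mod_hom_def)
    ultimately show ?thesis by blast
  qed
  have "N = e ` carrier M"
  proof
    show "N \<subseteq> e ` carrier M"
      unfolding N_def
      by (rule generated_least[OF submodule_image[OF eh submodule_carrier submodule_carrier]]) (use ef in blast)
    show "e ` carrier M \<subseteq> N" using eN by blast
  qed
  then show ?thesis
    using direct_sum_of_two_idempotent[OF eh submodule_carrier idem] by (auto simp: N_def direct_summand_iff)
qed

text \<open>A summand is the image of its projection. The union of a chain of summands is its own
  sum, so upper bounds for Zorn's lemma come from here.\<close>

lemma sum_direct_summands:
  assumes "\<And>A. A \<in> \<A> \<Longrightarrow> direct_summand R A M"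
  shows "direct_summand R (generated_submodule R M (\<Union>\<A>)) M"
proof -
  have "\<exists>p. linear_on R M (carrier M) (carrier M) p \<and> p ` carrier M = A" if A: "A \<in> \<A>" for A
    using direct_summand_projection[OF assms[OF A]]
      linear_on_subset[OF _ order_refl submoduleD(1)[OF direct_summandD[OF assms[OF A]]]] by metis
  then obtain p where p: "\<And>A. A \<in> \<A> \<Longrightarrow> linear_on R M (carrier M) (carrier M) (p A) \<and> p A ` carrier M = A"
    by metis
  have "direct_summand R (generated_submodule R M (\<Union>f\<in>p ` \<A>. f ` carrier M)) M"
    by (rule sum_of_images_direct_summand) (use p in auto)
  moreover have "(\<Union>f\<in>p ` \<A>. f ` carrier M) = \<Union>\<A>" using p by auto
  ultimately show ?thesis by simp
qed

text \<open>Precomposing with a projection onto \<open>X\<close> makes the image of \<open>f\<close>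
  the image of an endomorphism of \<open>M\<close>.\<close>

lemma image_direct_summand:
  assumes X: "direct_summand R X M" and Z: "submodule Z R M" and f: "linear_on R M X Z f"
  shows "direct_summand R (f ` X) M"
proof -
  obtain p where p: "linear_on R M (carrier M) X p" "p ` carrier M = X"
    using direct_summand_projection[OF X] .
  have im: "(\<lambda>x. f (p x)) ` carrier M = f ` X" unfolding p(2)[symmetric] image_image ..
  have "linear_on R M (carrier M) (carrier M) (\<lambda>x. f (p x))"
    by (rule linear_on_subset[OF linear_on_compose[OF p(1) f] order_refl submoduleD(1)[OF Z]])
  then have "direct_summand R (generated_submodule R M (\<Union>g\<in>{\<lambda>x. f (p x)}. g ` carrier M)) M"
    by (intro sum_of_images_direct_summand) auto
  then have "direct_summand R (generated_submodule R M (f ` X)) M" using im by simp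
  moreover have "generated_submodule R M (f ` X) = f ` X"
    using generated_least[OF submodule_image[OF f direct_summandD[OF X] Z] order_refl]
      generated_superset[of "f ` X"] by blast
  ultimately show ?thesis by simp
qed

text \<open>The image is a summand of \<open>M\<close> inside \<open>Z\<close>, hence a summand of
  \<open>Z\<close> by the modular law, and it is not zero.\<close>

lemma image_indecomposable:
  assumes X: "direct_summand R X M" and Z: "submodule Z R M"
    and ind: "indecomposable R (M\<lparr>carrier := Z\<rparr>)"
    and f: "linear_on R M X Z f" "x \<in> X" "f x \<noteq> \<zero>\<^bsub>M\<^esub>"
  shows "f ` X = Z"
proof -
  obtain B where B: "direct_sum_of_two R M (f ` X) B (carrier M)"
    using image_direct_summand[OF X Z f(1)] by (auto simp: direct_summand_iff)
  have "f ` X \<subseteq> Z" using linear_on_closed[OF f(1)] by blast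
  then have "direct_sum_of_two R M (f ` X) (B \<inter> Z) Z"
    by (intro direct_sum_of_two_restrict[OF B Z] submoduleD(1)[OF Z])
  then show ?thesis using ind f(2,3) by (auto simp: indecomposable_carrier_update_iff[OF Z])
qed

text \<open>A complement of a summand that is maximal among those avoiding a fixed non-zero element is
  indecomposable.\<close>

lemma exists_indecomposable_summand:
  assumes X: "direct_summand R X M" and ne: "X \<noteq> {\<zero>\<^bsub>M\<^esub>}"
  obtains Z where "direct_summand R Z M" "Z \<subseteq> X" "indecomposable R (M\<lparr>carrier := Z\<rparr>)"
proof -
  have sX: "submodule X R M" by (rule direct_summandD[OF X])
  then obtain x where x: "x \<in> X" "x \<noteq> \<zero>\<^bsub>M\<^esub>" using ne submoduleD(3)[OF sX] by blast
  define \<A> where "\<A> = {Y. direct_summand R Y M \<and> Y \<subseteq> X \<and> x \<notin> Y}"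
  have "\<exists>Y\<in>\<A>. \<forall>Y'\<in>\<A>. Y \<subseteq> Y' \<longrightarrow> Y' = Y"
  proof (rule subset_Zorn_nonempty)
    have "{\<zero>\<^bsub>M\<^esub>} \<in> \<A>" using direct_summand_zero x submoduleD(3)[OF sX] by (auto simp: \<A>_def)
    then show "\<A> \<noteq> {}" by blast
    fix \<C> assume ne: "\<C> \<noteq> {}" and ch: "subset.chain \<A> \<C>"
    have mem: "direct_summand R Y M" "Y \<subseteq> X" "x \<notin> Y" if "Y \<in> \<C>" for Y
      using ch that by (auto simp: subset_chain_def \<A>_def)
    have sub: "submodule (\<Union>\<C>) R M"
      by (rule submodule_Union_chain[OF ne direct_summandD[OF mem(1)]])
        (use ch in \<open>auto simp: subset_chain_def\<close>)
    have "generated_submodule R M (\<Union>\<C>) = \<Union>\<C>"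
      using generated_least[OF sub order_refl] generated_superset[of "\<Union>\<C>"] by blast
    then have "direct_summand R (\<Union>\<C>) M" using sum_direct_summands[of \<C>, OF mem(1)] by simp
    then show "\<Union>\<C> \<in> \<A>" using mem by (auto simp: \<A>_def)
  qed
  then obtain Y where "Y \<in> \<A>" and mx: "\<forall>Y'\<in>\<A>. Y \<subseteq> Y' \<longrightarrow> Y' = Y" by (rule bexE)
  then have Y: "direct_summand R Y M" "Y \<subseteq> X" "x \<notin> Y" by (simp_all add: \<A>_def)
  have max: "Y' = Y" if "direct_summand R Y' M" "Y' \<subseteq> X" "x \<notin> Y'" "Y \<subseteq> Y'" for Y'
    using mx that by (simp add: \<A>_def)
  obtain Y' where "direct_sum_of_two R M Y Y' (carrier M)" using Y(1) by (auto simp: direct_summand_iff)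
  then have d: "direct_sum_of_two R M Y (Y' \<inter> X) X"
    by (rule direct_sum_of_two_restrict[OF _ sX Y(2) submoduleD(1)[OF sX]])
  define Z where "Z = Y' \<inter> X"
  note d = d[folded Z_def] and s = direct_sum_of_two_submodule[OF d[folded Z_def]]
  have YZ: "Y \<inter> Z = {\<zero>\<^bsub>M\<^esub>}" using d by (simp add: direct_sum_of_two_def)
  have ZM: "direct_summand R Z M"
    by (rule direct_summand_trans[OF direct_sum_of_two_commute[OF d] X])
  \<comment> \<open>The sum of \<open>Y\<close> and \<open>A\<close> is a summand inside
    \<open>X\<close>, strictly larger than \<open>Y\<close> because \<open>A\<close> meets
    \<open>Y\<close> trivially; by maximality of \<open>Y\<close> it cannot avoid
    \<open>x\<close>.\<close>
  have mem: "x \<in> Y <+>\<^bsub>M\<^esub> A" if AB: "direct_sum_of_two R M A B Z" and A: "A \<noteq> {\<zero>\<^bsub>M\<^esub>}" for A B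
  proof (rule ccontr)
    assume nx: "x \<notin> Y <+>\<^bsub>M\<^esub> A"
    note t = direct_sum_of_two_submodule[OF AB]
    have yab: "direct_sum_of_two R M (Y <+>\<^bsub>M\<^esub> A) B X" by (rule direct_sum_of_two_assoc[OF d AB])
    have "Y <+>\<^bsub>M\<^esub> A = Y"
      by (rule max[OF direct_summand_trans[OF yab X] direct_sum_of_two_submodule(4)[OF yab] nx
            subset_set_add1[OF s(1) t(1)]])
    then have "A \<subseteq> Y \<inter> Z" using subset_set_add2[OF s(1) t(1)] t(4) by blast
    then show False using YZ A submoduleD(3)[OF t(1)] by blast
  qed
  have "indecomposable R (M\<lparr>carrier := Z\<rparr>)"
    unfolding indecomposable_carrier_update_iff[OF s(2)]
  proof (intro conjI allI impI notI)
    assume "Z = {\<zero>\<^bsub>M\<^esub>}"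
    then show False using direct_sum_of_two_right_zero[of Y X] d x(1) Y(3) by simp
  next
    fix A B assume AB: "direct_sum_of_two R M A B Z"
    note t = direct_sum_of_two_submodule[OF AB]
    show "A = {\<zero>\<^bsub>M\<^esub>} \<or> A = Z"
    proof (rule ccontr)
      assume n: "\<not> ?thesis"
      then have "B \<noteq> {\<zero>\<^bsub>M\<^esub>}" using direct_sum_of_two_right_zero AB by blast
      then have "x \<in> Y <+>\<^bsub>M\<^esub> B" using mem direct_sum_of_two_commute[OF AB] by blast
      then obtain y b where yb: "y \<in> Y" "b \<in> B" "x = y \<oplus>\<^bsub>M\<^esub> b" by (auto simp: set_add_iff)
      have "x \<in> Y <+>\<^bsub>M\<^esub> A" using mem[OF AB] n by blast
      then obtain y' a where ya: "y' \<in> Y" "a \<in> A" "x = y' \<oplus>\<^bsub>M\<^esub> a" by (auto simp: set_add_iff)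
      have c: "y \<in> carrier M" "b \<in> carrier M" "y' \<in> carrier M" "a \<in> carrier M"
        using yb ya submoduleD(2) s(1) t(1,2) by blast+
      \<comment> \<open>The difference of the two representations of \<open>x\<close> lies in
        \<open>Y \<inter> Z\<close>, so \<open>a = b\<close> lies in \<open>A \<inter> B\<close> and
        \<open>x\<close> would be the element \<open>y'\<close> of \<open>Y\<close>.\<close>
      have eq: "y \<ominus>\<^bsub>M\<^esub> y' = a \<ominus>\<^bsub>M\<^esub> b" by (rule diff_eq_if_sums_eq[OF c]) (use yb(3) ya(3) in simp)
      have "a \<ominus>\<^bsub>M\<^esub> b \<in> Y" using submodule_minus[OF s(1) yb(1) ya(1)] eq by simp
      moreover have "a \<ominus>\<^bsub>M\<^esub> b \<in> Z" using submodule_minus[OF s(2), of a b] ya(2) yb(2) t(4,5) by blast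
      ultimately have "a \<ominus>\<^bsub>M\<^esub> b = \<zero>\<^bsub>M\<^esub>" using YZ by blast
      then have "a = b" using c by simp
      then have "a = \<zero>\<^bsub>M\<^esub>" using AB ya(2) yb(2) by (auto simp: direct_sum_of_two_def)
      then show False using ya c Y(3) by simp
    qed
  qed
  then show ?thesis using that ZM s(5) by blast
qed

text \<open>The sum of a maximal independent set of indecomposable summands is itself a summand; a
  non-zero complement would contain one more indecomposable summand, independent of the
  others.\<close>

lemma indecomposable_decomposition:
  obtains \<Z> where "\<And>Z. Z \<in> \<Z> \<Longrightarrow> direct_summand R Z M \<and> indecomposable R (M\<lparr>carrier := Z\<rparr>)"
    "independent_submodules R M \<Z>" "generated_submodule R M (\<Union>\<Z>) = carrier M"
proof -
  define \<A> where "\<A> = {Z. direct_summand R Z M \<and> indecomposable R (M\<lparr>carrier := Z\<rparr>)}"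
  have sub: "submodule Z R M" if "Z \<in> \<A>" for Z using that direct_summandD by (auto simp: \<A>_def)
  let ?P = "{\<Z>. \<Z> \<subseteq> \<A> \<and> independent_submodules R M \<Z>}"
  have "\<exists>\<Z>\<in>?P. \<forall>\<Y>\<in>?P. \<Z> \<subseteq> \<Y> \<longrightarrow> \<Y> = \<Z>"
  proof (rule subset_Zorn_nonempty)
    show "?P \<noteq> {}" by (auto simp: independent_submodules_def intro!: exI[of _ "{}"])
    show "\<Union>\<C> \<in> ?P" if "\<C> \<noteq> {}" "subset.chain ?P \<C>" for \<C>
      using independent_submodules_Union_chain[OF that(2,1) sub] that(2) by (auto simp: subset_chain_def)
  qed
  then obtain \<Z> where "\<Z> \<in> ?P" and mx: "\<forall>\<Y>\<in>?P. \<Z> \<subseteq> \<Y> \<longrightarrow> \<Y> = \<Z>" by (rule bexE)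
  then have \<Z>: "\<Z> \<subseteq> \<A>" "independent_submodules R M \<Z>" by simp_all
  have max: "\<Y> = \<Z>" if "\<Y> \<subseteq> \<A>" "independent_submodules R M \<Y>" "\<Z> \<subseteq> \<Y>" for \<Y>
    using mx that by simp
  define W where "W = generated_submodule R M (\<Union>\<Z>)"
  have "direct_summand R W M" unfolding W_def by (rule sum_direct_summands) (use \<Z>(1) in \<open>auto simp: \<A>_def\<close>)
  then obtain W' where W': "direct_sum_of_two R M W W' (carrier M)" by (auto simp: direct_summand_iff)
  have "W' = {\<zero>\<^bsub>M\<^esub>}"
  proof (rule ccontr)
    assume ne: "W' \<noteq> {\<zero>\<^bsub>M\<^esub>}"
    have "direct_summand R W' M" using direct_sum_of_two_commute[OF W'] by (auto simp: direct_summand_iff)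
    then obtain Z where Z: "direct_summand R Z M" "Z \<subseteq> W'" "indecomposable R (M\<lparr>carrier := Z\<rparr>)"
      using exists_indecomposable_summand[OF _ ne] by blast
    have ZA: "Z \<in> \<A>" using Z by (simp add: \<A>_def)
    have sZ: "submodule Z R M" using sub[OF ZA] .
    have WZ: "W \<inter> Z = {\<zero>\<^bsub>M\<^esub>}"
      using W' Z(2) submoduleD(3)[OF sZ] submoduleD(3)[OF direct_sum_of_two_submodule(1)[OF W']]
      unfolding direct_sum_of_two_def by blast
    have "independent_submodules R M (insert Z \<Z>)"
      by (rule independent_submodules_insert[OF \<Z>(2) _ sZ WZ[unfolded W_def]]) (use sub \<Z>(1) in blast)
    then have "insert Z \<Z> = \<Z>" using max[of "insert Z \<Z>"] ZA \<Z>(1) by blast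
    then have "Z \<subseteq> W" unfolding W_def using generated_superset[of "\<Union>\<Z>"] by blast
    then have "Z = {\<zero>\<^bsub>M\<^esub>}" using WZ by blast
    then show False using Z(3) unfolding indecomposable_carrier_update_iff[OF sZ] by blast
  qed
  then have "W = carrier M" using direct_sum_of_two_right_zero W' by blast
  then show ?thesis using that[of \<Z>] \<Z> by (auto simp: W_def \<A>_def)
qed

end

end

section \<open>Grouping the indecomposable summands\<close>

text \<open>Representatives are taken inside \<open>A\<close> so that the classes, and with them the
  M_i, can be indexed by some of the indecomposable summands.\<close>

lemma equivalence_transversal:
  assumes refl: "\<And>x. x \<in> A \<Longrightarrow> r x x"
    and sym: "\<And>x y. x \<in> A \<Longrightarrow> y \<in> A \<Longrightarrow> r x y \<Longrightarrow> r y x"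
    and trans: "\<And>x y z. x \<in> A \<Longrightarrow> y \<in> A \<Longrightarrow> z \<in> A \<Longrightarrow> r x y \<Longrightarrow> r y z \<Longrightarrow> r x z"
  shows "\<exists>I\<subseteq>A. (\<forall>x\<in>A. \<exists>y\<in>I. r y x) \<and> (\<forall>x\<in>I. \<forall>y\<in>I. r x y \<longrightarrow> x = y)"
proof (intro exI conjI ballI impI)
  define rep where "rep x = (SOME y. y \<in> A \<and> r x y)" for x
  have rep: "rep x \<in> A" "r x (rep x)" if "x \<in> A" for x
    using someI[of "\<lambda>y. y \<in> A \<and> r x y" x] refl that by (simp_all add: rep_def)
  show "rep ` A \<subseteq> A" using rep by blast
  show "\<exists>y\<in>rep ` A. r y x" if "x \<in> A" for x using rep[OF that] sym that by blast
  fix u v assume "u \<in> rep ` A" "v \<in> rep ` A" and uv: "r u v"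
  then obtain x y where x: "x \<in> A" "u = rep x" and y: "y \<in> A" "v = rep y" by auto
  have "r x y"
    using rep[OF x(1)] rep[OF y(1)] uv sym trans x y by metis
  \<comment> \<open>The predicates behind the two choices are equivalent, so the choices
    agree.\<close>
  then have "y' \<in> A \<and> r x y' \<longleftrightarrow> y' \<in> A \<and> r y y'" for y'
    using x(1) y(1) sym trans by blast
  then show "u = v" by (simp add: x y rep_def)
qed

context right_module
begin

text \<open>By independence each \<open>Z\<close> is a complement of the sum of the other members;
  the projection along that sum kills each of them.\<close>

lemma independent_projection_system:
  assumes sub: "\<And>Z. Z \<in> \<Z> \<Longrightarrow> submodule Z R M" and ind: "independent_submodules R M \<Z>"
    and gen: "generated_submodule R M (\<Union>\<Z>) = carrier M"
  obtains \<pi> where "projection_system R M \<Z> (\<lambda>Z. Z) \<pi>"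
proof -
  have "\<exists>p. linear_on R M (carrier M) Z p \<and> (\<forall>x\<in>Z. p x = x) \<and> (\<forall>Z'\<in>\<Z>. Z \<noteq> Z' \<longrightarrow> (\<forall>x\<in>Z'. p x = \<zero>\<^bsub>M\<^esub>))"
    if Z: "Z \<in> \<Z>" for Z
  proof -
    let ?g = "generated_submodule R M (\<Union>(\<Z> - {Z}))"
    have carr: "\<Union>(\<Z> - {Z}) \<subseteq> carrier M" using sub submoduleD(1) by blast
    have "\<Union>(\<Z> - {Z}) \<union> Z = \<Union>\<Z>" using Z by blast
    then have "?g <+>\<^bsub>M\<^esub> Z = carrier M" using generated_Un[OF carr sub[OF Z]] gen by simp
    moreover have "?g \<inter> Z = {\<zero>\<^bsub>M\<^esub>}" using ind Z unfolding independent_submodules_def by blast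
    ultimately have d: "direct_sum_of_two R M ?g Z (carrier M)"
      using sub[OF Z] submodule_generated[OF carr] by (simp add: direct_sum_of_two_def)
    obtain p where p: "linear_on R M (carrier M) Z p" "\<And>x. x \<in> Z \<Longrightarrow> p x = x"
        "\<And>x. x \<in> ?g \<Longrightarrow> p x = \<zero>\<^bsub>M\<^esub>"
      using direct_sum_of_two_projection[OF direct_sum_of_two_commute[OF d]] by blast
    have "p x = \<zero>\<^bsub>M\<^esub>" if "Z' \<in> \<Z>" "Z \<noteq> Z'" "x \<in> Z'" for Z' x
      by (rule p(3), rule subsetD[OF generated_superset]) (use that in blast)
    then show ?thesis using p(1,2) by blast
  qed
  then have "\<forall>Z\<in>\<Z>. \<exists>p. linear_on R M (carrier M) Z p \<and> (\<forall>x\<in>Z. p x = x) \<and>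
      (\<forall>Z'\<in>\<Z>. Z \<noteq> Z' \<longrightarrow> (\<forall>x\<in>Z'. p x = \<zero>\<^bsub>M\<^esub>))" by (rule ballI)
  then obtain \<pi> where \<pi>: "\<forall>Z\<in>\<Z>. linear_on R M (carrier M) Z (\<pi> Z) \<and> (\<forall>x\<in>Z. \<pi> Z x = x) \<and>
      (\<forall>Z'\<in>\<Z>. Z \<noteq> Z' \<longrightarrow> (\<forall>x\<in>Z'. \<pi> Z x = \<zero>\<^bsub>M\<^esub>))"
    by (rule bchoice[THEN exE])
  have "L = carrier M" if L: "submodule L R M" "\<forall>Z\<in>\<Z>. Z \<subseteq> L" for L
    using generated_least[OF L(1), of "\<Union>\<Z>"] L(2) submoduleD(1)[OF L(1)] gen by (simp add: Sup_le_iff)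
  then have "projection_system R M \<Z> (\<lambda>Z. Z) \<pi>"
    using \<pi> sub by (simp add: projection_system_def)
  then show ?thesis by (rule that)
qed

text \<open>The kernel of \<open>\<pi> Z\<close> contains every member other than \<open>Z\<close>.
  Read backwards: a projection that is non-zero on an element of a partial sum belongs to a member
  of that partial sum.\<close>

lemma partial_sum_projection_zero:
  assumes ps: "projection_system R M \<Z> (\<lambda>Z. Z) \<pi>" and "\<A> \<subseteq> \<Z>" "Z \<in> \<Z> - \<A>"
    and x: "x \<in> generated_submodule R M (\<Union>\<A>)"
  shows "\<pi> Z x = \<zero>\<^bsub>M\<^esub>"
proof -
  have sub: "submodule Z R M" "linear_on R M (carrier M) Z (\<pi> Z)" if "Z \<in> \<Z>" for Z
    using ps that by (simp_all add: projection_system_def)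
  have "Z' \<subseteq> {x \<in> carrier M. \<pi> Z x = \<zero>\<^bsub>M\<^esub>}" if Z': "Z' \<in> \<A>" for Z'
  proof -
    have "Z' \<in> \<Z>" "Z \<in> \<Z>" "Z \<noteq> Z'" using Z' assms(2,3) by auto
    then have "\<pi> Z y = \<zero>\<^bsub>M\<^esub>" if "y \<in> Z'" for y
      using ps that by (simp add: projection_system_def)
    then show ?thesis using submoduleD(1)[OF sub(1)[OF \<open>Z' \<in> \<Z>\<close>]] by blast
  qed
  then have "generated_submodule R M (\<Union>\<A>) \<subseteq> {x \<in> carrier M. \<pi> Z x = \<zero>\<^bsub>M\<^esub>}"
    using submodule_kernel[OF sub(2) submodule_carrier sub(1)] assms(3)
    by (intro generated_least Sup_least) auto
  then show ?thesis using x by blast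
qed

text \<open>An element of both sums is killed by every projection, since each member is missing from
  one of the two families.\<close>

lemma partial_sum_complement:
  assumes ps: "projection_system R M \<Z> (\<lambda>Z. Z) \<pi>" and A: "\<A> \<subseteq> \<Z>"
  shows "direct_sum_of_two R M (generated_submodule R M (\<Union>\<A>)) (generated_submodule R M (\<Union>(\<Z> - \<A>))) (carrier M)"
    (is "direct_sum_of_two R M ?W ?W' _")
proof -
  have sub: "submodule Z R M" if "Z \<in> \<Z>" for Z using ps that by (simp add: projection_system_def)
  have W: "submodule ?W R M" "submodule ?W' R M"
    using A submoduleD(1)[OF sub] by (blast intro!: submodule_generated)+
  have "x = \<zero>\<^bsub>M\<^esub>" if x: "x \<in> ?W" "x \<in> ?W'" for x
  proof (rule projections_faithful[of \<Z> "\<lambda>Z. Z", OF sub ps])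
    show "x \<in> carrier M" by (rule submoduleD(2)[OF W(1) x(1)])
    fix Z assume Z: "Z \<in> \<Z>"
    show "\<pi> Z x = \<zero>\<^bsub>M\<^esub>"
    proof (cases "Z \<in> \<A>")
      case True
      then show ?thesis using partial_sum_projection_zero[OF ps _ _ x(2), of Z] Z by blast
    next
      case False
      then show ?thesis using partial_sum_projection_zero[OF ps A _ x(1), of Z] Z by blast
    qed
  qed
  moreover have "?W <+>\<^bsub>M\<^esub> ?W' = carrier M"
  proof -
    have "Z \<subseteq> ?W <+>\<^bsub>M\<^esub> ?W'" if Z: "Z \<in> \<Z>" for Z
    proof (cases "Z \<in> \<A>")
      case True
      then have "Z \<subseteq> ?W" using generated_superset[of "\<Union>\<A>"] by blast
      then show ?thesis using subset_set_add1[OF W] by (rule order_trans)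
    next
      case False
      then have "Z \<subseteq> ?W'" using Z generated_superset[of "\<Union>(\<Z> - \<A>)"] by blast
      then show ?thesis using subset_set_add2[OF W] by (rule order_trans)
    qed
    then show ?thesis using ps submodule_set_add[OF W] by (simp add: projection_system_def)
  qed
  moreover have "\<zero>\<^bsub>M\<^esub> \<in> ?W" "\<zero>\<^bsub>M\<^esub> \<in> ?W'" using submoduleD(3)[OF W(1)] submoduleD(3)[OF W(2)] .
  ultimately show ?thesis using W unfolding direct_sum_of_two_def by blast
qed

lemma partial_sum_internal_direct_sum:
  assumes ps: "projection_system R M \<Z> (\<lambda>Z. Z) \<pi>" and A: "\<A> \<subseteq> \<Z>"
  shows "is_internal_direct_sum R (M\<lparr>carrier := generated_submodule R M (\<Union>\<A>)\<rparr>) \<A> (\<lambda>Z. Z)"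
proof -
  define W where "W = generated_submodule R M (\<Union>\<A>)"
  have W: "submodule W R M"
    unfolding W_def by (rule direct_sum_of_two_submodule(1)[OF partial_sum_complement[OF ps A]])
  interpret W: right_module R "M\<lparr>carrier := W\<rparr>" by (rule submodule_is_right_module) (rule W)
  have sub: "submodule Z R (M\<lparr>carrier := W\<rparr>)" if "Z \<in> \<A>" for Z
  proof -
    have "Z \<subseteq> W" unfolding W_def using that generated_superset[of "\<Union>\<A>"] by blast
    moreover have "submodule Z R M" using ps that A by (auto simp: projection_system_def)
    ultimately show ?thesis by (simp add: submodule_carrier_update_iff[OF W])
  qed
  have "L = W" if L: "submodule L R M" "L \<subseteq> W" "\<forall>Z\<in>\<A>. Z \<subseteq> L" for L
    using L generated_least[OF L(1), of "\<Union>\<A>"] by (auto simp: W_def)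
  moreover have "linear_on R M W Z (\<pi> Z)" if "Z \<in> \<A>" for Z
  proof -
    have "linear_on R M (carrier M) Z (\<pi> Z)" using ps subsetD[OF A that] by (simp add: projection_system_def)
    then show ?thesis by (rule linear_on_subset[OF _ submoduleD(1)[OF W] order_refl])
  qed
  moreover have "\<forall>Z\<in>\<A>. \<forall>x\<in>Z. \<pi> Z x = x" "\<forall>Z\<in>\<A>. \<forall>Z'\<in>\<A>. Z \<noteq> Z' \<longrightarrow> (\<forall>x\<in>Z'. \<pi> Z x = \<zero>\<^bsub>M\<^esub>)"
    using ps A unfolding projection_system_def by (meson subsetD)+
  ultimately have psW: "projection_system R (M\<lparr>carrier := W\<rparr>) \<A> (\<lambda>Z. Z) \<pi>"
    using sub by (simp add: projection_system_def submodule_carrier_update_iff[OF W])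
  show ?thesis unfolding W_def[symmetric] by (rule W.internal_direct_sum_if_projections[OF sub psW])
qed

lemma co_prime_decomposition_if_summands_co_retractable:
  assumes DB: "dual_Baer R M" and CR: "summands_co_retractable R M"
  obtains I :: "'b set set" and N where "co_prime_decomposition R M I N"
proof -
  have co_ret: "co_retractable R (M\<lparr>carrier := X\<rparr>)" if "direct_summand R X M" for X
    using CR that by (simp add: summands_co_retractable_def)
  obtain \<Z> where mem: "\<And>Z. Z \<in> \<Z> \<Longrightarrow> direct_summand R Z M \<and> indecomposable R (M\<lparr>carrier := Z\<rparr>)"
    and ind: "independent_submodules R M \<Z>" and gen: "generated_submodule R M (\<Union>\<Z>) = carrier M"
    using indecomposable_decomposition[OF DB] by metis
  have sm: "direct_summand R Z M" and ic: "indecomposable R (M\<lparr>carrier := Z\<rparr>)" and sub: "submodule Z R M"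
    if "Z \<in> \<Z>" for Z using mem[OF that] direct_summandD by auto
  have nz: "\<exists>z\<in>Z. z \<noteq> \<zero>\<^bsub>M\<^esub>" if "Z \<in> \<Z>" for Z
    using ic[OF that] submoduleD(3)[OF sub[OF that]] by (auto simp: indecomposable_carrier_update_iff[OF sub[OF that]])
  obtain \<pi> where ps: "projection_system R M \<Z> (\<lambda>Z. Z) \<pi>"
    using independent_projection_system[OF sub ind gen] by metis
  have \<pi>: "linear_on R M (carrier M) Z (\<pi> Z)" if "Z \<in> \<Z>" for Z
    using ps that by (simp add: projection_system_def)
  have faithful: "\<exists>Z\<in>\<Z>. \<pi> Z x \<noteq> \<zero>\<^bsub>M\<^esub>" if "x \<in> carrier M" "x \<noteq> \<zero>\<^bsub>M\<^esub>" for x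
    using projections_faithful[of \<Z> "\<lambda>Z. Z", OF sub ps] that by blast
  have onto: "f ` X = Z" if "direct_summand R X M" "Z \<in> \<Z>" "linear_on R M X Z f" "x \<in> X" "f x \<noteq> \<zero>\<^bsub>M\<^esub>" for X Z f x
    using image_indecomposable[OF DB that(1) sub[OF that(2)] ic[OF that(2)] that(3-5)] .
  \<comment> \<open>Co-retractability gives a non-zero endomorphism of \<open>Z\<close> that kills
    \<open>Y\<close>, and it is onto because \<open>Z\<close> is indecomposable. This serves both
    co-compressibility and the symmetry of \<open>epi\<close>.\<close>
  have compress: "\<exists>f. linear_on R M Z Z f \<and> (\<forall>y\<in>Y. f y = \<zero>\<^bsub>M\<^esub>) \<and> f ` Z = Z"
    if Z: "Z \<in> \<Z>" and Y: "submodule Y R M" "Y \<subseteq> Z" "Y \<noteq> Z" for Y Z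
  proof -
    obtain f x where f: "linear_on R M Z Z f" "\<And>y. y \<in> Y \<Longrightarrow> f y = \<zero>\<^bsub>M\<^esub>" "x \<in> Z" "f x \<noteq> \<zero>\<^bsub>M\<^esub>"
      using co_retractableD[OF co_ret[OF sm[OF Z]] sub[OF Z] Y] by blast
    then show ?thesis using onto[OF sm[OF Z] Z f(1,3,4)] by blast
  qed
  define epi where "epi Z Z' \<longleftrightarrow> (\<exists>f. linear_on R M Z Z' f \<and> f ` Z = Z')" for Z Z'
  have epi_refl: "epi Z Z" for Z unfolding epi_def using linear_on_id[of Z Z R M] by (intro exI[of _ "\<lambda>x. x"]) simp
  have epi_trans: "epi Z Z''" if e: "epi Z Z'" "epi Z' Z''" for Z Z' Z''
  proof -
    obtain f g where "linear_on R M Z Z' f" "f ` Z = Z'" "linear_on R M Z' Z'' g" "g ` Z' = Z''"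
      using e by (auto simp: epi_def)
    then show ?thesis unfolding epi_def using linear_on_compose[of R M Z Z' f Z'' g]
      by (intro exI[of _ "\<lambda>x. g (f x)"]) (simp add: image_image[symmetric])
  qed
  have epi_sym: "epi Z' Z" if Z: "Z \<in> \<Z>" and Z': "Z' \<in> \<Z>" and e: "epi Z Z'" for Z Z'
  proof -
    obtain f where f: "linear_on R M Z Z' f" "f ` Z = Z'" using e by (auto simp: epi_def)
    txt \<open>\<open>Z\<close> is an image of \<open>Z / ?K\<close>, and \<open>f\<close> identifies the latter with \<open>Z'\<close>.\<close>
    let ?K = "{x \<in> Z. f x = \<zero>\<^bsub>M\<^esub>}"
    have K: "submodule ?K R M" by (rule submodule_kernel[OF f(1) sub[OF Z] sub[OF Z']])
    obtain z where "z \<in> Z'" "z \<noteq> \<zero>\<^bsub>M\<^esub>" using nz[OF Z'] by blast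
    then have KZ: "?K \<noteq> Z" using f(2) by blast
    obtain h where h: "linear_on R M Z Z h" "\<forall>y\<in>?K. h y = \<zero>\<^bsub>M\<^esub>" "h ` Z = Z"
      using compress[OF Z K _ KZ] by blast
    obtain g where g: "linear_on R M Z' Z g" "\<And>x. x \<in> Z \<Longrightarrow> g (f x) = h x"
      using linear_on_factor[OF f(1) sub[OF Z] sub[OF Z'] f(2) h(1) sub[OF Z]] h(2) by blast
    have "g ` Z' = h ` Z" unfolding f(2)[symmetric] image_image using g(2) by (rule image_cong[OF refl])
    then show ?thesis using g(1) h(3) by (auto simp: epi_def)
  qed
  have "\<exists>I\<subseteq>\<Z>. (\<forall>Z\<in>\<Z>. \<exists>Y\<in>I. epi Y Z) \<and> (\<forall>Y\<in>I. \<forall>Z\<in>I. epi Y Z \<longrightarrow> Y = Z)"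
    by (rule equivalence_transversal[of \<Z> epi, OF epi_refl epi_sym epi_trans])
  then obtain I where I: "I \<subseteq> \<Z>" "\<And>Z. Z \<in> \<Z> \<Longrightarrow> \<exists>Y\<in>I. epi Y Z"
      "\<And>Y Z. Y \<in> I \<Longrightarrow> Z \<in> I \<Longrightarrow> epi Y Z \<Longrightarrow> Y = Z"
    by (elim exE conjE) simp
  define cl where "cl Y = {Z \<in> \<Z>. epi Y Z}" for Y
  define N where "N Y = generated_submodule R M (\<Union>(cl Y))" for Y
  have cl: "cl Y \<subseteq> \<Z>" for Y by (auto simp: cl_def)
  have cl_epi: "epi Z Z'" if "Y \<in> I" "Z \<in> cl Y" "Z' \<in> cl Y" for Y Z Z'
    using that I(1) epi_sym[of Y Z] epi_trans[of Z Y Z'] by (auto simp: cl_def)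
  \<comment> \<open>Otherwise \<open>Y\<close>, \<open>Z\<close>, \<open>Z'\<close>,
    \<open>Y'\<close> would be linked by epimorphisms, the last one obtained by symmetry, although
    \<open>I\<close> has only one member per class.\<close>
  have dis: "\<not> epi Z Z'" if "Y \<in> I" "Y' \<in> I" "Y \<noteq> Y'" "Z \<in> cl Y" "Z' \<in> cl Y'" for Y Y' Z Z'
  proof
    assume "epi Z Z'"
    then have "epi Y Z'" using that(4) epi_trans[of Y Z Z'] by (simp add: cl_def)
    moreover have "epi Z' Y'" using that(2,5) I(1) epi_sym[of Y' Z'] by (auto simp: cl_def)
    ultimately show False using epi_trans[of Y Z' Y'] I(3) that(1-3) by blast
  qed
  have N: "direct_sum_of_two R M (N Y) (generated_submodule R M (\<Union>(\<Z> - cl Y))) (carrier M)" for Y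
    unfolding N_def by (rule partial_sum_complement[OF ps cl])
  have NM: "direct_summand R (N Y) M" for Y using N[of Y] by (auto simp: direct_summand_iff)
  have sN: "submodule (N Y) R M" for Y by (rule direct_summandD[OF NM])
  have ZN: "Z \<subseteq> N Y" if "Z \<in> cl Y" for Y Z
    unfolding N_def using that generated_superset[of "\<Union>(cl Y)"] by blast
  have zero: "\<pi> Z x = \<zero>\<^bsub>M\<^esub>" if "Z \<in> \<Z>" "Z \<notin> cl Y" "x \<in> N Y" for Z Y x
    using partial_sum_projection_zero[OF ps cl, of Z Y x] that by (simp add: N_def)

  have ids: "is_internal_direct_sum R M I N"
  proof -
    \<comment> \<open>The projection onto \<open>N Y\<close> is taken along the sum of all members
      outside the class of \<open>Y\<close>; this sum contains every other \<open>N Y'\<close>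
      because the classes are disjoint.\<close>
    have "\<forall>Y. \<exists>p. linear_on R M (carrier M) (N Y) p \<and> (\<forall>x\<in>N Y. p x = x) \<and>
        (\<forall>x\<in>generated_submodule R M (\<Union>(\<Z> - cl Y)). p x = \<zero>\<^bsub>M\<^esub>)"
      using direct_sum_of_two_projection[OF N] by metis
    then obtain \<rho> where \<rho>: "linear_on R M (carrier M) (N Y) (\<rho> Y)" "\<forall>x\<in>N Y. \<rho> Y x = x"
        "\<forall>x\<in>generated_submodule R M (\<Union>(\<Z> - cl Y)). \<rho> Y x = \<zero>\<^bsub>M\<^esub>" for Y
      by metis
    have "\<rho> Y x = \<zero>\<^bsub>M\<^esub>" if "Y \<in> I" "Y' \<in> I" "Y \<noteq> Y'" "x \<in> N Y'" for Y Y' x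
    proof -
      have "cl Y' \<subseteq> \<Z> - cl Y" using dis[OF that(1-3)] epi_refl cl by blast
      then have "N Y' \<subseteq> generated_submodule R M (\<Union>(\<Z> - cl Y))"
        unfolding N_def by (intro generated_mono Union_mono)
      then show ?thesis using \<rho>(3) that(4) by blast
    qed
    moreover have "L = carrier M" if L: "submodule L R M" "\<forall>Y\<in>I. N Y \<subseteq> L" for L
    proof -
      have "Z \<subseteq> L" if Z: "Z \<in> \<Z>" for Z
      proof -
        obtain Y where Y: "Y \<in> I" "epi Y Z" using I(2)[OF Z] by blast
        then have "Z \<subseteq> N Y" using Z by (intro ZN) (simp add: cl_def)
        then show ?thesis using L(2) Y(1) by blast
      qed
      then show ?thesis using ps L(1) by (simp add: projection_system_def)
    qed
    ultimately have ps\<rho>: "projection_system R M I N \<rho>"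
      using \<rho>(1,2) sN by (simp add: projection_system_def)
    show ?thesis by (rule internal_direct_sum_if_projections[OF sN ps\<rho>])
  qed

  have hom0: "mod_hom R (M\<lparr>carrier := N Y\<rparr>) (M\<lparr>carrier := N Y'\<rparr>) =
      {zero_hom (M\<lparr>carrier := N Y\<rparr>) (M\<lparr>carrier := N Y'\<rparr>)}" (is "?H = {?z}")
    if Y: "Y \<in> I" "Y' \<in> I" "Y \<noteq> Y'" for Y Y'
  proof
    show "{?z} \<subseteq> ?H"
      using zero_hom_in_mod_hom[OF submodule_is_right_module[OF sN] submodule_is_right_module[OF sN]] by simp
    show "?H \<subseteq> {?z}"
    proof (rule ccontr)
      assume "\<not> ?H \<subseteq> {?z}"
      then obtain f where f: "f \<in> ?H" "f \<noteq> ?z" by blast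
      then obtain x where x: "x \<in> N Y" "f x \<noteq> \<zero>\<^bsub>M\<^esub>" using mod_hom_nonzeroE[OF f] by auto
      have fl: "linear_on R M (N Y) (N Y') f" by (rule mod_hom_imp_linear_on[OF f(1)])
      \<comment> \<open>A non-zero value of \<open>f\<close> on a member \<open>Z\<close> is visible
        in some \<open>Z'\<close> of the other class, and then \<open>Z\<close> maps onto
        \<open>Z'\<close>, contrary to \<open>dis\<close>. So \<open>f\<close> kills the members
        that generate \<open>N Y\<close>.\<close>
      have "f z = \<zero>\<^bsub>M\<^esub>" if Z: "Z \<in> cl Y" and z: "z \<in> Z" for Z z
      proof (rule ccontr)
        assume fz: "f z \<noteq> \<zero>\<^bsub>M\<^esub>"
        have zN: "f z \<in> N Y'" using linear_on_closed[OF fl] ZN[OF Z] z by blast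
        obtain Z' where Z': "Z' \<in> \<Z>" "\<pi> Z' (f z) \<noteq> \<zero>\<^bsub>M\<^esub>"
          using faithful[OF submoduleD(2)[OF sN zN] fz] by blast
        have "Z' \<in> cl Y'" using zero[OF Z'(1) _ zN] Z'(2) by blast
        moreover have "epi Z Z'"
        proof -
          have "linear_on R M Z Z' (\<lambda>x. \<pi> Z' (f x))"
            by (rule linear_on_compose[OF linear_on_subset[OF fl ZN[OF Z] submoduleD(1)[OF sN]] \<pi>[OF Z'(1)]])
          moreover have "(\<lambda>x. \<pi> Z' (f x)) ` Z = Z'"
            using onto[OF sm Z'(1) calculation z Z'(2)] Z cl by blast
          ultimately show ?thesis by (auto simp: epi_def)
        qed
        ultimately show False using dis[OF Y Z] by blast
      qed
      then have "\<Union>(cl Y) \<subseteq> {x \<in> N Y. f x = \<zero>\<^bsub>M\<^esub>}" using ZN by blast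
      then have "generated_submodule R M (\<Union>(cl Y)) \<subseteq> {x \<in> N Y. f x = \<zero>\<^bsub>M\<^esub>}"
        by (rule generated_least[OF submodule_kernel[OF fl sN sN]])
      then show False using x by (auto simp: N_def)
    qed
  qed

  have cp: "co_prime R (M\<lparr>carrier := N Y\<rparr>)" if Y: "Y \<in> I" for Y
  proof (rule co_primeI[OF sN])
    fix L assume L: "submodule L R M" "L \<subseteq> N Y" "L \<noteq> N Y"
    obtain f x where f: "linear_on R M (N Y) (N Y) f" "\<And>y. y \<in> L \<Longrightarrow> f y = \<zero>\<^bsub>M\<^esub>" "x \<in> N Y" "f x \<noteq> \<zero>\<^bsub>M\<^esub>"
      using co_retractableD[OF co_ret[OF NM] sN L] by blast
    have fx: "f x \<in> N Y" by (rule linear_on_closed[OF f(1,3)])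
    obtain Z where Z: "Z \<in> \<Z>" "\<pi> Z (f x) \<noteq> \<zero>\<^bsub>M\<^esub>"
      using faithful[OF submoduleD(2)[OF sN fx] f(4)] by blast
    have ZY: "Z \<in> cl Y" using zero[OF Z(1) _ fx] Z(2) by blast
    have g: "linear_on R M (N Y) Z (\<lambda>x. \<pi> Z (f x))"
      by (rule linear_on_compose[OF linear_on_subset[OF f(1) order_refl submoduleD(1)[OF sN]] \<pi>[OF Z(1)]])
    have im: "(\<lambda>x. \<pi> Z (f x)) ` N Y = Z" by (rule onto[OF NM Z(1) g f(3) Z(2)])
    \<comment> \<open>The map \<open>x \<mapsto> \<pi> Z (f x)\<close> kills \<open>L\<close> and is
      onto \<open>Z\<close>. Following it by epimorphisms from \<open>Z\<close> to the members of
      the class produces each of them as an image, and together they generate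
      \<open>N Y\<close>.\<close>
    define H where "H = {\<lambda>x. k (\<pi> Z (f x)) | k Z'. Z' \<in> cl Y \<and> linear_on R M Z Z' k \<and> k ` Z = Z'}"
    have "linear_on R M (N Y) (N Y) h \<and> (\<forall>y\<in>L. h y = \<zero>\<^bsub>M\<^esub>)" if "h \<in> H" for h
    proof -
      obtain k Z' where k: "h = (\<lambda>x. k (\<pi> Z (f x)))" "Z' \<in> cl Y" "linear_on R M Z Z' k"
        using \<open>h \<in> H\<close> unfolding H_def by blast
      have Z': "Z' \<in> \<Z>" using k(2) cl by blast
      have "linear_on R M (N Y) (N Y) h"
        unfolding k(1) by (rule linear_on_subset[OF linear_on_compose[OF g k(3)] order_refl ZN[OF k(2)]])
      moreover have "h y = \<zero>\<^bsub>M\<^esub>" if "y \<in> L" for y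
        using f(2)[OF that] linear_on_zero[OF \<pi>[OF Z(1)] submodule_carrier submoduleD(1)[OF sub[OF Z(1)]]]
          linear_on_zero[OF k(3) sub[OF Z(1)] submoduleD(1)[OF sub[OF Z']]] by (simp add: k(1))
      ultimately show ?thesis by blast
    qed
    moreover have "N Y \<subseteq> L'" if L': "submodule L' R M" "\<forall>h\<in>H. h ` N Y \<subseteq> L'" for L'
    proof -
      have "Z' \<subseteq> L'" if Z': "Z' \<in> cl Y" for Z'
      proof -
        obtain k where k: "linear_on R M Z Z' k" "k ` Z = Z'" using cl_epi[OF Y ZY Z'] by (auto simp: epi_def)
        then have "(\<lambda>x. k (\<pi> Z (f x))) \<in> H" unfolding H_def using Z' by blast
        then have "(\<lambda>x. k (\<pi> Z (f x))) ` N Y \<subseteq> L'" using L'(2) by (rule bspec[rotated])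
        moreover have "(\<lambda>x. k (\<pi> Z (f x))) ` N Y = Z'" using im k(2) by (metis image_image)
        ultimately show ?thesis by simp
      qed
      then show ?thesis unfolding N_def by (intro generated_least L'(1)) blast
    qed
    ultimately show "\<exists>H. (\<forall>h\<in>H. linear_on R M (N Y) (N Y) h \<and> (\<forall>y\<in>L. h y = \<zero>\<^bsub>M\<^esub>)) \<and>
        (\<forall>L'. submodule L' R M \<longrightarrow> (\<forall>h\<in>H. h ` N Y \<subseteq> L') \<longrightarrow> N Y \<subseteq> L')"
      by (intro exI[of _ H]) simp
  qed

  have "sum_of_epi_invariant_co_compressibles R (M\<lparr>carrier := N Y\<rparr>)" if Y: "Y \<in> I" for Y
    unfolding sum_of_epi_invariant_co_compressibles_def
  proof (intro exI[of _ "cl Y"] exI[of _ "\<lambda>Z. Z"] conjI ballI)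
    show "is_internal_direct_sum R (M\<lparr>carrier := N Y\<rparr>) (cl Y) (\<lambda>Z. Z)"
      unfolding N_def by (rule partial_sum_internal_direct_sum[OF ps cl])
    fix Z assume Z: "Z \<in> cl Y"
    have Z': "Z \<in> \<Z>" using Z cl by blast
    \<comment> \<open>The two updates arise because the members are taken as submodules of
      \<open>N Y\<close>; the outer one prevails, so the facts about \<open>Z\<close> inside
      \<open>M\<close> apply.\<close>
    show "indecomposable R (M\<lparr>carrier := N Y, carrier := Z\<rparr>)" using ic[OF Z'] by simp
    have "co_compressible R (M\<lparr>carrier := Z\<rparr>)"
      by (rule co_compressibleI[OF sub[OF Z']]) (rule compress[OF Z'])
    then show "co_compressible R (M\<lparr>carrier := N Y, carrier := Z\<rparr>)" by simp
    fix Z2 assume Z2: "Z2 \<in> cl Y"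
    have "Z2 \<in> \<Z>" using Z2 cl by blast
    then have "epi_invariant R (M\<lparr>carrier := Z\<rparr>) (M\<lparr>carrier := Z2\<rparr>)"
      using cl_epi[OF Y Z Z2] cl_epi[OF Y Z2 Z] sub Z'
      by (simp add: epi_invariant_def hom_image_carrier_update_iff epi_def)
    then show "epi_invariant R (M\<lparr>carrier := N Y, carrier := Z\<rparr>) (M\<lparr>carrier := N Y, carrier := Z2\<rparr>)" by simp
  qed
  then have "co_prime_decomposition R M I N"
    using ids cp hom0 by (simp add: co_prime_decomposition_def)
  then show ?thesis by (rule that)
qed

end

theorem theorem3p11:
  fixes R :: "'a ring" and M :: "('a, 'b) module"
  assumes "right_module R M"
    and "nonzero_module M"
    and "dual_Baer R M"
  shows "(summands_co_retractable R M \<longrightarrow>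
            (\<exists>(I :: 'b set set) N. co_prime_decomposition R M I N)) \<and>
         (\<forall>(I :: 'i set) N. finite I \<and> co_prime_decomposition R M I N \<longrightarrow>
            summands_co_retractable R M)"
proof (intro conjI impI allI)
  interpret right_module R M by fact
  show "\<exists>(I :: 'b set set) N. co_prime_decomposition R M I N" if "summands_co_retractable R M"
    using co_prime_decomposition_if_summands_co_retractable[OF assms(3) that] by blast
  show "summands_co_retractable R M" if "finite I \<and> co_prime_decomposition R M I N" for I :: "'i set" and N
    using that summands_co_retractable_if_finite_co_prime_decomposition by blast
qed

end
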